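(* Let $d=1$, let $(\Omega,\mathcal F,\mathbb P)$ carry a measure-preserving ergodic action $(\tau_k)_{k\in\mathbb Z}$ of $\mathbb Z$, let $a_{per},c_{per}$ be $1$-periodic measurable real functions, and for $\eta>0$ let $b_\eta$ be a stationary scalar random field with $a_\eta=a_{per}+b_\eta c_{per}$. Assume there is $M>0$ with $\|b_\eta\|_{L^\infty([-\frac12,\frac12]\times\Omega)}\le M$ for all $\eta$, and $0<\alpha\le\beta$ with $\alpha\le a_{per}(x)\le\beta$ and $\alpha\le a_{per}(x)+sc_{per}(x)\le\beta$ for a.e. $x$ and all $s\in[-M,M]$. Assume that for some $p>1$, $m_\eta:=\|b_\eta\|_{L^\infty([-\frac12,\frac12];L^p(\Omega))}\to0$ as $\eta\to0$. Then there is a subsequence of $\eta$ (still denoted $\eta$) such that $b_\eta/m_\eta$ converges weakly-$*$ in $L^\infty([-\frac12,\frac12];L^p(\Omega))$ to a limit $\bar b_0$, and along it: - $\frac{d}{dx}w^\eta=\frac{d}{dx}w^0+m_\eta\frac{d}{dx}v^0+o(m_\eta)$ weakly in $L^2([-\frac12,\frac12];L^p(\Omega))$, where $w^0$ is the periodic corrector and $v^0$ solves $-\frac{d}{dx}(a_{per}\frac{d}{dx}v^0)=\frac{d}{dx}\big(\bar b_0c_{per}(\frac{d}{dx}w^0+1)\big)$ in $\mathbb R$, $\frac{d}{dx}v^0$ stationary, $\mathbb E\int_{-1/2}^{1/2}\frac{d}{dx}v^0=0$; - $a_\eta^*=a_{per}^*+m_\eta\int_{-1/2}^{1/2}\mathbb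 E(\bar b_0)c_{per}(\frac{d}{dx}w^0+1)+m_\eta\int_{-1/2}^{1/2}a_{per}\frac{d}{dx}\mathbb E(v^0)+o(m_\eta)$.
   Context: Stationary means $F(x+k,\omega)=F(x,\tau_k\omega)$ for $k\in\mathbb Z$. The stochastic corrector $w^\eta$ solves $-\frac{d}{dx}(a_\eta(\frac{d}{dx}w^\eta+1))=0$ in $\mathbb R$ with $\frac{d}{dx}w^\eta$ stationary and $\mathbb E\int_{-1/2}^{1/2}\frac{d}{dx}w^\eta=0$; $a_\eta^*=\mathbb E\int_{-1/2}^{1/2}a_\eta(\frac{d}{dx}w^\eta+1)$. The periodic corrector $w^0$ is the $1$-periodic solution of $-\frac{d}{dx}(a_{per}(\frac{d}{dx}w^0+1))=0$, and $a_{per}^*=\int_{-1/2}^{1/2}a_{per}(\frac{d}{dx}w^0+1)$. *)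

theory Defs
  imports "HOL-Probability.Probability"
begin

definition cell :: "real measure" where
  "cell = restrict_space lborel {-1/2..1/2}"

definition ergodic_Z_action :: "'a measure \<Rightarrow> (int \<Rightarrow> 'a \<Rightarrow> 'a) \<Rightarrow> bool" where
  "ergodic_Z_action M \<tau> \<longleftrightarrow>
     prob_space M \<and>
     (\<forall>k. \<tau> k \<in> M \<rightarrow>\<^sub>M M \<and> distr M M (\<tau> k) = M) \<and>
     (\<forall>\<omega>\<in>space M. \<tau> 0 \<omega> = \<omega>) \<and>
     (\<forall>j k. \<forall>\<omega>\<in>space M. \<tau> (j + k) \<omega> = \<tau> j (\<tau> k \<omega>)) \<and>
     (\<forall>A\<in>sets M. (\<forall>k. \<tau> k -` A \<inter> space M = A) \<longrightarrow>
        measure M A = 0 \<or> measure M A = 1)"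

definition stationary :: "'a measure \<Rightarrow> (int \<Rightarrow> 'a \<Rightarrow> 'a) \<Rightarrow> (real \<Rightarrow> 'a \<Rightarrow> real) \<Rightarrow> bool" where
  "stationary M \<tau> F \<longleftrightarrow> (\<forall>k x. \<forall>\<omega>\<in>space M. F (x + real_of_int k) \<omega> = F x (\<tau> k \<omega>))"

definition field_measurable :: "'a measure \<Rightarrow> (real \<Rightarrow> 'a \<Rightarrow> real) \<Rightarrow> bool" where
  "field_measurable M F \<longleftrightarrow> (\<lambda>z. F (fst z) (snd z)) \<in> borel_measurable (lborel \<Otimes>\<^sub>M M)"

definition test_fun :: "(real \<Rightarrow> real) \<Rightarrow> bool" where
  "test_fun \<phi> \<longleftrightarrow> (\<forall>n. (deriv ^^ n) \<phi> differentiable_on UNIV) \<and>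
                   (\<exists>R. \<forall>x. R \<le> \<bar>x\<bar> \<longrightarrow> \<phi> x = 0)"

definition has_weak_deriv :: "(real \<Rightarrow> real) \<Rightarrow> (real \<Rightarrow> real) \<Rightarrow> bool" where
  "has_weak_deriv f g \<longleftrightarrow>
     (\<forall>a b. set_integrable lborel {a..b} f \<and> set_integrable lborel {a..b} g) \<and>
     (\<forall>\<phi>. test_fun \<phi> \<longrightarrow>
        (\<integral>x. f x * deriv \<phi> x \<partial>lborel) = - (\<integral>x. g x * \<phi> x \<partial>lborel))"

definition weakly_divfree :: "(real \<Rightarrow> real) \<Rightarrow> bool" where
  "weakly_divfree F \<longleftrightarrow> (\<forall>\<phi>. test_fun \<phi> \<longrightarrow> (\<integral>x. F x * deriv \<phi> x \<partial>lborel) = 0)"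

definition stoch_corrector ::
  "'a measure \<Rightarrow> (int \<Rightarrow> 'a \<Rightarrow> 'a) \<Rightarrow> (real \<Rightarrow> 'a \<Rightarrow> real) \<Rightarrow>
   (real \<Rightarrow> 'a \<Rightarrow> real) \<Rightarrow> (real \<Rightarrow> 'a \<Rightarrow> real) \<Rightarrow> bool" where
  "stoch_corrector M \<tau> a w Dw \<longleftrightarrow>
     field_measurable M w \<and> field_measurable M Dw \<and> stationary M \<tau> Dw \<and>
     integrable (cell \<Otimes>\<^sub>M M) (\<lambda>z. Dw (fst z) (snd z)) \<and>
     (AE \<omega> in M. has_weak_deriv (\<lambda>x. w x \<omega>) (\<lambda>x. Dw x \<omega>) \<and>
                 weakly_divfree (\<lambda>x. a x \<omega> * (Dw x \<omega> + 1))) \<and>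
     (\<integral>z. Dw (fst z) (snd z) \<partial>(cell \<Otimes>\<^sub>M M)) = 0"

definition per_corrector :: "(real \<Rightarrow> real) \<Rightarrow> (real \<Rightarrow> real) \<Rightarrow> (real \<Rightarrow> real) \<Rightarrow> bool" where
  "per_corrector a w Dw \<longleftrightarrow>
     w \<in> borel_measurable lborel \<and> (\<forall>x. w (x + 1) = w x) \<and>
     has_weak_deriv w Dw \<and> weakly_divfree (\<lambda>x. a x * (Dw x + 1))"

definition Lp_finite :: "'a measure \<Rightarrow> real \<Rightarrow> ('a \<Rightarrow> real) \<Rightarrow> bool" where
  "Lp_finite M p f \<longleftrightarrow> (\<integral>\<^sup>+\<omega>. ennreal (\<bar>f \<omega>\<bar> powr p) \<partial>M) < \<infinity>"

definition Lp_norm :: "'a measure \<Rightarrow> real \<Rightarrow> ('a \<Rightarrow> real) \<Rightarrow> real" where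
  "Lp_norm M p f = (enn2real (\<integral>\<^sup>+\<omega>. ennreal (\<bar>f \<omega>\<bar> powr p) \<partial>M)) powr (1 / p)"

definition Linf_Lp_norm :: "'a measure \<Rightarrow> real \<Rightarrow> (real \<Rightarrow> 'a \<Rightarrow> real) \<Rightarrow> ereal" where
  "Linf_Lp_norm M p F =
     (if AE x in cell. Lp_finite M p (F x)
      then esssup cell (\<lambda>x. ereal (Lp_norm M p (F x))) else \<infinity>)"

definition in_Lr_Lq :: "'a measure \<Rightarrow> real \<Rightarrow> real \<Rightarrow> (real \<Rightarrow> 'a \<Rightarrow> real) \<Rightarrow> bool" where
  "in_Lr_Lq M r q G \<longleftrightarrow>
     (\<lambda>z. G (fst z) (snd z)) \<in> borel_measurable (cell \<Otimes>\<^sub>M M) \<and>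
     (AE x in cell. Lp_finite M q (G x)) \<and>
     (\<integral>\<^sup>+x. ennreal (Lp_norm M q (G x) powr r) \<partial>cell) < \<infinity>"

definition pair :: "'a measure \<Rightarrow> (real \<Rightarrow> 'a \<Rightarrow> real) \<Rightarrow> (real \<Rightarrow> 'a \<Rightarrow> real) \<Rightarrow> real" where
  "pair M F G = (\<integral>z. F (fst z) (snd z) * G (fst z) (snd z) \<partial>(cell \<Otimes>\<^sub>M M))"

end

theory Submission
  imports Defs "HOL-Library.Diagonal_Subsequence"
begin

text \<open>In one dimension the corrector equation says that the flux \<open>a\<^sub>\<eta> (Dw\<^sup>\<eta> + 1)\<close> is constant in
  space for almost every \<open>\<omega>\<close> (du Bois-Reymond). By stationarity this constant is shift invariant,
  hence deterministic by ergodicity, and the mean-zero condition gives \<open>Dw\<^sup>\<eta> + 1 = a\<^sup>*\<^sub>\<eta> / a\<^sub>\<eta>\<close> with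
  \<open>1 / a\<^sup>*\<^sub>\<eta> = \<bbbE> \<integral> 1 / a\<^sub>\<eta>\<close>. Expanding \<open>1 / a\<^sub>\<eta>\<close> around \<open>1 / a\<^sub>p\<^sub>e\<^sub>r\<close> produces a term linear in
  \<open>b\<^sub>\<eta> / m\<^sub>\<eta>\<close>, which passes to the weak-* limit, and a remainder controlled by
  \<open>\<bbbE> \<integral> \<bar>b\<^sub>\<eta> / m\<^sub>\<eta>\<bar> \<bar>b\<^sub>\<eta>\<bar>\<close>, which vanishes by truncation because \<open>b\<^sub>\<eta>\<close> is bounded and \<open>p > 1\<close>.

  The probability space need not be separable, so the weak limit is not obtained from a countable
  dense set of test functions. Instead a subsequence is chosen along which the Gram matrix of
  the truncations of \<open>b\<^sub>\<eta> / m\<^sub>\<eta>\<close> converges; this forces convergence against every bounded test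
  function, and the limit functional has a density by the Radon-Nikodym theorem.\<close>

section \<open>Smooth test functions and weak derivatives\<close>

text \<open>The equations are posed against compactly supported C^\<infinity> functions, with
  smoothness defined through iterated \<open>deriv\<close>; concrete flat exponentials and their
  antiderivatives are therefore built before any equation can be exploited. The corrector v^0 is not
  obtained by a variational argument: its derivative is given in closed form and integrated. As p
  may be smaller than 2, the second-order term need not be O(m^2) even in mean, so only o(m)
  survives and the limits are qualitative. The subsequence is extracted on the cell times \<Omega>
  against bounded test functions. The larger class L^1(L^q) is reached because every normalised
  field lies in the unit ball of L^\<infinity>(L^p) and the weak limit lies there too, which demands
  an argument localised in x. A weak limit on the cell carries no information about translates, so
  stationarity is restored by extending it along the action.\<close>

definition exp_flat :: "real poly \<Rightarrow> real \<Rightarrow> real" where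
  "exp_flat P x = (if x > 0 then poly P (1 / x) * exp (- 1 / x) else 0)"

lemma poly_times_exp_neg_tendsto_0:
  "((\<lambda>y::real. poly P y * exp (- y)) \<longlongrightarrow> 0) at_top"
proof -
  have "((\<lambda>y. \<Sum>i\<le>degree P. coeff P i * (y ^ i / exp y)) \<longlongrightarrow> (\<Sum>i\<le>degree P. coeff P i * 0)) at_top"
    by (intro tendsto_sum tendsto_mult tendsto_const tendsto_power_div_exp_0)
  then show ?thesis
    by (simp add: poly_altdef sum_distrib_right exp_minus divide_inverse mult.assoc)
qed

text \<open>With y = 1/x, differentiating P(y) exp(-y) gives y^2 (P - P')(y) exp(-y). The family of
  all \<open>exp_flat P\<close> is thus closed under differentiation, and the polynomial parameter
  avoids any formula for the n-th derivative.\<close>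

lemma has_real_derivative_exp_flat:
  "(exp_flat P has_real_derivative exp_flat ([:0, 0, 1:] * (P - pderiv P)) x) (at x)"
proof -
  consider "x < 0" | "x = 0" | "x > 0" by linarith
  then show ?thesis
  proof cases
    case 1
    have "((\<lambda>_. 0) has_real_derivative 0) (at x)" by simp
    then have "(exp_flat P has_real_derivative 0) (at x)"
      by (rule has_field_derivative_transform_within_open[of _ _ _ "{..<0}"])
         (use 1 in \<open>auto simp: exp_flat_def\<close>)
    then show ?thesis using 1 by (simp add: exp_flat_def)
  next
    case 3
    have "((\<lambda>x. poly P (1 / x) * exp (- 1 / x)) has_real_derivative
        (poly (pderiv P) (1 / x) * (- 1 / x\<^sup>2)) * exp (- 1 / x) + exp (- 1 / x) * (1 / x\<^sup>2) * poly P (1 / x)) (at x)"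
      using 3 by (auto intro!: derivative_eq_intros DERIV_chain2[OF poly_DERIV] simp: power2_eq_square)
    then have "((\<lambda>x. poly P (1 / x) * exp (- 1 / x)) has_real_derivative
        exp_flat ([:0, 0, 1:] * (P - pderiv P)) x) (at x)"
      using 3 by (simp add: exp_flat_def power2_eq_square algebra_simps)
    then show ?thesis
      by (rule has_field_derivative_transform_within_open[of _ _ _ "{0<..}"])
         (use 3 in \<open>auto simp: exp_flat_def\<close>)
  next
    case 2
    \<comment> \<open>The division by h in the difference quotient is absorbed as one more power of
      1/h, whence \<open>pCons 0 P\<close>.\<close>
    have "((\<lambda>h. poly (pCons 0 P) (inverse h) * exp (- inverse h)) \<longlongrightarrow> 0) (at_right 0)"
      by (rule filterlim_compose[OF poly_times_exp_neg_tendsto_0 filterlim_inverse_at_top_right])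
    then have "((\<lambda>h. exp_flat P h / h) \<longlongrightarrow> 0) (at_right 0)"
      by (rule Lim_transform_eventually)
         (auto simp: exp_flat_def field_simps eventually_at_right_field intro!: exI[of _ 1])
    moreover have "((\<lambda>h. exp_flat P h / h) \<longlongrightarrow> 0) (at_left 0)"
      by (rule Lim_transform_eventually[OF tendsto_const])
         (auto simp: exp_flat_def eventually_at_left_field intro!: exI[of _ "-1"])
    ultimately have "((\<lambda>h. exp_flat P h / h) \<longlongrightarrow> 0) (at 0)"
      by (simp add: filterlim_at_split)
    then show ?thesis
      using 2 unfolding has_field_derivative_iff by (simp add: exp_flat_def)
  qed
qed

section \<open>Smooth functions and a smooth step\<close>

definition smooth :: "(real \<Rightarrow> real) \<Rightarrow> bool" where
  "smooth f \<longleftrightarrow> (\<forall>n. (deriv ^^ n) f differentiable_on UNIV)"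

text \<open>A set in which every member has its derivative contains all iterated derivatives of its
  members. The closure properties below only have to name such a set.\<close>

lemma smooth_coinduct:
  assumes S: "\<And>f. f \<in> S \<Longrightarrow> \<exists>f'\<in>S. \<forall>x. (f has_real_derivative f' x) (at x)" and f: "f \<in> S"
  shows "smooth f"
proof -
  have "(deriv ^^ n) f \<in> S" for n
  proof (induction n)
    case (Suc n)
    from S[OF this] obtain f' where "f' \<in> S" "\<And>x. ((deriv ^^ n) f has_real_derivative f' x) (at x)" by blast
    then show ?case using DERIV_imp_deriv by (metis (no_types, lifting) ext comp_def funpow.simps(2))
  qed (use f in simp)
  then show ?thesis unfolding smooth_def differentiable_on_def
    using S by (metis differentiable_at_withinI real_differentiable_def)
qed

lemma smooth_if_has_derivative:
  assumes "\<And>x. (f has_real_derivative f' x) (at x)" "smooth f'"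
  shows "smooth f"
  unfolding smooth_def
proof
  fix n
  have d: "deriv f = f'" using assms(1) DERIV_imp_deriv by blast
  show "(deriv ^^ n) f differentiable_on UNIV"
  proof (cases n)
    case 0
    then show ?thesis using assms(1) unfolding differentiable_on_def
      by (auto intro: differentiable_at_withinI simp: real_differentiable_def)
  next
    case (Suc m)
    then show ?thesis using assms(2) d by (simp add: funpow_Suc_right smooth_def del: funpow.simps)
  qed
qed

lemma smoothD:
  assumes "smooth f"
  shows "smooth (deriv f)" "(f has_real_derivative deriv f x) (at x)"
proof -
  show "smooth (deriv f)" unfolding smooth_def
  proof
    fix n
    have "(deriv ^^ Suc n) f differentiable_on UNIV" using assms unfolding smooth_def by blast
    then show "(deriv ^^ n) (deriv f) differentiable_on UNIV" by (simp add: funpow_Suc_right del: funpow.simps)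
  qed
  have "(deriv ^^ 0) f differentiable_on UNIV" using assms unfolding smooth_def by blast
  then have "f field_differentiable at x"
    by (simp add: differentiable_on_def real_differentiable_def field_differentiable_def)
  then show "(f has_real_derivative deriv f x) (at x)" by (simp add: DERIV_deriv_iff_field_differentiable)
qed

lemma smooth_add: assumes "smooth f" "smooth g" shows "smooth (\<lambda>x. f x + g x)"
proof (rule smooth_coinduct)
  let ?S = "{\<lambda>x. f x + g x |f g. smooth f \<and> smooth g}"
  show "(\<lambda>x. f x + g x) \<in> ?S" using assms by blast
  fix h assume "h \<in> ?S"
  then obtain f g where h: "h = (\<lambda>x. f x + g x)" "smooth f" "smooth g" by blast
  show "\<exists>h'\<in>?S. \<forall>x. (h has_real_derivative h' x) (at x)"
  proof
    show "\<forall>x. (h has_real_derivative (\<lambda>x. deriv f x + deriv g x) x) (at x)"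
      unfolding h(1) using smoothD(2)[OF h(2)] smoothD(2)[OF h(3)] by (auto intro!: derivative_intros)
  qed (use smoothD(1) h in blast)
qed

text \<open>The outer factor \<open>c\<close> is what closes the family under differentiation: the
  chain rule multiplies it by \<open>k\<close>.\<close>

lemma smooth_affine: assumes "smooth f" shows "smooth (\<lambda>x. c * f (k * x + s))"
proof (rule smooth_coinduct)
  let ?S = "{\<lambda>x. c * f (k * x + s) |c f. smooth f}"
  show "(\<lambda>x. c * f (k * x + s)) \<in> ?S" using assms by blast
  fix h assume "h \<in> ?S"
  then obtain c f where h: "h = (\<lambda>x. c * f (k * x + s))" "smooth f" by blast
  show "\<exists>h'\<in>?S. \<forall>x. (h has_real_derivative h' x) (at x)"
  proof
    show "\<forall>x. (h has_real_derivative (\<lambda>x. (c * k) * deriv f (k * x + s)) x) (at x)"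
      unfolding h(1) using smoothD(2)[OF h(2)]
      by (auto intro!: derivative_eq_intros DERIV_chain2[OF smoothD(2)[OF h(2)]])
  qed (use smoothD(1) h in blast)
qed

text \<open>The Leibniz rule turns a product into a sum of two products, so sums have to be included
  before \<open>smooth_coinduct\<close> applies.\<close>

inductive_set smooth_products :: "(real \<Rightarrow> real) set" where
  base: "smooth f \<Longrightarrow> smooth g \<Longrightarrow> (\<lambda>x. f x * g x) \<in> smooth_products"
| add: "f \<in> smooth_products \<Longrightarrow> g \<in> smooth_products \<Longrightarrow> (\<lambda>x. f x + g x) \<in> smooth_products"

lemma smooth_mult: assumes "smooth f" "smooth g" shows "smooth (\<lambda>x. f x * g x)"
proof (rule smooth_coinduct)
  show "(\<lambda>x. f x * g x) \<in> smooth_products" using assms by (rule smooth_products.base)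
  fix h assume "h \<in> smooth_products"
  then show "\<exists>h'\<in>smooth_products. \<forall>x. (h has_real_derivative h' x) (at x)"
  proof induction
    case (base f g)
    have "(\<lambda>x. deriv f x * g x + f x * deriv g x) \<in> smooth_products"
      using base smoothD(1) by (intro smooth_products.intros) auto
    moreover have "((\<lambda>x. f x * g x) has_real_derivative (deriv f x * g x + f x * deriv g x)) (at x)" for x
      using DERIV_mult'[OF smoothD(2)[OF base(1)] smoothD(2)[OF base(2)]] by (simp add: add.commute)
    ultimately show ?case by (intro bexI[of _ "\<lambda>x. deriv f x * g x + f x * deriv g x"]) auto
  next
    case (add f g)
    then obtain f' g' where "f' \<in> smooth_products" "g' \<in> smooth_products"
      "\<forall>x. (f has_real_derivative f' x) (at x)" "\<forall>x. (g has_real_derivative g' x) (at x)" by blast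
    then show ?case
      by (intro bexI[of _ "\<lambda>x. f' x + g' x"]) (auto intro!: derivative_intros smooth_products.add)
  qed
qed

lemma smooth_exp_flat: "smooth (exp_flat P)"
  by (rule smooth_coinduct[of "range exp_flat"]) (use has_real_derivative_exp_flat in auto)

lemma continuous_antiderivative:
  fixes f :: "real \<Rightarrow> real"
  assumes "\<And>x. isCont f x"
  shows "\<exists>F. \<forall>x. (F has_real_derivative f x) (at x)"
  using einterval_antiderivative[of "-\<infinity>" "\<infinity>" f] assms
  by (auto simp: has_real_derivative_iff_has_vector_derivative)

text \<open>The product of a function flat at 0 with its mirror image flat at 1 is a smooth bump
  supported in [0,1]. The step is its antiderivative, shifted and divided by the total mass
  \<open>B 1 - B 0\<close>.\<close>

lemma smooth_step:
  "\<exists>\<sigma>. smooth \<sigma> \<and> (\<forall>x\<le>0. \<sigma> x = 0) \<and> (\<forall>x\<ge>1. \<sigma> x = 1) \<and> (\<forall>x. 0 \<le> \<sigma> x \<and> \<sigma> x \<le> 1)"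
proof -
  define b where "b x = exp_flat 1 x * exp_flat 1 (1 - x)" for x
  have sb: "smooth b"
    using smooth_mult[OF smooth_exp_flat[of 1] smooth_affine[OF smooth_exp_flat[of 1], of 1 "-1" 1]]
    unfolding b_def by (simp add: add.commute)
  have b0: "b x = 0" if "x \<le> 0 \<or> x \<ge> 1" for x using that by (auto simp: b_def exp_flat_def)
  have bpos: "b x > 0" if "0 < x" "x < 1" for x using that by (auto simp: b_def exp_flat_def)
  have bnn: "b x \<ge> 0" for x using bpos[of x] b0[of x] by linarith
  obtain B where B: "\<And>x. (B has_real_derivative b x) (at x)"
    using continuous_antiderivative[of b] smoothD(2)[OF sb] DERIV_isCont by blast
  have mono: "B x \<le> B y" if "x \<le> y" for x y
    by (rule DERIV_nonneg_imp_nondecreasing[OF that]) (use B bnn in blast)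
  have left: "B x = B 0" if "x \<le> 0" for x
  proof (rule antisym)
    show "B 0 \<le> B x"
      by (rule DERIV_nonpos_imp_nonincreasing[OF that]) (use B b0 in force)
  qed (use mono that in blast)
  have right: "B x = B 1" if "x \<ge> 1" for x
  proof (rule antisym)
    show "B x \<le> B 1"
      by (rule DERIV_nonpos_imp_nonincreasing[OF that]) (use B b0 in force)
  qed (use mono that in blast)
  have Z: "B 1 - B 0 > 0"
  proof -
    have "B 0 < B 1"
      by (rule DERIV_pos_imp_increasing_open[of 0 1]) (use B bpos in \<open>auto intro!: continuous_at_imp_continuous_on DERIV_isCont[OF B]\<close>)
    then show ?thesis by simp
  qed
  define \<sigma> where "\<sigma> x = (B x - B 0) / (B 1 - B 0)" for x
  have "(\<sigma> has_real_derivative (1 / (B 1 - B 0)) * b (1 * x + 0)) (at x)" for x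
    unfolding \<sigma>_def using Z by (auto intro!: derivative_eq_intros B)
  then have "smooth \<sigma>" by (rule smooth_if_has_derivative[OF _ smooth_affine[OF sb]])
  moreover have "0 \<le> \<sigma> x \<and> \<sigma> x \<le> 1" for x
  proof -
    have "B 0 \<le> B x" using left[of x] mono[of 0 x] by linarith
    moreover have "B x \<le> B 1" using right[of x] mono[of x 1] by linarith
    ultimately show ?thesis using Z by (simp add: \<sigma>_def)
  qed
  moreover have "\<sigma> x = 0" if "x \<le> 0" for x unfolding \<sigma>_def left[OF that] by simp
  moreover have "\<sigma> x = 1" if "x \<ge> 1" for x unfolding \<sigma>_def right[OF that] using Z by simp
  ultimately show ?thesis by blast
qed

section \<open>Test functions and local integrability\<close>

lemma test_fun_iff_smooth: "test_fun \<phi> \<longleftrightarrow> smooth \<phi> \<and> (\<exists>R. \<forall>x. R \<le> \<bar>x\<bar> \<longrightarrow> \<phi> x = 0)"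
  by (simp add: test_fun_def smooth_def)

lemma test_funE:
  assumes "test_fun \<phi>"
  obtains R where "R > 0" "\<And>x. R \<le> \<bar>x\<bar> \<Longrightarrow> \<phi> x = 0" "\<And>x. R \<le> \<bar>x\<bar> \<Longrightarrow> deriv \<phi> x = 0"
proof -
  obtain R0 where R0: "\<And>x. R0 \<le> \<bar>x\<bar> \<Longrightarrow> \<phi> x = 0" using assms unfolding test_fun_def by blast
  \<comment> \<open>The extra 1 places x inside the open set
    \<open>\<bar>R0\<bar> < \<bar>y\<bar>\<close>, on which \<phi> vanishes identically.\<close>
  have "deriv \<phi> x = 0" if "\<bar>R0\<bar> + 1 \<le> \<bar>x\<bar>" for x
  proof (rule DERIV_imp_deriv)
    show "(\<phi> has_real_derivative 0) (at x)"
      by (rule has_field_derivative_transform_within_open[of "\<lambda>_. 0" _ _ "{y. \<bar>R0\<bar> < \<bar>y\<bar>}"])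
         (use that R0 in \<open>auto intro!: open_Collect_less continuous_intros\<close>)
  qed
  then show ?thesis using R0 that[of "\<bar>R0\<bar> + 1"] by force
qed

lemma test_fun_deriv:
  assumes "test_fun \<phi>"
  shows "(\<phi> has_real_derivative deriv \<phi> x) (at x)" "isCont \<phi> x" "isCont (deriv \<phi>) x"
proof -
  have s: "smooth \<phi>" using assms by (simp add: test_fun_iff_smooth)
  show "(\<phi> has_real_derivative deriv \<phi> x) (at x)" by (rule smoothD(2)[OF s])
  then show "isCont \<phi> x" by (rule DERIV_isCont)
  show "isCont (deriv \<phi>) x" using smoothD(2)[OF smoothD(1)[OF s]] by (rule DERIV_isCont)
qed

lemma loc_integrable_measurable:
  fixes f :: "real \<Rightarrow> real"
  assumes "\<And>a b. set_integrable lborel {a..b} f"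
  shows "f \<in> borel_measurable borel"
proof (rule borel_measurable_LIMSEQ_real)
  show "(\<lambda>x. indicator {-real n..real n} x *\<^sub>R f x) \<in> borel_measurable borel" for n
    using assms[of "-real n" "real n"] unfolding set_integrable_def by (auto dest: borel_measurable_integrable)
  fix x :: real
  obtain N :: nat where N: "\<bar>x\<bar> \<le> real N" using real_arch_simple by blast
  show "(\<lambda>n. indicator {-real n..real n} x *\<^sub>R f x) \<longlonglongrightarrow> f x"
    by (rule tendsto_eventually, rule eventually_sequentiallyI[of N]) (use N in \<open>auto simp: indicator_def\<close>)
qed

lemma set_integrable_const: "set_integrable lborel {a..b::real} (\<lambda>_. c::real)"
  unfolding set_integrable_def
  by (intro integrable_scaleR_left integrable_real_indicator) (auto simp: emeasure_lborel_Icc_eq)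

lemma set_integrable_mult_bounded:
  fixes f g :: "real \<Rightarrow> real"
  assumes f: "set_integrable lborel {a..b} f" and g: "g \<in> borel_measurable borel"
    and fm: "f \<in> borel_measurable borel" and bd: "AE x in lborel. \<bar>g x\<bar> \<le> B"
  shows "set_integrable lborel {a..b} (\<lambda>x. g x * f x)"
  unfolding set_integrable_def
proof (rule Bochner_Integration.integrable_bound)
  show "integrable lborel (\<lambda>x. B * \<bar>indicator {a..b} x *\<^sub>R f x\<bar>)"
    using f unfolding set_integrable_def by (intro integrable_mult_right integrable_abs)
  show "AE x in lborel. norm (indicator {a..b} x *\<^sub>R (g x * f x)) \<le> norm (B * \<bar>indicator {a..b} x *\<^sub>R f x\<bar>)"
    using bd by eventually_elim (auto simp: indicator_def abs_mult intro!: mult_right_mono)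
qed (use g fm in measurable)

lemma integrable_mult_compact_support:
  fixes f \<psi> :: "real \<Rightarrow> real"
  assumes f: "set_integrable lborel {-R..R} f"
    and \<psi>: "\<And>x. isCont \<psi> x" "\<And>x. R \<le> \<bar>x\<bar> \<Longrightarrow> \<psi> x = 0"
  shows "integrable lborel (\<lambda>x. f x * \<psi> x)"
proof -
  have c: "continuous_on UNIV \<psi>" using \<psi>(1) by (intro continuous_at_imp_continuous_on) auto
  have "compact (\<psi> ` {-R..R})" by (intro compact_continuous_image continuous_on_subset[OF c]) auto
  then obtain C where "\<forall>y\<in>\<psi> ` {-R..R}. norm y \<le> C" using compact_imp_bounded bounded_iff by meson
  then have C: "\<And>x. x \<in> {-R..R} \<Longrightarrow> \<bar>\<psi> x\<bar> \<le> C" by auto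
  have m: "(\<lambda>x. indicator {-R..R} x *\<^sub>R f x) \<in> borel_measurable lborel"
    using f unfolding set_integrable_def by (rule borel_measurable_integrable)
  have eq: "f x * \<psi> x = (indicator {-R..R} x *\<^sub>R f x) * \<psi> x" for x
    using \<psi>(2)[of x] by (cases "x \<in> {-R..R}") (simp, cases "R \<le> \<bar>x\<bar>", simp, simp, linarith)
  show ?thesis unfolding eq
  proof (rule Bochner_Integration.integrable_bound)
    show "integrable lborel (\<lambda>x. C * \<bar>indicator {-R..R} x *\<^sub>R f x\<bar>)"
      using f unfolding set_integrable_def by (intro integrable_mult_right integrable_abs)
    show "(\<lambda>x. (indicator {-R..R} x *\<^sub>R f x) * \<psi> x) \<in> borel_measurable lborel"
      using m borel_measurable_continuous_onI[OF c] by measurable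
    show "AE x in lborel. norm ((indicator {-R..R} x *\<^sub>R f x) * \<psi> x) \<le> norm (C * \<bar>indicator {-R..R} x *\<^sub>R f x\<bar>)"
    proof (rule AE_I2)
      fix x
      show "norm ((indicator {-R..R} x *\<^sub>R f x) * \<psi> x) \<le> norm (C * \<bar>indicator {-R..R} x *\<^sub>R f x\<bar>)"
      proof (cases "x \<in> {-R..R}")
        case True
        then have "\<bar>f x\<bar> * \<bar>\<psi> x\<bar> \<le> \<bar>C\<bar> * \<bar>f x\<bar>" using C[OF True]
          by (subst mult.commute, intro mult_right_mono) auto
        then show ?thesis using True by (simp add: abs_mult)
      qed simp
    qed
  qed
qed

text \<open>The two half-line forms are what Fubini produces when \<open>primitive\<close> is tested
  against \<open>deriv \<phi>\<close>: one for positive, the other for nonpositive integration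
  points.\<close>

lemma integral_deriv_compact_support:
  assumes d: "\<And>x. (\<phi> has_real_derivative \<psi> x) (at x)" and c: "\<And>x. isCont \<psi> x"
    and R: "\<And>x::real. R \<le> \<bar>x\<bar> \<Longrightarrow> \<phi> x = 0" "\<And>x. R \<le> \<bar>x\<bar> \<Longrightarrow> \<psi> x = 0"
  shows "(\<integral>x. \<psi> x * indicator {t..} x \<partial>lborel) = - \<phi> t"
    and "(\<integral>x. \<psi> x * indicator {..<t} x \<partial>lborel) = \<phi> t"
    and "(\<integral>x. \<psi> x \<partial>lborel) = 0"
proof -
  define Q where "Q = \<bar>R\<bar> + \<bar>t\<bar> + 1"
  have Q: "- Q \<le> t" "t \<le> Q" "R < Q" "Q > 0" unfolding Q_def by auto
  have z: "\<psi> x = 0" if "Q \<le> x \<or> x \<le> - Q" for x using that R(2)[of x] Q by auto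
  have "(\<integral>x. \<psi> x * indicator {t..} x \<partial>lborel) = (\<integral>x. \<psi> x * indicator {t..Q} x \<partial>lborel)"
    by (intro Bochner_Integration.integral_cong) (use z in \<open>auto simp: indicator_def\<close>)
  also have "\<dots> = \<phi> Q - \<phi> t" by (rule integral_FTC_Icc_real) (use Q d c in auto)
  also have "\<phi> Q = 0" using R(1)[of Q] Q by auto
  finally show "(\<integral>x. \<psi> x * indicator {t..} x \<partial>lborel) = - \<phi> t" by simp
  have "(\<integral>x. \<psi> x * indicator {..<t} x \<partial>lborel) = (\<integral>x. \<psi> x * indicator {-Q..t} x \<partial>lborel)"
  proof (rule integral_cong_AE)
    have "continuous_on UNIV \<psi>" using c by (intro continuous_at_imp_continuous_on) auto
    then have [measurable]: "\<psi> \<in> borel_measurable borel" by (rule borel_measurable_continuous_onI)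
    show "(\<lambda>x. \<psi> x * indicator {..<t} x) \<in> borel_measurable lborel" by measurable
    show "(\<lambda>x. \<psi> x * indicator {-Q..t} x) \<in> borel_measurable lborel" by measurable
    show "AE x in lborel. \<psi> x * indicator {..<t} x = \<psi> x * indicator {-Q..t} x"
      using AE_lborel_singleton[of t] by eventually_elim (use z in \<open>auto simp: indicator_def\<close>)
  qed
  also have "\<dots> = \<phi> t - \<phi> (-Q)" by (rule integral_FTC_Icc_real) (use Q d c in auto)
  also have "\<phi> (-Q) = 0" using R(1)[of "-Q"] Q by auto
  finally show "(\<integral>x. \<psi> x * indicator {..<t} x \<partial>lborel) = \<phi> t" by simp
  have "(\<integral>x. \<psi> x \<partial>lborel) = (\<integral>x. \<psi> x * indicator {-Q..Q} x \<partial>lborel)"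
    by (intro Bochner_Integration.integral_cong refl, simp add: indicator_def) (metis z linorder_not_le less_imp_le)
  also have "\<dots> = \<phi> Q - \<phi> (-Q)" by (rule integral_FTC_Icc_real) (use Q d c in auto)
  also have "\<dots> = 0" using R(1)[of Q] R(1)[of "-Q"] Q by auto
  finally show "(\<integral>x. \<psi> x \<partial>lborel) = 0" .
qed

section \<open>Divergence-free functions on the line\<close>

lemma weakly_divfree_AE_const:
  assumes F: "F \<in> borel_measurable borel" and c: "AE x in lborel. F x = C"
  shows "weakly_divfree F"
  unfolding weakly_divfree_def
proof (intro allI impI)
  fix \<phi> assume t: "test_fun \<phi>"
  obtain R where R: "\<And>x. R \<le> \<bar>x\<bar> \<Longrightarrow> \<phi> x = 0" "\<And>x. R \<le> \<bar>x\<bar> \<Longrightarrow> deriv \<phi> x = 0"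
    using t by (rule test_funE) blast
  have "continuous_on UNIV (deriv \<phi>)" using test_fun_deriv(3)[OF t] by (intro continuous_at_imp_continuous_on) auto
  then have [measurable]: "deriv \<phi> \<in> borel_measurable borel" by (rule borel_measurable_continuous_onI)
  have "(\<integral>x. F x * deriv \<phi> x \<partial>lborel) = (\<integral>x. C * deriv \<phi> x \<partial>lborel)"
    by (rule integral_cong_AE) (use F c in \<open>auto elim!: eventually_mono\<close>)
  also have "\<dots> = 0"
    using integral_deriv_compact_support(3)[OF test_fun_deriv(1)[OF t] test_fun_deriv(3)[OF t] R] by simp
  finally show "(\<integral>x. F x * deriv \<phi> x \<partial>lborel) = 0" .
qed

text \<open>The positive and negative parts of a truncation of \<open>G\<close>, taken as densities,
  define measures with equal finite mass on every ray \<open>{t<..}\<close>. Such measures coincide,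
  and densities are unique up to null sets.\<close>

lemma AE_zero_if_interval_integrals_zero:
  fixes G :: "real \<Rightarrow> real"
  assumes li: "\<And>a b. set_integrable lborel {a..b} G"
    and z: "\<And>a b. a < b \<Longrightarrow> (\<integral>x. G x * indicator {a<..b} x \<partial>lborel) = 0"
  shows "AE x in lborel. G x = 0"
proof -
  have [measurable]: "G \<in> borel_measurable borel" by (rule loc_integrable_measurable[OF li])
  have "AE x in lborel. G x * indicator {-real n<..real n} x = 0" for n
  proof -
    define g where "g x = G x * indicator {-real n<..real n} x" for x
    have gm[measurable]: "g \<in> borel_measurable borel" unfolding g_def by measurable
    have gi: "integrable lborel g"
    proof (rule Bochner_Integration.integrable_bound)
      show "integrable lborel (\<lambda>x. indicator {-real n..real n} x *\<^sub>R G x)"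
        using li unfolding set_integrable_def .
    qed (auto simp: g_def indicator_def)
    \<comment> \<open>\<open>ennreal\<close> sends negative reals to 0, so the two densities are the
      positive and the negative part of \<open>g\<close>.\<close>
    have eq: "density lborel (\<lambda>x. ennreal (g x)) = density lborel (\<lambda>x. ennreal (- g x))"
    proof (rule measure_eqI_lessThan)
      fix t
      have gi': "integrable lborel (\<lambda>x. max 0 (g x) * indicator {t<..} x)"
        "integrable lborel (\<lambda>x. max 0 (- g x) * indicator {t<..} x)"
        by (rule Bochner_Integration.integrable_bound[OF gi]; auto simp: indicator_def)+
      have e1: "emeasure (density lborel (\<lambda>x. ennreal (g x))) {t<..} = ennreal (\<integral>x. max 0 (g x) * indicator {t<..} x \<partial>lborel)"
      proof -
        have "(\<integral>\<^sup>+x. ennreal (g x) * indicator {t<..} x \<partial>lborel) = (\<integral>\<^sup>+x. ennreal (max 0 (g x) * indicator {t<..} x) \<partial>lborel)"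
          by (intro nn_integral_cong) (auto simp: indicator_def max_def ennreal_neg)
        then show ?thesis using nn_integral_eq_integral[OF gi'(1)] by (simp add: emeasure_density)
      qed
      have e2: "emeasure (density lborel (\<lambda>x. ennreal (- g x))) {t<..} = ennreal (\<integral>x. max 0 (- g x) * indicator {t<..} x \<partial>lborel)"
      proof -
        have "(\<integral>\<^sup>+x. ennreal (- g x) * indicator {t<..} x \<partial>lborel) = (\<integral>\<^sup>+x. ennreal (max 0 (- g x) * indicator {t<..} x) \<partial>lborel)"
          by (intro nn_integral_cong) (auto simp: indicator_def max_def ennreal_neg)
        then show ?thesis using nn_integral_eq_integral[OF gi'(2)] by (simp add: emeasure_density)
      qed
      have "(\<integral>x. max 0 (g x) * indicator {t<..} x \<partial>lborel) - (\<integral>x. max 0 (- g x) * indicator {t<..} x \<partial>lborel)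
          = (\<integral>x. g x * indicator {t<..} x \<partial>lborel)"
        by (subst Bochner_Integration.integral_diff[OF gi', symmetric], intro Bochner_Integration.integral_cong)
           (auto simp: indicator_def max_def)
      also have "\<dots> = (\<integral>x. G x * indicator {max t (-real n)<..real n} x \<partial>lborel)"
        by (intro Bochner_Integration.integral_cong) (auto simp: indicator_def g_def)
      also have "\<dots> = 0"
        using z[of "max t (-real n)" "real n"] by (cases "max t (-real n) < real n") auto
      finally show "emeasure (density lborel (\<lambda>x. ennreal (g x))) {t<..} = emeasure (density lborel (\<lambda>x. ennreal (- g x))) {t<..}"
        unfolding e1 e2 by simp
      show "emeasure (density lborel (\<lambda>x. ennreal (g x))) {t<..} < \<infinity>" unfolding e1 by simp
    qed auto
    have "AE x in lborel. ennreal (g x) = ennreal (- g x)"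
      by (rule sigma_finite_measure.density_unique[OF sigma_finite_lborel _ _ eq]) auto
    then show ?thesis
    proof eventually_elim
      case (elim x)
      have "g x = 0"
      proof (cases "g x \<ge> 0")
        case True
        then show ?thesis using elim by (simp add: ennreal_neg)
      next
        case False
        then have "ennreal (- g x) = 0" using elim by (simp add: ennreal_neg)
        then show ?thesis using False by simp
      qed
      then show ?case by (simp add: g_def)
    qed
  qed
  then have "AE x in lborel. \<forall>n::nat. G x * indicator {-real n<..real n} x = 0" unfolding AE_all_countable by blast
  then show ?thesis
  proof eventually_elim
    case (elim x)
    obtain N :: nat where "\<bar>x\<bar> < real N" using reals_Archimedean2 by blast
    then show ?case using elim[rule_format, of N] by (auto simp: indicator_def split: if_splits)
  qed
qed

lemma loc_integrable_subset:
  fixes F :: "real \<Rightarrow> real"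
  assumes li: "\<And>a b. set_integrable lborel {a..b} F" and S: "S \<subseteq> {a..b}" "S \<in> sets borel"
  shows "integrable lborel (\<lambda>x. F x * indicator S x)"
proof -
  have [measurable]: "F \<in> borel_measurable borel" by (rule loc_integrable_measurable[OF li])
  show ?thesis
    by (rule Bochner_Integration.integrable_bound[OF li[of a b, unfolded set_integrable_def]])
       (use S in \<open>auto simp: indicator_def intro!: AE_I2\<close>)
qed

text \<open>An antiderivative of the smooth step. Combinations of such ramps serve as test functions
  whose derivatives are smoothed indicators; \<kappa> records the offset left by the gradual rise
  and cancels in these combinations.\<close>

lemma smooth_ramp:
  "\<exists>\<Sigma> \<sigma> \<kappa>. smooth \<Sigma> \<and> (\<forall>x. (\<Sigma> has_real_derivative \<sigma> x) (at x)) \<and> (\<forall>x\<le>0. \<Sigma> x = 0) \<and> (\<forall>x\<ge>1. \<Sigma> x = x + \<kappa>) \<and>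
    smooth \<sigma> \<and> (\<forall>x\<le>0. \<sigma> x = 0) \<and> (\<forall>x\<ge>1. \<sigma> x = 1) \<and> (\<forall>x. 0 \<le> \<sigma> x \<and> \<sigma> x \<le> 1)"
proof -
  obtain \<sigma> where s: "smooth \<sigma>" "\<And>x. x \<le> 0 \<Longrightarrow> \<sigma> x = 0" "\<And>x. x \<ge> 1 \<Longrightarrow> \<sigma> x = 1" "\<And>x. 0 \<le> \<sigma> x \<and> \<sigma> x \<le> 1"
    using smooth_step by blast
  obtain S where S: "\<And>x. (S has_real_derivative \<sigma> x) (at x)"
    using continuous_antiderivative[of \<sigma>] smoothD(2)[OF s(1)] DERIV_isCont by blast
  define \<Sigma> where "\<Sigma> x = S x - S 0" for x
  have d: "(\<Sigma> has_real_derivative \<sigma> x) (at x)" for x unfolding \<Sigma>_def by (auto intro!: derivative_eq_intros S)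
  have l: "\<Sigma> x = 0" if "x \<le> 0" for x
  proof (rule antisym)
    have "\<Sigma> x \<le> \<Sigma> 0" by (rule DERIV_nonneg_imp_nondecreasing[OF that]) (use d s(4) in blast)
    then show "\<Sigma> x \<le> 0" by (simp add: \<Sigma>_def)
    have "\<Sigma> 0 \<le> \<Sigma> x" by (rule DERIV_nonpos_imp_nonincreasing[OF that]) (use d s(2) in force)
    then show "0 \<le> \<Sigma> x" by (simp add: \<Sigma>_def)
  qed
  have r: "\<Sigma> x = x + (\<Sigma> 1 - 1)" if "x \<ge> 1" for x
  proof -
    have d': "((\<lambda>x. \<Sigma> x - x) has_real_derivative (\<sigma> x - 1)) (at x)" for x
      by (auto intro!: derivative_eq_intros d)
    have "\<Sigma> x - x \<le> \<Sigma> 1 - 1"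
      by (rule DERIV_nonpos_imp_nonincreasing[OF that]) (use d' s(4) in \<open>force simp del: One_nat_def\<close>)
    moreover have "\<Sigma> 1 - 1 \<le> \<Sigma> x - x"
      by (rule DERIV_nonneg_imp_nondecreasing[OF that]) (use d' s(3) in force)
    ultimately show ?thesis by simp
  qed
  have "smooth \<Sigma>" by (rule smooth_if_has_derivative[OF d s(1)])
  then show ?thesis using d l r s by blast
qed

text \<open>At x = c the value is 0 for every n, so the limit is the indicator of the open ray and
  differences of limits are indicators of half-open intervals \<open>{a<..b}\<close>. The scale n +
  1 is at least 1 from n = 0 on.\<close>

lemma scaled_step_tendsto:
  fixes \<sigma> :: "real \<Rightarrow> real"
  assumes \<sigma>: "\<And>x. x \<le> 0 \<Longrightarrow> \<sigma> x = 0" "\<And>x. x \<ge> 1 \<Longrightarrow> \<sigma> x = 1"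
  shows "(\<lambda>n. \<sigma> ((real n + 1) * (x - c))) \<longlonglongrightarrow> indicator {c<..} x"
proof (cases "x \<le> c")
  case True
  then have "(real n + 1) * (x - c) \<le> 0" for n by (intro mult_nonneg_nonpos) auto
  then show ?thesis using True \<sigma>(1) by simp
next
  case False
  then have xc: "x - c > 0" by simp
  obtain N :: nat where N: "1 / (x - c) < real N" using reals_Archimedean2 by blast
  have "\<sigma> ((real n + 1) * (x - c)) = 1" if "n \<ge> N" for n
  proof (rule \<sigma>(2))
    have "1 < real N * (x - c)" using N xc by (simp add: field_simps)
    also have "\<dots> \<le> (real n + 1) * (x - c)" using that xc by (intro mult_right_mono) auto
    finally show "1 \<le> (real n + 1) * (x - c)" by simp
  qed
  then show ?thesis using False by (intro tendsto_eventually eventually_sequentiallyI[of N]) auto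
qed

text \<open>Test with a function whose derivative approximates the indicator of (a,b] minus (b - a)
  times the indicator of (0,1]: the mean of \<open>F\<close> over (a,b] is then its mean over (0,1].
  The correction on (0,1] gives this derivative total mass 0, so that its antiderivative can have
  compact support.\<close>

lemma du_Bois_Reymond:
  fixes F :: "real \<Rightarrow> real"
  assumes li: "\<And>a b. set_integrable lborel {a..b} F" and df: "weakly_divfree F"
  shows "\<exists>C. AE x in lborel. F x = C"
proof -
  have [measurable]: "F \<in> borel_measurable borel" by (rule loc_integrable_measurable[OF li])
  obtain \<Sigma> \<sigma> \<kappa> where S: "smooth \<Sigma>" "\<And>x. (\<Sigma> has_real_derivative \<sigma> x) (at x)" "\<And>x. x \<le> 0 \<Longrightarrow> \<Sigma> x = 0"
    "\<And>x. x \<ge> 1 \<Longrightarrow> \<Sigma> x = x + \<kappa>" and s: "smooth \<sigma>" "\<And>x. x \<le> 0 \<Longrightarrow> \<sigma> x = 0" "\<And>x. x \<ge> 1 \<Longrightarrow> \<sigma> x = 1"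
    "\<And>x. 0 \<le> \<sigma> x \<and> \<sigma> x \<le> 1"
    using smooth_ramp by metis
  define C where "C = (\<integral>x. F x * indicator {0<..1} x \<partial>lborel)"
  have fi: "integrable lborel (\<lambda>x. F x * indicator {a<..b} x)" for a b
    by (rule loc_integrable_subset[OF li, of _ a b]) auto
  have key: "(\<integral>x. F x * indicator {a<..b} x \<partial>lborel) = (b - a) * C" if ab: "a < b" for a b
  proof -
    define k where "k n = real n + 1" for n
    have k: "k n \<ge> 1" for n unfolding k_def by simp
    \<comment> \<open>Four ramps starting at a, b, 0 and 1. Their weights sum to zero, which removes
      the terms in x and \<kappa> far to the right, and the remaining constants -a + b - (b - a)
      cancel as well. Dividing by \<open>k n\<close> compensates the chain rule.\<close>
    define \<phi> where "\<phi> n x = ((1 / k n) * \<Sigma> (k n * x + (- k n * a)) + (- 1 / k n) * \<Sigma> (k n * x + (- k n * b)))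
      + ((- (b - a) / k n) * \<Sigma> (k n * x + 0) + ((b - a) / k n) * \<Sigma> (k n * x + (- k n)))" for n x
    define \<psi> where "\<psi> n x = (\<sigma> (k n * x + (- k n * a)) - \<sigma> (k n * x + (- k n * b)))
      - (b - a) * (\<sigma> (k n * x + 0) - \<sigma> (k n * x + (- k n)))" for n x
    \<comment> \<open>All ramps start in [-R, R - 1] and bend over a length 1 / \<open>k n\<close>,
      at most 1, so beyond R each is in one of its two affine regimes.\<close>
    define R where "R = \<bar>a\<bar> + \<bar>b\<bar> + 2"
    have sm: "smooth (\<phi> n)" for n unfolding \<phi>_def by (intro smooth_add smooth_affine S(1))
    have der: "(\<phi> n has_real_derivative \<psi> n x) (at x)" for n x
      unfolding \<phi>_def \<psi>_def using k[of n]
      by (auto intro!: derivative_eq_intros DERIV_chain2[OF S(2)] simp: field_simps)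
    have big: "k n * x + (- k n * c) \<ge> 1" if "x \<ge> R" "c \<le> R - 1" for n x c
    proof -
      have "k n * 1 \<le> k n * (x - c)" using that k[of n] by (intro mult_left_mono) auto
      then show ?thesis using k[of n] by (simp add: right_diff_distrib)
    qed
    have small: "k n * x + (- k n * c) \<le> 0" if "x \<le> c" for n x c
      using that k[of n] mult_left_mono[OF that, of "k n"] by auto
    have out: "\<phi> n x = 0 \<and> \<psi> n x = 0" if x: "R \<le> \<bar>x\<bar>" for n x
    proof (cases "x \<ge> 0")
      case True
      have 1: "k n * x + (- k n * a) \<ge> 1" "k n * x + (- k n * b) \<ge> 1" "k n * x + 0 \<ge> 1" "k n * x + (- k n) \<ge> 1"
        using big[of x a n] big[of x b n] big[of x 0 n] big[of x 1 n] True x unfolding R_def by auto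
      show ?thesis
        unfolding \<phi>_def \<psi>_def S(4)[OF 1(1)] S(4)[OF 1(2)] S(4)[OF 1(3)] S(4)[OF 1(4)]
          s(3)[OF 1(1)] s(3)[OF 1(2)] s(3)[OF 1(3)] s(3)[OF 1(4)]
        using k[of n] by (simp add: field_simps)
    next
      case False
      have 1: "k n * x + (- k n * a) \<le> 0" "k n * x + (- k n * b) \<le> 0" "k n * x + 0 \<le> 0" "k n * x + (- k n) \<le> 0"
        using small[of x a n] small[of x b n] small[of x 0 n] small[of x 1 n] False x unfolding R_def by auto
      show ?thesis
        unfolding \<phi>_def \<psi>_def S(3)[OF 1(1)] S(3)[OF 1(2)] S(3)[OF 1(3)] S(3)[OF 1(4)]
          s(2)[OF 1(1)] s(2)[OF 1(2)] s(2)[OF 1(3)] s(2)[OF 1(4)] by simp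
    qed
    have "test_fun (\<phi> n)" for n unfolding test_fun_iff_smooth using sm out by blast
    moreover have "deriv (\<phi> n) = \<psi> n" for n using der by (intro ext DERIV_imp_deriv)
    ultimately have z: "(\<integral>x. F x * \<psi> n x \<partial>lborel) = 0" for n
      using df unfolding weakly_divfree_def by metis
    have lims: "(\<lambda>n. \<sigma> (k n * x + (- k n * c))) \<longlonglongrightarrow> indicator {c<..} x" for x c :: real
      using scaled_step_tendsto[of \<sigma> x c, OF s(2,3)] by (simp add: k_def algebra_simps)
    define \<xi> where "\<xi> x = (indicator {a<..b} x - (b - a) * indicator {0<..1} x :: real)" for x
    have psi_lim: "(\<lambda>n. \<psi> n x) \<longlonglongrightarrow> \<xi> x" for x
    proof -
      have "(\<lambda>n. \<psi> n x) \<longlonglongrightarrow> (indicator {a<..} x - indicator {b<..} x) - (b - a) * (indicator {0<..} x - indicator {1<..} x)"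
        unfolding \<psi>_def using lims[where c=a] lims[where c=b] lims[where c=0] lims[where c=1]
        by (intro tendsto_intros) auto
      moreover have "(indicator {a<..} x - indicator {b<..} x) - (b - a) * (indicator {0<..} x - indicator {1<..} x) = \<xi> x"
        using ab unfolding \<xi>_def by (auto simp: indicator_def)
      ultimately show ?thesis by (simp only:)
    qed
    have "(\<lambda>n. \<integral>x. F x * \<psi> n x \<partial>lborel) \<longlonglongrightarrow> (\<integral>x. F x * \<xi> x \<partial>lborel)"
    proof (rule integral_dominated_convergence)
      have "continuous_on UNIV \<sigma>" using smoothD(2)[OF s(1)] DERIV_isCont by (blast intro: continuous_at_imp_continuous_on)
      then have [measurable]: "\<sigma> \<in> borel_measurable borel" by (rule borel_measurable_continuous_onI)
      show "(\<lambda>x. F x * \<psi> n x) \<in> borel_measurable lborel" for n unfolding \<psi>_def by measurable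
      show "(\<lambda>x. F x * \<xi> x) \<in> borel_measurable lborel" unfolding \<xi>_def by measurable
      show "integrable lborel (\<lambda>x. (1 + (b - a)) * \<bar>F x * indicator {-R..R} x\<bar>)"
        by (intro integrable_mult_right integrable_abs loc_integrable_subset[OF li, of _ "-R" R]) auto
      show "AE x in lborel. (\<lambda>n. F x * \<psi> n x) \<longlonglongrightarrow> F x * \<xi> x"
        using psi_lim by (intro AE_I2 tendsto_mult tendsto_const) auto
      fix n
      show "AE x in lborel. norm (F x * \<psi> n x) \<le> (1 + (b - a)) * \<bar>F x * indicator {-R..R} x\<bar>"
      proof (rule AE_I2)
        fix x
        have "\<bar>u - v\<bar> \<le> 1" if "0 \<le> u \<and> u \<le> 1" "0 \<le> v \<and> v \<le> 1" for u v :: real using that by linarith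
        then have d: "\<bar>\<sigma> u - \<sigma> v\<bar> \<le> 1" for u v using s(4) by blast
        have "\<bar>\<psi> n x\<bar> \<le> \<bar>\<sigma> (k n * x + (- k n * a)) - \<sigma> (k n * x + (- k n * b))\<bar>
            + \<bar>(b - a) * (\<sigma> (k n * x + 0) - \<sigma> (k n * x + (- k n)))\<bar>"
          unfolding \<psi>_def by (rule abs_triangle_ineq4)
        also have "\<dots> \<le> 1 + (b - a) * 1"
          unfolding abs_mult using ab by (intro add_mono d mult_mono) auto
        finally have "\<bar>\<psi> n x\<bar> \<le> 1 + (b - a)" by simp
        then have "\<bar>F x\<bar> * \<bar>\<psi> n x\<bar> \<le> \<bar>F x\<bar> * (1 + (b - a))" by (intro mult_left_mono) auto
        then show "norm (F x * \<psi> n x) \<le> (1 + (b - a)) * \<bar>F x * indicator {-R..R} x\<bar>"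
          using out[of x n] by (cases "x \<in> {-R..R}") (auto simp: abs_mult mult.commute not_le)
      qed
    qed
    then have "(\<integral>x. F x * \<xi> x \<partial>lborel) = 0" unfolding z using LIMSEQ_unique tendsto_const by blast
    also have "(\<integral>x. F x * \<xi> x \<partial>lborel) = (\<integral>x. F x * indicator {a<..b} x - (b - a) * (F x * indicator {0<..1} x) \<partial>lborel)"
      by (intro Bochner_Integration.integral_cong) (auto simp: \<xi>_def algebra_simps)
    also have "\<dots> = (\<integral>x. F x * indicator {a<..b} x \<partial>lborel) - (b - a) * C"
      unfolding C_def using fi by (subst Bochner_Integration.integral_diff) auto
    finally show ?thesis by simp
  qed
  have "AE x in lborel. F x - C = 0"
  proof (rule AE_zero_if_interval_integrals_zero)
    fix a b :: real
    show "set_integrable lborel {a..b} (\<lambda>x. F x - C)" by (intro set_integral_diff li set_integrable_const)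
    assume ab: "a < b"
    have "(\<integral>x. (F x - C) * indicator {a<..b} x \<partial>lborel) = (\<integral>x. F x * indicator {a<..b} x - C * indicator {a<..b} x \<partial>lborel)"
      by (intro Bochner_Integration.integral_cong) (auto simp: algebra_simps)
    also have "\<dots> = (b - a) * C - C * (b - a)"
      using fi key[OF ab] ab by (subst Bochner_Integration.integral_diff) auto
    finally show "(\<integral>x. (F x - C) * indicator {a<..b} x \<partial>lborel) = 0" by simp
  qed
  then show ?thesis by (intro exI[of _ C]) auto
qed

text \<open>\<open>per_corrector\<close> asks for periodicity of \<open>w\<close>, not for mean zero
  of its derivative. The latter follows by testing against smoothed indicators of one period: their
  derivative is a bump minus its translate by 1, and integrals against a periodic \<open>w\<close>
  do not distinguish the two.\<close>

lemma periodic_weak_deriv_mean_zero: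
  assumes per: "\<And>x. w (x + 1) = w x" and wd: "has_weak_deriv w g"
  shows "(\<integral>x. g x * indicator {-1/2<..1/2} x \<partial>lborel) = 0"
proof -
  have lw: "\<And>a b. set_integrable lborel {a..b} w" and lg: "\<And>a b. set_integrable lborel {a..b} g"
    and ibp: "\<And>\<phi>. test_fun \<phi> \<Longrightarrow> (\<integral>x. w x * deriv \<phi> x \<partial>lborel) = - (\<integral>x. g x * \<phi> x \<partial>lborel)"
    using wd unfolding has_weak_deriv_def by blast+
  have [measurable]: "g \<in> borel_measurable borel" by (rule loc_integrable_measurable[OF lg])
  obtain \<sigma> where s: "smooth \<sigma>" "\<And>x. x \<le> 0 \<Longrightarrow> \<sigma> x = 0" "\<And>x. x \<ge> 1 \<Longrightarrow> \<sigma> x = 1"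
    "\<And>x. 0 \<le> \<sigma> x \<and> \<sigma> x \<le> 1"
    using smooth_step by metis
  define k where "k n = real n + 1" for n
  have k: "k n \<ge> 1" for n unfolding k_def by simp
  define \<phi> where "\<phi> n x = 1 * \<sigma> (k n * x + k n / 2) + (-1) * \<sigma> (k n * x + (- k n / 2))" for n x
  define \<theta> where "\<theta> n x = k n * deriv \<sigma> (k n * x + k n / 2)" for n x
  have sm: "smooth (\<phi> n)" for n unfolding \<phi>_def by (intro smooth_add smooth_affine s(1))
  have der: "deriv (\<phi> n) x = \<theta> n x - \<theta> n (x - 1)" for n x
    unfolding \<phi>_def \<theta>_def
    by (rule DERIV_imp_deriv)
       (auto intro!: derivative_eq_intros DERIV_chain2[OF smoothD(2)[OF s(1)]] simp: algebra_simps)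
  have ds: "deriv \<sigma> y = 0" if "y < 0 \<or> y > 1" for y
  proof -
    have "(\<sigma> has_real_derivative 0) (at y)"
    proof (cases "y < 0")
      case True
      then show ?thesis
        by (intro has_field_derivative_transform_within_open[of "\<lambda>_. 0" 0 y "{..<0}" \<sigma>] DERIV_const) (auto simp: s(2))
    next
      case False
      with that have "y > 1" by simp
      then show ?thesis
        by (intro has_field_derivative_transform_within_open[of "\<lambda>_. 1" 0 y "{1<..}" \<sigma>] DERIV_const) (auto simp: s(3))
    qed
    then show ?thesis by (rule DERIV_imp_deriv)
  qed
  have big: "k n * x + k n * c \<ge> 1" if "x \<ge> 1 - c" for n x c
  proof -
    have "k n * 1 \<le> k n * (x + c)" using that k[of n] by (intro mult_left_mono) auto
    then show ?thesis using k[of n] by (simp add: distrib_left)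
  qed
  have small: "k n * x + k n * c \<le> 0" if "x \<le> - c" for n x c
    using that k[of n] mult_left_mono[of "x + c" 0 "k n"] by (auto simp: distrib_left)
  have out: "\<phi> n x = 0" if "2 \<le> \<bar>x\<bar>" for n x
  proof (cases "x \<ge> 0")
    case True
    have 1: "k n * x + k n / 2 \<ge> 1" "k n * x + (- k n / 2) \<ge> 1"
      using big[of "1/2" x n] big[of "-1/2" x n] True that by auto
    show ?thesis unfolding \<phi>_def s(3)[OF 1(1)] s(3)[OF 1(2)] by simp
  next
    case False
    have 1: "k n * x + k n / 2 \<le> 0" "k n * x + (- k n / 2) \<le> 0"
      using small[of x "1/2" n] small[of x "-1/2" n] False that by auto
    show ?thesis unfolding \<phi>_def s(2)[OF 1(1)] s(2)[OF 1(2)] by simp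
  qed
  have out\<theta>: "\<theta> n x = 0" if "2 \<le> \<bar>x\<bar>" for n x
  proof -
    have "k n * x + k n / 2 < 0 \<or> k n * x + k n / 2 > 1"
    proof (cases "x \<ge> 0")
      case True
      then have "k n * 2 \<le> k n * x" using that k[of n] by (intro mult_left_mono) auto
      then show ?thesis using k[of n] by linarith
    next
      case False
      then have "k n * x \<le> k n * (-2)" using that k[of n] by (intro mult_left_mono) auto
      then show ?thesis using k[of n] by linarith
    qed
    then show ?thesis unfolding \<theta>_def using ds by simp
  qed
  have cont\<theta>: "isCont (\<theta> n) x" for n x
  proof -
    have "isCont (deriv \<sigma>) y" for y
      by (rule DERIV_isCont[OF smoothD(2)[OF smoothD(1)[OF s(1)]]])
    then have "isCont (\<lambda>x. deriv \<sigma> (k n * x + k n / 2)) x"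
      by (rule isCont_o2[rotated]) (intro continuous_intros)
    then show ?thesis unfolding \<theta>_def by (intro continuous_mult continuous_const)
  qed
  have int\<theta>: "integrable lborel (\<lambda>x. w x * \<theta> n x)" for n
    using integrable_mult_compact_support[OF lw cont\<theta> out\<theta>] .
  have shift: "(\<lambda>x. w x * \<theta> n (x - 1)) = (\<lambda>x. (\<lambda>y. w y * \<theta> n y) (-1 + 1 * x))" for n
  proof
    fix x show "w x * \<theta> n (x - 1) = (\<lambda>y. w y * \<theta> n y) (-1 + 1 * x)"
    proof -
      have "w x = w (x - 1)" using per[of "x - 1"] by (simp only: diff_add_cancel)
      moreover have "-1 + 1 * x = x - 1" by simp
      ultimately show ?thesis by (simp only:)
    qed
  qed
  have int\<theta>': "integrable lborel (\<lambda>x. w x * \<theta> n (x - 1))" for n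
    unfolding shift by (rule lborel_integrable_real_affine[OF int\<theta>]) simp
  have eq\<theta>: "(\<integral>x. w x * \<theta> n (x - 1) \<partial>lborel) = (\<integral>x. w x * \<theta> n x \<partial>lborel)" for n
    unfolding shift using lborel_integral_real_affine[of 1 "\<lambda>y. w y * \<theta> n y" "-1"]
    by (simp only: abs_one scaleR_one)
  have z: "(\<integral>x. g x * \<phi> n x \<partial>lborel) = 0" for n
  proof -
    have "test_fun (\<phi> n)" unfolding test_fun_iff_smooth using sm out by blast
    from ibp[OF this] have "(\<integral>x. g x * \<phi> n x \<partial>lborel) = - (\<integral>x. w x * deriv (\<phi> n) x \<partial>lborel)" by simp
    also have "(\<integral>x. w x * deriv (\<phi> n) x \<partial>lborel) = (\<integral>x. w x * \<theta> n x - w x * \<theta> n (x - 1) \<partial>lborel)"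
      unfolding der by (simp add: right_diff_distrib)
    also have "\<dots> = 0" using int\<theta> int\<theta>' eq\<theta> by simp
    finally show ?thesis by simp
  qed
  have lims: "(\<lambda>n. \<sigma> (k n * x + k n * c)) \<longlonglongrightarrow> indicator {-c<..} x" for x c :: real
    using scaled_step_tendsto[of \<sigma> x "- c", OF s(2,3)] by (simp add: k_def algebra_simps)
  have phi_lim: "(\<lambda>n. \<phi> n x) \<longlonglongrightarrow> indicator {-1/2<..1/2} x" for x
  proof -
    have "(\<lambda>n. \<phi> n x) \<longlonglongrightarrow> 1 * indicator {-(1/2)<..} x + (-1) * indicator {-(-1/2)<..} x"
      unfolding \<phi>_def using lims[of x "1/2"] lims[of x "-1/2"]
      by (intro tendsto_add tendsto_mult tendsto_const) simp_all
    moreover have "1 * indicator {-(1/2)<..} x + (-1) * indicator {-(-1/2)<..} x = (indicator {-1/2<..1/2} x :: real)"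
      by (auto simp: indicator_def)
    ultimately show ?thesis by (simp only:)
  qed
  have "(\<lambda>n. \<integral>x. g x * \<phi> n x \<partial>lborel) \<longlonglongrightarrow> (\<integral>x. g x * indicator {-1/2<..1/2} x \<partial>lborel)"
  proof (rule integral_dominated_convergence)
    have "continuous_on UNIV \<sigma>" using smoothD(2)[OF s(1)] DERIV_isCont by (blast intro: continuous_at_imp_continuous_on)
    then have [measurable]: "\<sigma> \<in> borel_measurable borel" by (rule borel_measurable_continuous_onI)
    show "(\<lambda>x. g x * \<phi> n x) \<in> borel_measurable lborel" for n unfolding \<phi>_def by measurable
    show "(\<lambda>x. g x * indicator {-1/2<..1/2} x) \<in> borel_measurable lborel" by measurable
    show "integrable lborel (\<lambda>x. \<bar>g x * indicator {-2..2} x\<bar>)"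
      by (intro integrable_abs loc_integrable_subset[OF lg, of _ "-2" 2]) auto
    show "AE x in lborel. (\<lambda>n. g x * \<phi> n x) \<longlonglongrightarrow> g x * indicator {-1/2<..1/2} x"
      using phi_lim by (intro AE_I2 tendsto_mult tendsto_const) auto
    fix n
    show "AE x in lborel. norm (g x * \<phi> n x) \<le> \<bar>g x * indicator {-2..2} x\<bar>"
    proof (rule AE_I2)
      fix x
      have "\<bar>\<phi> n x\<bar> \<le> 1"
        using s(4)[of "k n * x + k n / 2"] s(4)[of "k n * x + (- k n / 2)"] unfolding \<phi>_def by linarith
      then have "\<bar>g x\<bar> * \<bar>\<phi> n x\<bar> \<le> \<bar>g x\<bar> * 1" by (intro mult_left_mono) auto
      then show "norm (g x * \<phi> n x) \<le> \<bar>g x * indicator {-2..2} x\<bar>"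
        using out[of x n] by (cases "x \<in> {-2..2}") (auto simp: abs_mult not_le)
    qed
  qed
  then show ?thesis unfolding z using LIMSEQ_unique tendsto_const by blast
qed

text \<open>Signed indicator of the interval between 0 and x, so that \<open>primitive g x\<close>
  is the oriented integral of g from 0 to x, also for negative x. In kernel form, measurability in x
  and the exchange of integrals are direct.\<close>

definition primitive_kernel :: "real \<Rightarrow> real \<Rightarrow> real" where
  "primitive_kernel x t = (if 0 < t \<and> t \<le> x then 1 else if x < t \<and> t \<le> 0 then -1 else 0)"

definition primitive :: "(real \<Rightarrow> real) \<Rightarrow> real \<Rightarrow> real" where
  "primitive g x = (\<integral>t. g t * primitive_kernel x t \<partial>lborel)"

lemma primitive_kernel_measurable [measurable]:
  assumes [measurable]: "f \<in> borel_measurable M" "g \<in> borel_measurable M"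
  shows "(\<lambda>z. primitive_kernel (f z) (g z)) \<in> borel_measurable M"
  unfolding primitive_kernel_def by measurable

text \<open>Fubini: integrating the kernel against \<open>deriv \<phi>\<close> in its first variable
  returns -\<phi>. No pointwise differentiation of the primitive is involved.\<close>

lemma has_weak_deriv_primitive:
  assumes li: "\<And>a b. set_integrable lborel {a..b} g"
  shows "has_weak_deriv (primitive g) g"
  unfolding has_weak_deriv_def
proof (intro conjI allI impI)
  have gm[measurable]: "g \<in> borel_measurable borel" by (rule loc_integrable_measurable[OF li])
  have vm[measurable]: "primitive g \<in> borel_measurable borel"
  proof -
    have "(\<lambda>x. \<integral>t. g t * primitive_kernel x t \<partial>lborel) \<in> borel_measurable borel"
      by (rule lborel.borel_measurable_lebesgue_integral) (simp add: case_prod_beta)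
    then show ?thesis unfolding primitive_def[abs_def] .
  qed
  have gi: "integrable lborel (\<lambda>x. g x * indicator {-R..R} x)" for R
    by (rule loc_integrable_subset[OF li, of _ "-R" R]) auto
  have gk: "\<bar>g t * primitive_kernel x t\<bar> \<le> \<bar>g t * indicator {-R..R} t\<bar>" if "\<bar>x\<bar> \<le> R" for x t R
    using that by (auto simp: primitive_kernel_def indicator_def)
  have gki: "integrable lborel (\<lambda>t. g t * primitive_kernel x t)" for x
    by (rule Bochner_Integration.integrable_bound[OF gi[of "\<bar>x\<bar>"]]) (use gk[of x "\<bar>x\<bar>"] in auto)
  show "set_integrable lborel {a..b} g" for a b by (rule li)
  show "set_integrable lborel {a..b} (primitive g)" for a b
    unfolding set_integrable_def
  proof (rule integrableI_bounded_set_indicator[where B="\<integral>t. \<bar>g t * indicator {-(\<bar>a\<bar>+\<bar>b\<bar>)..(\<bar>a\<bar>+\<bar>b\<bar>)} t\<bar> \<partial>lborel"])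
    show "AE x in lborel. x \<in> {a..b} \<longrightarrow> norm (primitive g x) \<le> (\<integral>t. \<bar>g t * indicator {-(\<bar>a\<bar>+\<bar>b\<bar>)..(\<bar>a\<bar>+\<bar>b\<bar>)} t\<bar> \<partial>lborel)"
    proof (intro AE_I2 impI)
      fix x assume "x \<in> {a..b}"
      then have x: "\<bar>x\<bar> \<le> \<bar>a\<bar> + \<bar>b\<bar>" by auto
      have "norm (primitive g x) \<le> (\<integral>t. \<bar>g t * primitive_kernel x t\<bar> \<partial>lborel)"
        unfolding primitive_def by (simp only: real_norm_def) (rule integral_abs_bound)
      also have "\<dots> \<le> (\<integral>t. \<bar>g t * indicator {-(\<bar>a\<bar>+\<bar>b\<bar>)..(\<bar>a\<bar>+\<bar>b\<bar>)} t\<bar> \<partial>lborel)"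
        by (intro integral_mono integrable_abs gki gi gk x)
      finally show "norm (primitive g x) \<le> (\<integral>t. \<bar>g t * indicator {-(\<bar>a\<bar>+\<bar>b\<bar>)..(\<bar>a\<bar>+\<bar>b\<bar>)} t\<bar> \<partial>lborel)" .
    qed
  qed (auto simp: emeasure_lborel_Icc_eq)
  fix \<phi> assume t: "test_fun \<phi>"
  obtain R where R: "R > 0" "\<And>x. R \<le> \<bar>x\<bar> \<Longrightarrow> \<phi> x = 0" "\<And>x. R \<le> \<bar>x\<bar> \<Longrightarrow> deriv \<phi> x = 0"
    using test_funE[OF t] by blast
  have "continuous_on UNIV (deriv \<phi>)" using test_fun_deriv(3)[OF t] by (intro continuous_at_imp_continuous_on) auto
  then have dm[measurable]: "deriv \<phi> \<in> borel_measurable borel" by (rule borel_measurable_continuous_onI)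
  have one: "set_integrable lborel {-R..R} (\<lambda>_. 1::real)" by (rule set_integrable_const)
  have di: "integrable lborel (deriv \<phi>)"
    using integrable_mult_compact_support[OF one test_fun_deriv(3)[OF t] R(3)] by simp
  \<comment> \<open>As a function of x the kernel is the indicator of \<open>{s..}\<close> for s > 0
    and minus the indicator of \<open>{..<s}\<close> otherwise.\<close>
  have inner: "(\<integral>x. primitive_kernel x s * deriv \<phi> x \<partial>lborel) = - \<phi> s" for s
  proof (cases "s > 0")
    case True
    then have "(\<integral>x. primitive_kernel x s * deriv \<phi> x \<partial>lborel) = (\<integral>x. deriv \<phi> x * indicator {s..} x \<partial>lborel)"
      by (intro Bochner_Integration.integral_cong) (auto simp: primitive_kernel_def indicator_def)
    then show ?thesis
      using integral_deriv_compact_support(1)[OF test_fun_deriv(1)[OF t] test_fun_deriv(3)[OF t] R(2,3)] by simp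
  next
    case False
    then have "(\<integral>x. primitive_kernel x s * deriv \<phi> x \<partial>lborel) = (\<integral>x. - (deriv \<phi> x * indicator {..<s} x) \<partial>lborel)"
      by (intro Bochner_Integration.integral_cong) (auto simp: primitive_kernel_def indicator_def)
    then show ?thesis
      using integral_deriv_compact_support(2)[OF test_fun_deriv(1)[OF t] test_fun_deriv(3)[OF t] R(2,3)] by simp
  qed
  have bound: "\<bar>g s * primitive_kernel x s * deriv \<phi> x\<bar> \<le> \<bar>g s * indicator {-R..R} s\<bar> * \<bar>deriv \<phi> x\<bar>" for x s
  proof (cases "\<bar>x\<bar> \<le> R")
    case True
    show ?thesis unfolding abs_mult[of _ "deriv \<phi> x"] by (intro mult_right_mono gk True) auto
  qed (use R(3)[of x] in auto)
  have prod_int: "integrable (lborel \<Otimes>\<^sub>M lborel) (\<lambda>(x, s). g s * primitive_kernel x s * deriv \<phi> x)"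
  proof (rule Bochner_Integration.integrable_bound)
    show "integrable (lborel \<Otimes>\<^sub>M lborel) (\<lambda>(x, s). \<bar>g s * indicator {-R..R} s\<bar> * \<bar>deriv \<phi> x\<bar>)"
    proof (rule lborel_pair.Fubini_integrable)
      show "integrable lborel (\<lambda>x. \<integral>s. norm (case (x, s) of (x, s) \<Rightarrow> \<bar>g s * indicator {-R..R} s\<bar> * \<bar>deriv \<phi> x\<bar>) \<partial>lborel)"
        using di by (simp add: abs_mult)
      show "AE x in lborel. integrable lborel (\<lambda>s. case (x, s) of (x, s) \<Rightarrow> \<bar>g s * indicator {-R..R} s\<bar> * \<bar>deriv \<phi> x\<bar>)"
        using gi[of R] by (intro AE_I2) simp
    qed measurable
  qed (use bound in \<open>auto intro!: AE_I2 simp: case_prod_beta\<close>)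
  have "(\<integral>x. primitive g x * deriv \<phi> x \<partial>lborel) = (\<integral>x. \<integral>s. g s * primitive_kernel x s * deriv \<phi> x \<partial>lborel \<partial>lborel)"
    unfolding primitive_def by simp
  also have "\<dots> = (\<integral>s. \<integral>x. g s * primitive_kernel x s * deriv \<phi> x \<partial>lborel \<partial>lborel)"
    by (rule lborel_pair.Fubini_integral[OF prod_int, symmetric])
  also have "\<dots> = (\<integral>s. g s * (- \<phi> s) \<partial>lborel)"
    using inner by (simp add: mult.assoc)
  also have "\<dots> = - (\<integral>x. g x * \<phi> x \<partial>lborel)" by simp
  finally show "(\<integral>x. primitive g x * deriv \<phi> x \<partial>lborel) = - (\<integral>x. g x * \<phi> x \<partial>lborel)" .
qed

section \<open>Stationary fields and correctors\<close>

lemma prob_space_cell: "prob_space cell"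
  by (rule prob_spaceI) (simp add: cell_def emeasure_restrict_space space_restrict_space)

lemma space_cell: "space cell = {-1/2..1/2}"
  by (simp add: cell_def space_restrict_space)

lemma measurable_id_cell: "(\<lambda>x. x) \<in> cell \<rightarrow>\<^sub>M lborel"
  unfolding cell_def by (rule measurable_restrict_space1) simp

lemma borel_measurable_cell: "f \<in> borel_measurable borel \<Longrightarrow> f \<in> borel_measurable cell"
  by (rule measurable_compose[OF measurable_id_cell]) simp

lemma AE_cell_iff: "(AE x in cell. P x) \<longleftrightarrow> (AE x in lborel. x \<in> {-1/2..1/2} \<longrightarrow> P x)"
  unfolding cell_def by (rule AE_restrict_space_iff) simp

lemma AE_cellI: "AE x in lborel. P x \<Longrightarrow> AE x in cell. P x"
  unfolding AE_cell_iff by (auto elim: eventually_mono)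

lemma integrable_cell_iff:
  fixes f :: "real \<Rightarrow> real"
  shows "integrable cell f \<longleftrightarrow> set_integrable lborel {-1/2..1/2} f"
  unfolding cell_def set_integrable_def by (rule integrable_restrict_space) simp

lemma integral_cell:
  fixes f :: "real \<Rightarrow> real"
  shows "(\<integral>x. f x \<partial>cell) = (\<integral>x. f x * indicator {-1/2..1/2} x \<partial>lborel)"
  unfolding cell_def by (subst integral_restrict_space) (simp_all add: mult.commute)

lemma AE_lborel_translate:
  fixes c :: real
  assumes "AE x in lborel. P x"
  shows "AE x in lborel. P (x + c)"
proof -
  have "AE x in distr lborel borel ((+) c). P x" by (subst lborel_distr_plus) (rule assms)
  from AE_distrD[OF _ this] have "AE x in lborel. P (c + x)" by simp
  then show ?thesis by (simp add: add.commute)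
qed

text \<open>The closed cells centred at the integers are countably many and cover the line;
  \<open>\<lfloor>x + 1/2\<rfloor>\<close> is the centre of one that contains x.\<close>

lemma AE_lborel_cells:
  assumes "\<And>k::int. AE x in cell. P (x + real_of_int k)"
  shows "AE x in lborel. P x"
proof -
  have "AE x in lborel. x - real_of_int k \<in> {-1/2..1/2} \<longrightarrow> P x" for k
    using AE_lborel_translate[OF assms[of k, unfolded AE_cell_iff], of "- real_of_int k"] by simp
  then have "AE x in lborel. \<forall>k::int. x - real_of_int k \<in> {-1/2..1/2} \<longrightarrow> P x"
    unfolding AE_all_countable by blast
  then show ?thesis
  proof eventually_elim
    case (elim x)
    have "x - real_of_int \<lfloor>x + 1/2\<rfloor> \<in> {-1/2..1/2}" by auto linarith+
    then show ?case using elim by blast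
  qed
qed

lemma set_integrable_cells:
  fixes f :: "real \<Rightarrow> real"
  assumes "\<And>k::int. integrable cell (\<lambda>x. f (x + real_of_int k))"
  shows "set_integrable lborel {a..b} f"
proof -
  have k: "set_integrable lborel {real_of_int k - 1/2..real_of_int k + 1/2} f" for k :: int
  proof -
    have "integrable lborel (\<lambda>x. indicator {-1/2..1/2} x *\<^sub>R f (x + real_of_int k))"
      using assms[of k] unfolding integrable_cell_iff set_integrable_def .
    from lborel_integrable_real_affine[OF this, of 1 "- real_of_int k"]
    show ?thesis unfolding set_integrable_def
      by (rule Bochner_Integration.integrable_cong[OF refl, THEN iffD1, rotated]) (auto simp: indicator_def)
  qed
  define N where "N = \<lceil>\<bar>a\<bar> + \<bar>b\<bar>\<rceil> + 1"
  have "set_integrable lborel (\<Union>k\<in>{-N..N}. {real_of_int k - 1/2..real_of_int k + 1/2}) f"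
    by (rule set_integrable_UN) (use k in auto)
  then show ?thesis
  proof (rule set_integrable_subset)
    show "{a..b} \<subseteq> (\<Union>k\<in>{-N..N}. {real_of_int k - 1/2..real_of_int k + 1/2})"
    proof
      fix x assume x: "x \<in> {a..b}"
      show "x \<in> (\<Union>k\<in>{-N..N}. {real_of_int k - 1/2..real_of_int k + 1/2})"
      proof
        show "\<lfloor>x + 1/2\<rfloor> \<in> {-N..N}" using x unfolding N_def by auto linarith+
        show "x \<in> {real_of_int \<lfloor>x + 1/2\<rfloor> - 1/2..real_of_int \<lfloor>x + 1/2\<rfloor> + 1/2}" by auto linarith+
      qed
    qed
  qed auto
qed

section \<open>Ergodic actions and stationary fields\<close>

locale ergodic_Z_system =
  fixes M :: "'a measure" and \<tau> :: "int \<Rightarrow> 'a \<Rightarrow> 'a"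
  assumes erg: "ergodic_Z_action M \<tau>"
begin

sublocale M: prob_space M using erg unfolding ergodic_Z_action_def by blast
sublocale cell: prob_space cell by (rule prob_space_cell)
sublocale P: pair_prob_space cell M ..

abbreviation CM where "CM \<equiv> cell \<Otimes>\<^sub>M M"

lemma tau_measurable [measurable]: "\<tau> k \<in> M \<rightarrow>\<^sub>M M"
  using erg unfolding ergodic_Z_action_def by blast

lemma distr_tau: "distr M M (\<tau> k) = M"
  using erg unfolding ergodic_Z_action_def by blast

lemma tau_space: "\<omega> \<in> space M \<Longrightarrow> \<tau> k \<omega> \<in> space M"
  by (rule measurable_space[OF tau_measurable])

lemma tau_add: "\<omega> \<in> space M \<Longrightarrow> \<tau> (j + k) \<omega> = \<tau> j (\<tau> k \<omega>)"
  using erg unfolding ergodic_Z_action_def by blast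

lemma tau_zero: "\<omega> \<in> space M \<Longrightarrow> \<tau> 0 \<omega> = \<omega>"
  using erg unfolding ergodic_Z_action_def by blast

lemma AE_tau: "AE \<omega> in M. Q \<omega> \<Longrightarrow> AE \<omega> in M. Q (\<tau> k \<omega>)"
  by (rule AE_distrD[OF tau_measurable]) (subst distr_tau)

text \<open>Ergodicity speaks of exactly invariant events, whereas \<open>f\<close> is invariant
  only almost everywhere. Intersecting with \<open>G\<close>, the full-measure set of points along
  whose whole orbit \<open>f\<close> is constant, makes the level events exactly invariant. If
  \<open>f\<close> exceeded its mean with probability 1, the mean would exceed itself; so it does so
  with probability 0, and likewise from below.\<close>

lemma invariant_AE_const:
  fixes f :: "'a \<Rightarrow> real"
  assumes f: "integrable M f" and inv: "\<And>k. AE \<omega> in M. f (\<tau> k \<omega>) = f \<omega>"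
  shows "AE \<omega> in M. f \<omega> = (\<integral>\<omega>. f \<omega> \<partial>M)"
proof -
  note [measurable] = borel_measurable_integrable[OF f]
  define c where "c = (\<integral>\<omega>. f \<omega> \<partial>M)"
  define G where "G = {\<omega> \<in> space M. \<forall>k. f (\<tau> k \<omega>) = f \<omega>}"
  have G[measurable]: "G \<in> sets M" unfolding G_def by measurable
  have AEG: "AE \<omega> in M. \<omega> \<in> G"
  proof -
    have "AE \<omega> in M. \<forall>k. f (\<tau> k \<omega>) = f \<omega>" unfolding AE_all_countable using inv by blast
    then show ?thesis using AE_space by eventually_elim (simp add: G_def)
  qed
  have Ginv: "\<tau> k \<omega> \<in> G \<longleftrightarrow> \<omega> \<in> G" if w: "\<omega> \<in> space M" for k \<omega>
  proof
    assume "\<omega> \<in> G"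
    then show "\<tau> k \<omega> \<in> G" using w tau_space tau_add[OF w] unfolding G_def by (auto simp flip: tau_add)
  next
    assume g: "\<tau> k \<omega> \<in> G"
    \<comment> \<open>By the group law \<open>\<tau> j \<omega>\<close> is
      \<open>\<tau> (j - k)\<close> applied to \<open>\<tau> k \<omega>\<close>; this is where
      invertibility of the action enters.\<close>
    have "f (\<tau> j \<omega>) = f (\<tau> k \<omega>)" for j
      using g tau_add[OF w, of "j - k" k] unfolding G_def by simp
    from this this[of 0] show "\<omega> \<in> G" using w tau_zero[OF w] unfolding G_def by simp
  qed
  have zo: "M.prob (G \<inter> {\<omega>\<in>space M. f \<omega> \<in> B}) = 0 \<or> M.prob (G \<inter> {\<omega>\<in>space M. f \<omega> \<in> B}) = 1"
    if B[measurable]: "B \<in> sets borel" for B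
  proof -
    have "\<tau> k -` (G \<inter> {\<omega>\<in>space M. f \<omega> \<in> B}) \<inter> space M = G \<inter> {\<omega>\<in>space M. f \<omega> \<in> B}" for k
    proof -
      have "f (\<tau> k \<omega>) = f \<omega>" if "\<omega> \<in> G" for \<omega> using that unfolding G_def by blast
      then show ?thesis using Ginv tau_space sets.sets_into_space[OF G] by auto
    qed
    moreover have "G \<inter> {\<omega>\<in>space M. f \<omega> \<in> B} \<in> sets M" by measurable
    ultimately show ?thesis using erg unfolding ergodic_Z_action_def by blast
  qed
  have AE0: "AE \<omega> in M. f \<omega> \<notin> B" if B[measurable]: "B \<in> sets borel"
    and no: "\<not> (AE \<omega> in M. f \<omega> \<in> B)" for B
  proof -
    have "M.prob (G \<inter> {\<omega>\<in>space M. f \<omega> \<in> B}) \<noteq> 1"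
    proof
      assume "M.prob (G \<inter> {\<omega>\<in>space M. f \<omega> \<in> B}) = 1"
      then have "AE \<omega> in M. \<omega> \<in> G \<inter> {\<omega>\<in>space M. f \<omega> \<in> B}" by (subst M.AE_in_set_eq_1) auto
      then have "AE \<omega> in M. f \<omega> \<in> B" by eventually_elim auto
      with no show False by blast
    qed
    then have "M.prob (G \<inter> {\<omega>\<in>space M. f \<omega> \<in> B}) = 0" using zo[OF B] by blast
    then have "AE \<omega> in M. \<omega> \<notin> G \<inter> {\<omega>\<in>space M. f \<omega> \<in> B}"
      by (subst (asm) M.prob_eq_0) auto
    then show ?thesis using AEG by eventually_elim (auto dest: sets.sets_into_space[OF G, THEN subsetD])
  qed
  have "\<not> (AE \<omega> in M. f \<omega> \<in> {c<..})"
  proof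
    assume "AE \<omega> in M. f \<omega> \<in> {c<..}"
    then have "c < M.expectation f" by (intro M.expectation_greater f) auto
    then show False by (simp add: c_def)
  qed
  from AE0[OF _ this] have 1: "AE \<omega> in M. f \<omega> \<notin> {c<..}" by simp
  have "\<not> (AE \<omega> in M. f \<omega> \<in> {..<c})"
  proof
    assume "AE \<omega> in M. f \<omega> \<in> {..<c}"
    then have "M.expectation f < c" by (intro M.expectation_less f) auto
    then show False by (simp add: c_def)
  qed
  from AE0[OF _ this] have 2: "AE \<omega> in M. f \<omega> \<notin> {..<c}" by simp
  from 1 2 show ?thesis unfolding c_def[symmetric] by eventually_elim auto
qed

lemma field_measurable_cell:
  "field_measurable M F \<Longrightarrow> (\<lambda>z. F (fst z) (snd z)) \<in> borel_measurable CM"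
proof -
  assume F: "field_measurable M F"
  have "(\<lambda>z. (fst z, snd z)) \<in> CM \<rightarrow>\<^sub>M lborel \<Otimes>\<^sub>M M"
    by (intro measurable_Pair measurable_snd measurable_compose[OF measurable_fst measurable_id_cell])
  from measurable_compose[OF this F[unfolded field_measurable_def]] show ?thesis by simp
qed

lemma field_measurable_section:
  assumes F: "field_measurable M F" and w: "\<omega> \<in> space M"
  shows "(\<lambda>x. F x \<omega>) \<in> borel_measurable borel"
proof -
  have "(\<lambda>x. (x, \<omega>)) \<in> lborel \<rightarrow>\<^sub>M lborel \<Otimes>\<^sub>M M" using w by simp
  from measurable_compose[OF this F[unfolded field_measurable_def]] show ?thesis by simp
qed

lemma AE_pair_snd_iff:
  assumes "{z \<in> space CM. Q (fst z) (snd z)} \<in> sets CM"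
  shows "(AE z in CM. Q (fst z) (snd z)) \<longleftrightarrow> (AE \<omega> in M. AE x in cell. Q x \<omega>)"
  using P.AE_pair_iff[OF assms] P.AE_commute[OF assms] by simp

text \<open>On the k-th translate of the cell the property at \<omega> is the property on the cell
  itself at \<open>\<tau> k \<omega>\<close>, and each \<tau> k preserves the measure. Bounds known
  on the cell thereby hold on the whole line.\<close>

lemma AE_stationary_extend:
  assumes Q: "{z \<in> space CM. Q (fst z) (snd z)} \<in> sets CM"
    and st: "\<And>k x \<omega>. \<omega> \<in> space M \<Longrightarrow> Q (x + real_of_int k) \<omega> \<longleftrightarrow> Q x (\<tau> k \<omega>)"
    and ae: "AE z in CM. Q (fst z) (snd z)"
  shows "AE \<omega> in M. AE x in lborel. Q x \<omega>"
proof -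
  have "AE \<omega> in M. AE x in cell. Q x \<omega>" using ae AE_pair_snd_iff[OF Q] by simp
  then have "AE \<omega> in M. AE x in cell. Q x (\<tau> k \<omega>)" for k by (rule AE_tau)
  then have "AE \<omega> in M. \<forall>k. AE x in cell. Q x (\<tau> k \<omega>)" unfolding AE_all_countable by blast
  then show ?thesis using AE_space
  proof eventually_elim
    case (elim \<omega>)
    then show ?case using st by (intro AE_lborel_cells) simp
  qed
qed

lemma stationary_loc_integrable:
  assumes st: "stationary M \<tau> F" and i: "integrable CM (\<lambda>z. F (fst z) (snd z))"
  shows "AE \<omega> in M. \<forall>a b. set_integrable lborel {a..b} (\<lambda>x. F x \<omega>)"
proof -
  have "AE \<omega> in M. integrable cell (\<lambda>x. F x \<omega>)"
    by (rule P.AE_integrable_snd) (use i in \<open>simp add: case_prod_beta'\<close>)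
  then have "AE \<omega> in M. integrable cell (\<lambda>x. F x (\<tau> k \<omega>))" for k by (rule AE_tau)
  then have "AE \<omega> in M. \<forall>k. integrable cell (\<lambda>x. F x (\<tau> k \<omega>))" unfolding AE_all_countable by blast
  then show ?thesis using AE_space
  proof eventually_elim
    case (elim \<omega>)
    then show ?case using st unfolding stationary_def by (intro allI set_integrable_cells) simp
  qed
qed

text \<open>The constant from \<open>du_Bois_Reymond\<close> depends on \<omega> through an
  existential, which leaves its measurability open. It is therefore read off as the cell average
  \<open>m\<close>, measurable by Fubini and invariant under the action, so that ergodicity
  identifies it with the expectation \<open>c\<close>.\<close>

lemma stoch_corrector_flux:
  fixes a :: "real \<Rightarrow> 'a \<Rightarrow> real"
  assumes am: "field_measurable M a" and ast: "stationary M \<tau> a"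
    and bnd: "AE z in CM. \<alpha> \<le> a (fst z) (snd z) \<and> a (fst z) (snd z) \<le> \<beta>" and al: "0 < \<alpha>"
    and sc: "stoch_corrector M \<tau> a w Dw"
  defines "c \<equiv> (\<integral>z. a (fst z) (snd z) * (Dw (fst z) (snd z) + 1) \<partial>CM)"
  shows "AE z in CM. a (fst z) (snd z) * (Dw (fst z) (snd z) + 1) = c"
    and "c * (\<integral>z. 1 / a (fst z) (snd z) \<partial>CM) = 1"
proof -
  have Dm: "field_measurable M Dw" and Dst: "stationary M \<tau> Dw"
    and Di: "integrable CM (\<lambda>z. Dw (fst z) (snd z))"
    and eqn: "AE \<omega> in M. has_weak_deriv (\<lambda>x. w x \<omega>) (\<lambda>x. Dw x \<omega>) \<and>
                 weakly_divfree (\<lambda>x. a x \<omega> * (Dw x \<omega> + 1))"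
    and mean: "(\<integral>z. Dw (fst z) (snd z) \<partial>CM) = 0"
    using sc unfolding stoch_corrector_def by auto
  define F where "F x \<omega> = a x \<omega> * (Dw x \<omega> + 1)" for x \<omega>
  have amc[measurable]: "(\<lambda>z. a (fst z) (snd z)) \<in> borel_measurable CM"
    and Dmc[measurable]: "(\<lambda>z. Dw (fst z) (snd z)) \<in> borel_measurable CM"
    using am Dm by (auto intro: field_measurable_cell)
  have Fmc[measurable]: "(\<lambda>z. F (fst z) (snd z)) \<in> borel_measurable CM"
    unfolding F_def by measurable
  have Fi: "integrable CM (\<lambda>z. F (fst z) (snd z))"
  proof (rule Bochner_Integration.integrable_bound)
    show "integrable CM (\<lambda>z. \<beta> * (Dw (fst z) (snd z) + 1))"
      using Di by simp
    show "AE z in CM. norm (F (fst z) (snd z)) \<le> norm (\<beta> * (Dw (fst z) (snd z) + 1))"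
      using bnd by eventually_elim (use al in \<open>auto simp: F_def abs_mult intro!: mult_right_mono\<close>)
  qed measurable
  have "AE \<omega> in M. AE x in lborel. \<alpha> \<le> a x \<omega> \<and> a x \<omega> \<le> \<beta>"
    using ast by (intro AE_stationary_extend[OF _ _ bnd]) (simp_all add: stationary_def)
  then have const: "AE \<omega> in M. \<exists>C. AE x in lborel. F x \<omega> = C"
    using eqn AE_space
  proof eventually_elim
    case (elim \<omega>)
    note w = \<open>\<omega> \<in> space M\<close>
    have Dl: "set_integrable lborel {s..t} (\<lambda>x. Dw x \<omega>)" for s t
      using elim(2) unfolding has_weak_deriv_def by blast
    have "set_integrable lborel {s..t} (\<lambda>x. a x \<omega> * (Dw x \<omega> + 1))" for s t
    proof (rule set_integrable_mult_bounded[where B=\<beta>])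
      show "set_integrable lborel {s..t} (\<lambda>x. Dw x \<omega> + 1)"
        by (intro set_integral_add Dl set_integrable_const)
      show "AE x in lborel. \<bar>a x \<omega>\<bar> \<le> \<beta>" using elim(1) by eventually_elim (use al in auto)
      show "(\<lambda>x. Dw x \<omega> + 1) \<in> borel_measurable borel"
        using field_measurable_section[OF Dm w] by measurable
    qed (rule field_measurable_section[OF am w])
    then show ?case using du_Bois_Reymond elim(2) unfolding F_def by blast
  qed
  define m where "m \<omega> = (\<integral>x. F x \<omega> \<partial>cell)" for \<omega>
  have Fsec: "(\<lambda>x. F x \<omega>) \<in> borel_measurable borel" if "\<omega> \<in> space M" for \<omega>
    using field_measurable_section[OF am that] field_measurable_section[OF Dm that] unfolding F_def by measurable
  have Fst: "F (x + real_of_int k) \<omega> = F x (\<tau> k \<omega>)" if "\<omega> \<in> space M" for k x \<omega>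
    using that ast Dst unfolding F_def stationary_def by simp
  \<comment> \<open>The average over the cell at \<open>\<tau> k \<omega>\<close> is the average at
    \<omega> over the k-th cell, where the flux has the same constant value.\<close>
  have mC: "m (\<tau> k \<omega>) = C" if "AE x in lborel. F x \<omega> = C" "\<omega> \<in> space M" for k \<omega> C
  proof -
    have "m (\<tau> k \<omega>) = (\<integral>x. C \<partial>cell)"
      unfolding m_def
    proof (rule integral_cong_AE)
      show "(\<lambda>x. F x (\<tau> k \<omega>)) \<in> borel_measurable cell"
        by (intro borel_measurable_cell Fsec tau_space that(2))
      show "AE x in cell. F x (\<tau> k \<omega>) = C"
        using AE_lborel_translate[OF that(1), of "real_of_int k"] Fst[OF that(2)] by (intro AE_cellI) simp
    qed simp
    then show ?thesis by (simp add: cell.prob_space)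
  qed
  have inv: "AE \<omega> in M. m (\<tau> k \<omega>) = m \<omega>" for k
    using const AE_space
  proof eventually_elim
    case (elim \<omega>)
    then show ?case using mC[of \<omega> _ k] mC[of \<omega> _ 0] tau_zero by auto
  qed
  have mi: "integrable M m" and mE: "(\<integral>\<omega>. m \<omega> \<partial>M) = c"
    unfolding m_def c_def using P.integrable_snd[of F] P.integral_snd[of F] Fi
    by (simp_all add: case_prod_beta' F_def)
  have mc: "AE \<omega> in M. m \<omega> = c" using invariant_AE_const[OF mi inv] mE by simp
  have "AE \<omega> in M. AE x in cell. F x \<omega> = c"
    using const mc AE_space
  proof eventually_elim
    case (elim \<omega>)
    then obtain C where C: "AE x in lborel. F x \<omega> = C" by blast
    have "C = c" using mC[OF C, of 0] elim tau_zero by simp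
    then show ?case using C by (auto intro: AE_cellI)
  qed
  then show flux: "AE z in CM. a (fst z) (snd z) * (Dw (fst z) (snd z) + 1) = c"
    using AE_pair_snd_iff[of "\<lambda>x \<omega>. F x \<omega> = c"] unfolding F_def by simp
  have "c * (\<integral>z. 1 / a (fst z) (snd z) \<partial>CM) = (\<integral>z. c * (1 / a (fst z) (snd z)) \<partial>CM)"
    by (rule integral_mult_right_zero[symmetric])
  also have "\<dots> = (\<integral>z. Dw (fst z) (snd z) + 1 \<partial>CM)"
  proof (rule integral_cong_AE)
    show "AE z in CM. c * (1 / a (fst z) (snd z)) = Dw (fst z) (snd z) + 1"
      using flux bnd by eventually_elim (use al in \<open>auto simp: field_simps\<close>)
  qed measurable
  also have "\<dots> = 1" using Di mean P.prob_space by simp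
  finally show "c * (\<integral>z. 1 / a (fst z) (snd z) \<partial>CM) = 1" .
qed

text \<open>Deterministic counterpart, in which mean zero has to be derived from periodicity.
  \<open>periodic_weak_deriv_mean_zero\<close> gives it on the half-open cell, which differs from
  the closed one by a null set.\<close>

lemma per_corrector_flux:
  fixes a :: "real \<Rightarrow> real"
  assumes am: "a \<in> borel_measurable borel"
    and bnd: "AE x in lborel. \<alpha> \<le> a x \<and> a x \<le> \<beta>" and al: "0 < \<alpha>"
    and pc: "per_corrector a w Dw"
  defines "c \<equiv> (\<integral>x. a x * (Dw x + 1) \<partial>cell)"
  shows "Dw \<in> borel_measurable borel" and "AE x in lborel. a x * (Dw x + 1) = c"
    and "c * (\<integral>x. 1 / a x \<partial>cell) = 1"
proof -
  have per: "\<And>x. w (x + 1) = w x" and wd: "has_weak_deriv w Dw" and df: "weakly_divfree (\<lambda>x. a x * (Dw x + 1))"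
    using pc unfolding per_corrector_def by auto
  have Dl: "set_integrable lborel {s..t} Dw" for s t using wd unfolding has_weak_deriv_def by blast
  show Dm[measurable]: "Dw \<in> borel_measurable borel" by (rule loc_integrable_measurable[OF Dl])
  have [measurable]: "Dw \<in> borel_measurable cell" "a \<in> borel_measurable cell"
    using Dm am by (auto intro: borel_measurable_cell)
  have "set_integrable lborel {s..t} (\<lambda>x. a x * (Dw x + 1))" for s t
  proof (rule set_integrable_mult_bounded[where B=\<beta>])
    show "set_integrable lborel {s..t} (\<lambda>x. Dw x + 1)"
      by (intro set_integral_add Dl set_integrable_const)
    show "AE x in lborel. \<bar>a x\<bar> \<le> \<beta>" using bnd by eventually_elim (use al in auto)
  qed (use am in measurable)
  from du_Bois_Reymond[OF this df] obtain C where C: "AE x in lborel. a x * (Dw x + 1) = C" by blast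
  have "c = (\<integral>x. C \<partial>cell)"
    unfolding c_def by (intro integral_cong_AE AE_cellI[OF C]) simp_all
  then have cC: "c = C" by (simp add: cell.prob_space)
  then show "AE x in lborel. a x * (Dw x + 1) = c" using C by simp
  have Di: "integrable cell Dw" using Dl by (simp add: integrable_cell_iff)
  have "(\<integral>x. Dw x \<partial>cell) = (\<integral>x. Dw x * indicator {-1/2<..1/2} x \<partial>lborel)"
    unfolding integral_cell
  proof (rule integral_cong_AE)
    show "AE x in lborel. Dw x * indicator {-1/2..1/2} x = Dw x * indicator {-1/2<..1/2} x"
      using AE_lborel_singleton[of "-1/2"] by eventually_elim (auto simp: indicator_def)
  qed measurable
  then have mean: "(\<integral>x. Dw x \<partial>cell) = 0" using periodic_weak_deriv_mean_zero[OF per wd] by simp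
  have "c * (\<integral>x. 1 / a x \<partial>cell) = (\<integral>x. c * (1 / a x) \<partial>cell)"
    by (rule integral_mult_right_zero[symmetric])
  also have "\<dots> = (\<integral>x. Dw x + 1 \<partial>cell)"
  proof (rule integral_cong_AE)
    show "AE x in cell. c * (1 / a x) = Dw x + 1"
      using AE_cellI[OF C] AE_cellI[OF bnd] by eventually_elim (use al cC in \<open>auto simp: field_simps\<close>)
  qed measurable
  also have "\<dots> = 1" using Di mean cell.prob_space by simp
  finally show "c * (\<integral>x. 1 / a x \<partial>cell) = 1" .
qed

end

section \<open>Weak compactness\<close>

lemma convergent_uniform_approx:
  fixes x :: "nat \<Rightarrow> real"
  assumes "\<And>\<epsilon>. \<epsilon> > 0 \<Longrightarrow> \<exists>y. convergent y \<and> (\<forall>n. \<bar>x n - y n\<bar> \<le> \<epsilon>)"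
  shows "convergent x"
proof -
  have "Cauchy x"
  proof (rule metric_CauchyI)
    fix e :: real assume "e > 0"
    then obtain y where y: "convergent y" "\<And>n. \<bar>x n - y n\<bar> \<le> e / 4"
      using assms[of "e/4"] by auto
    have "Cauchy y" using y(1) by (simp add: Cauchy_convergent_iff)
    then obtain N where N: "\<And>m n. m \<ge> N \<Longrightarrow> n \<ge> N \<Longrightarrow> dist (y m) (y n) < e / 4"
      using \<open>e > 0\<close> unfolding Cauchy_def by (metis divide_pos_pos zero_less_numeral)
    have "dist (x m) (x n) < e" if "m \<ge> N" "n \<ge> N" for m n
      using N[OF that] y(2)[of m] y(2)[of n] \<open>e > 0\<close> unfolding dist_real_def by linarith
    then show "\<exists>N. \<forall>m\<ge>N. \<forall>n\<ge>N. dist (x m) (x n) < e" by blast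
  qed
  then show ?thesis by (simp add: Cauchy_convergent_iff)
qed

lemma tendsto_uniform_approx:
  fixes x :: "nat \<Rightarrow> real"
  assumes "\<And>\<epsilon>. \<epsilon> > 0 \<Longrightarrow> \<exists>y m. y \<longlonglongrightarrow> m \<and> (\<forall>\<^sub>F n in sequentially. \<bar>x n - y n\<bar> \<le> \<epsilon>) \<and> \<bar>m - l\<bar> \<le> \<epsilon>"
  shows "x \<longlonglongrightarrow> l"
proof (rule tendstoI)
  fix e :: real assume "e > 0"
  then obtain y m where y: "y \<longlonglongrightarrow> m" "\<forall>\<^sub>F n in sequentially. \<bar>x n - y n\<bar> \<le> e/4" "\<bar>m - l\<bar> \<le> e/4"
    using assms[of "e/4"] by auto
  have "\<forall>\<^sub>F n in sequentially. dist (y n) m < e / 4" using y(1) \<open>e > 0\<close> by (intro tendstoD) auto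
  then show "\<forall>\<^sub>F n in sequentially. dist (x n) l < e"
    using y(2)
  proof eventually_elim
    case (elim n)
    then show ?case using y(3) \<open>e > 0\<close> unfolding dist_real_def by linarith
  qed
qed

lemma diagonal_convergent_subsequence:
  fixes X :: "nat \<Rightarrow> nat \<Rightarrow> real"
  assumes bd: "\<And>i n. \<bar>X i n\<bar> \<le> B i"
  shows "\<exists>s. strict_mono s \<and> (\<forall>i. convergent (\<lambda>n. X i (s n)))"
proof -
  interpret subseqs "\<lambda>i s. convergent (\<lambda>n. X i (s n))"
  proof
    fix i and s :: "nat \<Rightarrow> nat"
    have "bounded (range (\<lambda>n. X i (s n)))"
      unfolding bounded_iff by (rule exI[of _ "B i"]) (use bd in auto)
    then obtain l r where "strict_mono r" "((\<lambda>n. X i (s n)) \<circ> r) \<longlonglongrightarrow> l"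
      using bounded_imp_convergent_subsequence by blast
    then show "\<exists>r. strict_mono r \<and> convergent (\<lambda>n. X i ((s \<circ> r) n))"
      unfolding convergent_def o_def by auto
  qed
  have "convergent (\<lambda>n. X k (diagseq n))" for k
  proof -
    have "convergent (\<lambda>n. X k ((diagseq \<circ> ((+) (Suc k))) n))"
    proof (rule diagseq_holds)
      fix r s :: "nat \<Rightarrow> nat" and n assume "strict_mono r" "convergent (\<lambda>na. X n (s na))"
      then show "convergent (\<lambda>na. X n ((s \<circ> r) na))"
        using convergent_subseq_convergent[of "\<lambda>na. X n (s na)" r] by (simp add: o_def)
    qed
    \<comment> \<open>Only the tail of the diagonal sequence is a subsequence of the k-th
      extraction, hence the shift by \<open>Suc k\<close>.\<close>
    then have "convergent (\<lambda>n. X k (diagseq (n + Suc k)))" by (simp add: o_def add.commute)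
    then show ?thesis
      using convergent_ignore_initial_segment[of "\<lambda>n. X k (diagseq n)" "Suc k"] by simp
  qed
  then show ?thesis using subseq_diagseq by blast
qed

text \<open>Adding one multiple of one \<open>e j\<close> at a time yields exactly the competitors
  used when a near-minimiser is perturbed.\<close>

inductive_set lin_span :: "(nat \<Rightarrow> 'a \<Rightarrow> real) \<Rightarrow> ('a \<Rightarrow> real) set" for e where
  lin_span_zero: "(\<lambda>x. 0) \<in> lin_span e"
| lin_span_add: "v \<in> lin_span e \<Longrightarrow> (\<lambda>x. v x + t * e j x) \<in> lin_span e"

section \<open>Weak compactness in L^1 of a finite measure\<close>

context finite_measure begin

lemma integrable_bounded:
  fixes f :: "'a \<Rightarrow> real"
  assumes "f \<in> borel_measurable M" "\<And>x. x \<in> space M \<Longrightarrow> \<bar>f x\<bar> \<le> C"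
  shows "integrable M f"
  using assms by (intro integrable_const_bound[of _ C]) auto

text \<open>Minimising the distance from \<open>h\<close> to the span replaces the orthogonal projection, so that
  no completeness of \<open>L\<^sup>2\<close> is needed.\<close>

lemma convergent_integral_of_convergent_gram:
  fixes e :: "nat \<Rightarrow> 'a \<Rightarrow> real"
  assumes e: "\<And>j. e j \<in> borel_measurable M" "\<And>j x. x \<in> space M \<Longrightarrow> \<bar>e j x\<bar> \<le> K"
    and h: "h \<in> borel_measurable M" "\<And>x. x \<in> space M \<Longrightarrow> \<bar>h x\<bar> \<le> (C::real)"
    and gram: "\<And>j. convergent (\<lambda>n. \<integral>x. e (s n) x * e j x \<partial>M)"
  shows "convergent (\<lambda>n. \<integral>x. e (s n) x * h x \<partial>M)"
proof -
  \<comment> \<open>A common bound for the squared norms of the \<open>e j\<close>; the summand 1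
    keeps it positive, since it becomes a divisor.\<close>
  define Q where "Q = K\<^sup>2 * measure M (space M) + 1"
  have Q: "Q > 0" unfolding Q_def by (simp add: add_nonneg_pos)
  have eint: "integrable M (\<lambda>x. e j x * e i x)" for i j
  proof (rule integrable_bounded[where C="K * K"])
    fix x assume x: "x \<in> space M"
    have "\<bar>e j x\<bar> * \<bar>e i x\<bar> \<le> K * K"
      using e(2)[OF x, of j] e(2)[OF x, of i] by (intro mult_mono) auto
    then show "\<bar>e j x * e i x\<bar> \<le> K * K" by (simp add: abs_mult)
  qed (use e(1) in measurable)
  have eQ: "(\<integral>x. e j x * e j x \<partial>M) \<le> Q" for j
  proof -
    have "(\<integral>x. e j x * e j x \<partial>M) \<le> (\<integral>x. K\<^sup>2 \<partial>M)"
    proof (rule integral_mono[OF eint])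
      fix x assume "x \<in> space M"
      then have "\<bar>e j x\<bar>\<^sup>2 \<le> K\<^sup>2" using e(2) by (intro power_mono) auto
      then show "e j x * e j x \<le> K\<^sup>2" by (simp add: power2_eq_square)
    qed auto
    then show ?thesis by (simp add: Q_def mult.commute)
  qed
  have V: "v \<in> borel_measurable M \<and> (\<exists>D. \<forall>x\<in>space M. \<bar>v x\<bar> \<le> D) \<and>
      convergent (\<lambda>n. \<integral>x. e (s n) x * v x \<partial>M)" if "v \<in> lin_span e" for v
    using that
  proof induction
    case lin_span_zero
    then show ?case by (auto simp: convergent_const)
  next
    case (lin_span_add v t j)
    then obtain D where v: "v \<in> borel_measurable M" "\<And>x. x \<in> space M \<Longrightarrow> \<bar>v x\<bar> \<le> D"
      "convergent (\<lambda>n. \<integral>x. e (s n) x * v x \<partial>M)" by auto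
    have "\<bar>v x + t * e j x\<bar> \<le> D + \<bar>t\<bar> * K" if "x \<in> space M" for x
      using v(2)[OF that] mult_left_mono[OF e(2)[OF that, of j], of "\<bar>t\<bar>"]
      by (simp add: abs_mult[symmetric])
    moreover have "(\<integral>x. e (s n) x * (v x + t * e j x) \<partial>M) =
        (\<integral>x. e (s n) x * v x \<partial>M) + t * (\<integral>x. e (s n) x * e j x \<partial>M)" for n
    proof -
      have "integrable M (\<lambda>x. e (s n) x * v x)"
      proof (rule integrable_bounded[where C="K * D"])
        fix x assume x: "x \<in> space M"
        have "\<bar>e (s n) x\<bar> * \<bar>v x\<bar> \<le> K * D"
          using e(2)[OF x, of "s n"] v(2)[OF x] by (intro mult_mono) auto
        then show "\<bar>e (s n) x * v x\<bar> \<le> K * D" by (simp add: abs_mult)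
      qed (use e(1) v(1) in measurable)
      then show ?thesis using eint[of "s n" j]
        by (simp add: distrib_left mult.left_commute)
    qed
    ultimately show ?case
      using v gram[of j] e(1)[of j] by (auto intro!: convergent_add convergent_mult convergent_const)
  qed
  define dd where "dd v = (\<integral>x. (h x - v x) * (h x - v x) \<partial>M)" for v
  have dnn: "dd v \<ge> 0" for v unfolding dd_def by (intro integral_nonneg_AE) auto
  define d where "d = Inf (dd ` lin_span e)"
  have bb: "bdd_below (dd ` lin_span e)" using dnn by (intro bdd_belowI2[where m=0])
  have ne: "dd ` lin_span e \<noteq> {}" using lin_span_zero by blast
  show ?thesis
  proof (rule convergent_uniform_approx)
    fix \<epsilon> :: real assume \<epsilon>: "\<epsilon> > 0"
    have "d < d + \<epsilon>\<^sup>2 / Q" using \<epsilon> Q by simp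
    then obtain v where v: "v \<in> lin_span e" "dd v < d + \<epsilon>\<^sup>2 / Q"
      using cInf_lessD[OF ne, of "d + \<epsilon>\<^sup>2 / Q"] unfolding d_def by auto
    obtain D where vm: "v \<in> borel_measurable M" and D: "\<And>x. x \<in> space M \<Longrightarrow> \<bar>v x\<bar> \<le> D"
      using V[OF v(1)] by auto
    have hv: "\<bar>h x - v x\<bar> \<le> C + D" if "x \<in> space M" for x
      using h(2)[OF that] D[OF that] by linarith
    have i1: "integrable M (\<lambda>x. (h x - v x) * (h x - v x))"
    proof (rule integrable_bounded[where C="(C+D) * (C+D)"])
      fix x assume x: "x \<in> space M"
      show "\<bar>(h x - v x) * (h x - v x)\<bar> \<le> (C+D) * (C+D)"
        unfolding abs_mult using hv[OF x] by (intro mult_mono) auto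
    qed (use h(1) vm in measurable)
    have i2: "integrable M (\<lambda>x. (h x - v x) * e j x)" for j
    proof (rule integrable_bounded[where C="(C+D) * K"])
      fix x assume x: "x \<in> space M"
      show "\<bar>(h x - v x) * e j x\<bar> \<le> (C+D) * K"
        unfolding abs_mult using hv[OF x] e(2)[OF x] by (intro mult_mono) auto
    qed (use h(1) vm e(1) in measurable)
    have i3: "integrable M (\<lambda>x. e j x * h x)" for j
    proof (rule integrable_bounded[where C="K * C"])
      fix x assume x: "x \<in> space M"
      show "\<bar>e j x * h x\<bar> \<le> K * C"
        unfolding abs_mult using h(2)[OF x] e(2)[OF x, of j] by (intro mult_mono) auto
    qed (use h(1) e(1) in measurable)
    have i4: "integrable M (\<lambda>x. e j x * v x)" for j
    proof (rule integrable_bounded[where C="K * D"])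
      fix x assume x: "x \<in> space M"
      show "\<bar>e j x * v x\<bar> \<le> K * D"
        unfolding abs_mult using D[OF x] e(2)[OF x, of j] by (intro mult_mono) auto
    qed (use vm e(1) in measurable)
    have key: "\<bar>(\<integral>x. (h x - v x) * e j x \<partial>M)\<bar> \<le> \<epsilon>" for j
    proof -
      define I where "I = (\<integral>x. (h x - v x) * e j x \<partial>M)"
      \<comment> \<open>This step length minimises the bound dd v - 2 t I + t^2 Q and would lower
        the squared distance by I^2 / Q. But \<open>v\<close> is within \<epsilon>^2 / Q of the
        infimum, so |I| is at most \<epsilon>, with the same \<open>v\<close> for all j, as uniform
        approximation requires.\<close>
      define t where "t = I / Q"
      have "d \<le> dd (\<lambda>x. v x + t * e j x)"
        unfolding d_def using v(1) bb by (intro cInf_lower) (auto intro: lin_span_add)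
      also have "\<dots> = (\<integral>x. (h x - v x) * (h x - v x) - 2 * t * ((h x - v x) * e j x) + t * t * (e j x * e j x) \<partial>M)"
        unfolding dd_def by (intro Bochner_Integration.integral_cong refl) (simp add: algebra_simps)
      also have "\<dots> = dd v - 2 * t * I + t * t * (\<integral>x. e j x * e j x \<partial>M)"
        unfolding dd_def I_def using i1 i2[of j] eint[of j j] by simp
      also have "\<dots> \<le> dd v - 2 * t * I + t * t * Q"
        using eQ[of j] by (intro add_left_mono mult_left_mono) auto
      also have "\<dots> = dd v - I\<^sup>2 / Q" unfolding t_def using Q by (simp add: field_simps power2_eq_square)
      also have "\<dots> < d + \<epsilon>\<^sup>2 / Q - I\<^sup>2 / Q" using v(2) by simp
      finally have "I\<^sup>2 < \<epsilon>\<^sup>2" using Q by (simp add: field_simps)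
      then show ?thesis unfolding I_def using \<epsilon> by (metis abs_le_square_iff abs_of_pos less_imp_le)
    qed
    show "\<exists>y. convergent y \<and> (\<forall>n. \<bar>(\<integral>x. e (s n) x * h x \<partial>M) - y n\<bar> \<le> \<epsilon>)"
    proof (intro exI conjI allI)
      show "convergent (\<lambda>n. \<integral>x. e (s n) x * v x \<partial>M)" using V[OF v(1)] by blast
      fix n
      have "(\<integral>x. e (s n) x * h x \<partial>M) - (\<integral>x. e (s n) x * v x \<partial>M) = (\<integral>x. (h x - v x) * e (s n) x \<partial>M)"
        by (subst Bochner_Integration.integral_diff[OF i3 i4, symmetric], intro Bochner_Integration.integral_cong)
           (auto simp: algebra_simps)
      then show "\<bar>(\<integral>x. e (s n) x * h x \<partial>M) - (\<integral>x. e (s n) x * v x \<partial>M)\<bar> \<le> \<epsilon>"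
        using key[of "s n"] by simp
    qed
  qed
qed

text \<open>A bounded test function is a uniform limit of simple functions: \<open>hm\<close> rounds
  \<open>h\<close> down to a multiple of 1/m. The L^1 bound makes the resulting error at most L'/m
  for all n and for the limit.\<close>

lemma tendsto_integral_bounded_test:
  fixes f :: "nat \<Rightarrow> 'a \<Rightarrow> real" and g h :: "'a \<Rightarrow> real"
  assumes f: "\<And>n. integrable M (f n)" "\<And>n. (\<integral>x. \<bar>f n x\<bar> \<partial>M) \<le> L"
    and g: "integrable M g"
    and lim: "\<And>A. A \<in> sets M \<Longrightarrow> (\<lambda>n. \<integral>x. f n x * indicator A x \<partial>M) \<longlonglongrightarrow> (\<integral>x. g x * indicator A x \<partial>M)"
    and h: "h \<in> borel_measurable M" "\<And>x. x \<in> space M \<Longrightarrow> \<bar>h x\<bar> \<le> C"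
  shows "(\<lambda>n. \<integral>x. f n x * h x \<partial>M) \<longlonglongrightarrow> (\<integral>x. g x * h x \<partial>M)"
proof (rule tendsto_uniform_approx)
  fix \<epsilon> :: real assume \<epsilon>: "\<epsilon> > 0"
  define L' where "L' = max L (\<integral>x. \<bar>g x\<bar> \<partial>M)"
  obtain m :: nat where m: "real m > max 0 (L' / \<epsilon>)" using reals_Archimedean2 by blast
  then have m0: "real m > 0" and mL: "L' / real m \<le> \<epsilon>"
  proof -
    show "real m > 0" using m by simp
    moreover have "L' / \<epsilon> < real m" using m by simp
    ultimately show "L' / real m \<le> \<epsilon>" using \<epsilon> by (simp add: field_simps)
  qed
  define A where "A i = {x \<in> space M. \<lfloor>real m * h x\<rfloor> = i}" for i
  have A: "A i \<in> sets M" for i unfolding A_def using h(1) by measurable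
  define N where "N = \<lceil>real m * C\<rceil> + 1"
  define hm where "hm x = (\<Sum>i\<in>{-N..N}. (real_of_int i / real m) * indicator (A i) x)" for x
  have hm: "hm x = real_of_int \<lfloor>real m * h x\<rfloor> / real m" if x: "x \<in> space M" for x
  proof -
    have "\<bar>real m * h x\<bar> \<le> real m * C" using h(2)[OF x] m0 by (simp add: abs_mult)
    then have "\<lfloor>real m * h x\<rfloor> \<in> {-N..N}" unfolding N_def by (auto simp: abs_le_iff) linarith+
    moreover have "hm x = (\<Sum>i\<in>{-N..N}. if i = \<lfloor>real m * h x\<rfloor> then real_of_int i / real m else 0)"
      unfolding hm_def using x by (intro sum.cong) (auto simp: A_def)
    ultimately show ?thesis by simp
  qed
  have hd: "\<bar>h x - hm x\<bar> \<le> 1 / real m" if x: "x \<in> space M" for x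
  proof -
    have "h x - hm x = (real m * h x - real_of_int \<lfloor>real m * h x\<rfloor>) / real m"
      using hm[OF x] m0 by (simp add: field_simps)
    moreover have "\<bar>real m * h x - real_of_int \<lfloor>real m * h x\<rfloor>\<bar> \<le> 1" by linarith
    ultimately show ?thesis using m0 by (simp add: divide_right_mono)
  qed
  have hmm: "hm \<in> borel_measurable M" unfolding hm_def using A by measurable
  have int_ind: "integrable M (\<lambda>x. u x * indicator (A i) x)" if "integrable M u" for u :: "'a \<Rightarrow> real" and i
    using integrable_real_mult_indicator[OF A that] by (simp add: mult.commute)
  have int_hm: "(\<integral>x. u x * hm x \<partial>M) = (\<Sum>i\<in>{-N..N}. (real_of_int i / real m) * (\<integral>x. u x * indicator (A i) x \<partial>M))"
    and int_hm': "integrable M (\<lambda>x. u x * hm x)" if u: "integrable M u" for u :: "'a \<Rightarrow> real"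
  proof -
    have eq: "u x * hm x = (\<Sum>i\<in>{-N..N}. (real_of_int i / real m) * (u x * indicator (A i) x))" for x
      unfolding hm_def sum_distrib_left by (intro sum.cong) auto
    show "(\<integral>x. u x * hm x \<partial>M) = (\<Sum>i\<in>{-N..N}. (real_of_int i / real m) * (\<integral>x. u x * indicator (A i) x \<partial>M))"
      unfolding eq using int_ind[OF u] by (subst Bochner_Integration.integral_sum) auto
    show "integrable M (\<lambda>x. u x * hm x)"
      unfolding eq using int_ind[OF u] by (intro Bochner_Integration.integrable_sum) auto
  qed
  have int_h: "integrable M (\<lambda>x. u x * h x)" if u: "integrable M u" for u :: "'a \<Rightarrow> real"
  proof (rule Bochner_Integration.integrable_bound[where f="\<lambda>x. C * \<bar>u x\<bar>"])
    show "AE x in M. norm (u x * h x) \<le> norm (C * \<bar>u x\<bar>)"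
    proof (rule AE_I2)
      fix x assume "x \<in> space M"
      then have "\<bar>u x\<bar> * \<bar>h x\<bar> \<le> \<bar>u x\<bar> * \<bar>C\<bar>"
        using h(2)[of x] by (intro mult_left_mono) auto
      then show "norm (u x * h x) \<le> norm (C * \<bar>u x\<bar>)" by (simp add: abs_mult mult.commute)
    qed
  qed (use u h in auto)
  have appr: "\<bar>(\<integral>x. u x * h x \<partial>M) - (\<integral>x. u x * hm x \<partial>M)\<bar> \<le> \<epsilon>"
    if u: "integrable M u" and uL: "(\<integral>x. \<bar>u x\<bar> \<partial>M) \<le> L'" for u :: "'a \<Rightarrow> real"
  proof -
    have "(\<integral>x. u x * h x \<partial>M) - (\<integral>x. u x * hm x \<partial>M) = (\<integral>x. u x * (h x - hm x) \<partial>M)"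
      using int_h[OF u] int_hm'[OF u] by (subst Bochner_Integration.integral_diff[symmetric])
        (auto intro!: Bochner_Integration.integral_cong simp: algebra_simps)
    also have "\<bar>\<dots>\<bar> \<le> (\<integral>x. \<bar>u x * (h x - hm x)\<bar> \<partial>M)" by (rule integral_abs_bound)
    also have "\<dots> \<le> (\<integral>x. \<bar>u x\<bar> * (1 / real m) \<partial>M)"
    proof (rule integral_mono)
      have "integrable M (\<lambda>x. u x * h x - u x * hm x)" using int_h[OF u] int_hm'[OF u] by simp
      then show "integrable M (\<lambda>x. \<bar>u x * (h x - hm x)\<bar>)" by (simp add: algebra_simps)
      show "\<bar>u x * (h x - hm x)\<bar> \<le> \<bar>u x\<bar> * (1 / real m)" if "x \<in> space M" for x
        unfolding abs_mult using hd[OF that] by (intro mult_left_mono) auto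
    qed (use u in auto)
    also have "\<dots> = (\<integral>x. \<bar>u x\<bar> \<partial>M) / real m" by simp
    also have "\<dots> \<le> L' / real m" using uL m0 by (intro divide_right_mono) auto
    finally show ?thesis using mL by simp
  qed
  show "\<exists>y l. y \<longlonglongrightarrow> l \<and> (\<forall>\<^sub>F n in sequentially. \<bar>(\<integral>x. f n x * h x \<partial>M) - y n\<bar> \<le> \<epsilon>) \<and>
      \<bar>l - (\<integral>x. g x * h x \<partial>M)\<bar> \<le> \<epsilon>"
  proof (intro exI conjI always_eventually allI)
    show "(\<lambda>n. \<integral>x. f n x * hm x \<partial>M) \<longlonglongrightarrow> (\<integral>x. g x * hm x \<partial>M)"
      unfolding int_hm[OF f(1)] int_hm[OF g] by (intro tendsto_sum tendsto_mult tendsto_const lim A)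
    show "\<bar>(\<integral>x. f n x * h x \<partial>M) - (\<integral>x. f n x * hm x \<partial>M)\<bar> \<le> \<epsilon>" for n
      using f(2)[of n] by (intro appr f) (simp add: L'_def)
    show "\<bar>(\<integral>x. g x * hm x \<partial>M) - (\<integral>x. g x * h x \<partial>M)\<bar> \<le> \<epsilon>"
      using appr[OF g] by (simp add: L'_def abs_minus_commute)
  qed
qed

text \<open>The sequential Dunford-Pettis criterion, with uniform integrability expressed through
  truncations. At each truncation level convergence of the Gram matrix gives convergence on every
  event, and the truncation error is uniform over n and over events. Nonnegativity makes the
  limiting set function \<open>L\<close> a measure, to which Radon-Nikodym applies.\<close>

lemma uniformly_integrable_nonneg_subsequence:
  fixes f :: "nat \<Rightarrow> 'a \<Rightarrow> real"
  assumes f: "\<And>n. integrable M (f n)" "\<And>n x. x \<in> space M \<Longrightarrow> f n x \<ge> 0"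
    and ui: "\<And>\<epsilon>. \<epsilon> > 0 \<Longrightarrow> \<exists>K::nat. \<forall>n. (\<integral>x. f n x - min (f n x) (real K) \<partial>M) \<le> \<epsilon>"
  shows "\<exists>s g. strict_mono (s :: nat \<Rightarrow> nat) \<and> integrable M g \<and>
    (\<forall>A\<in>sets M. (\<lambda>n. \<integral>x. f (s n) x * indicator A x \<partial>M) \<longlonglongrightarrow> (\<integral>x. g x * indicator A x \<partial>M))"
proof -
  note fm[measurable] = borel_measurable_integrable[OF f(1)]
  define e where "e K j x = min (f j x) (real K) * indicator (space M) x" for K j x
  have em[measurable]: "e K j \<in> borel_measurable M" for K j unfolding e_def by measurable
  have eb: "\<bar>e K j x\<bar> \<le> real K" if "x \<in> space M" for K j x
    using f(2)[OF that, of j] that by (auto simp: e_def)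
  \<comment> \<open>All truncation levels K and all indices j are coded in one sequence, so that a
    single diagonal subsequence serves every Gram matrix.\<close>
  define X where "X i n = (case prod_decode i of (K, j) \<Rightarrow> \<integral>x. e K n x * e K j x \<partial>M)" for i n
  have "\<bar>X i n\<bar> \<le> (case prod_decode i of (K, j) \<Rightarrow> real K * real K * measure M (space M))" for i n
  proof (cases "prod_decode i")
    case (Pair K j)
    have b: "\<bar>e K n x * e K j x\<bar> \<le> real K * real K" if "x \<in> space M" for x
      unfolding abs_mult using eb[OF that] by (intro mult_mono) auto
    have "\<bar>\<integral>x. e K n x * e K j x \<partial>M\<bar> \<le> (\<integral>x. \<bar>e K n x * e K j x\<bar> \<partial>M)" by (rule integral_abs_bound)
    also have "\<dots> \<le> (\<integral>x. real K * real K \<partial>M)"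
      using b by (intro integral_mono integrable_bounded[where C="real K * real K"]) auto
    finally show ?thesis unfolding X_def Pair by (simp add: mult.commute mult.left_commute)
  qed
  from diagonal_convergent_subsequence[of X, OF this]
  obtain s where s: "strict_mono s" "\<And>i. convergent (\<lambda>n. X i (s n))" by blast
  have gram: "convergent (\<lambda>n. \<integral>x. e K (s n) x * e K j x \<partial>M)" for K j
    using s(2)[of "prod_encode (K, j)"] by (simp add: X_def)
  have eind: "convergent (\<lambda>n. \<integral>x. e K (s n) x * indicator A x \<partial>M)" if "A \<in> sets M" for K A
    by (rule convergent_integral_of_convergent_gram[where K="real K" and C=1])
       (use that gram eb in \<open>auto simp: indicator_def\<close>)
  have eint: "integrable M (e K j)" for K j
    by (rule integrable_bounded[OF em eb])
  have ind_int: "integrable M (\<lambda>x. u x * indicator A x)" if "A \<in> sets M" "integrable M u" for u :: "'a \<Rightarrow> real" and A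
    using integrable_real_mult_indicator[OF that] by (simp add: mult.commute)
  have trunc: "\<exists>K::nat. \<forall>n. \<forall>A\<in>sets M. (\<integral>x. e K n x * indicator A x \<partial>M) \<le> (\<integral>x. f n x * indicator A x \<partial>M) \<and>
      (\<integral>x. f n x * indicator A x \<partial>M) \<le> (\<integral>x. e K n x * indicator A x \<partial>M) + \<epsilon>" if "\<epsilon> > 0" for \<epsilon>
  proof -
    obtain K :: nat where K: "\<And>n. (\<integral>x. f n x - min (f n x) (real K) \<partial>M) \<le> \<epsilon>" using ui[OF \<open>\<epsilon> > 0\<close>] by blast
    have "(\<integral>x. e K n x * indicator A x \<partial>M) \<le> (\<integral>x. f n x * indicator A x \<partial>M) \<and>
      (\<integral>x. f n x * indicator A x \<partial>M) \<le> (\<integral>x. e K n x * indicator A x \<partial>M) + \<epsilon>" if A: "A \<in> sets M" for n A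
    proof
      show "(\<integral>x. e K n x * indicator A x \<partial>M) \<le> (\<integral>x. f n x * indicator A x \<partial>M)"
        using f(2) by (intro integral_mono ind_int A eint f(1) mult_right_mono) (auto simp: e_def)
      have "(\<integral>x. f n x * indicator A x \<partial>M) - (\<integral>x. e K n x * indicator A x \<partial>M) =
          (\<integral>x. (f n x - e K n x) * indicator A x \<partial>M)"
        using ind_int[OF A f(1)] ind_int[OF A eint]
        by (simp only: left_diff_distrib Bochner_Integration.integral_diff)
      also have "\<dots> \<le> (\<integral>x. f n x - e K n x \<partial>M)"
        by (intro integral_mono ind_int A Bochner_Integration.integrable_diff f(1) eint)
           (auto simp: e_def indicator_def)
      also have "\<dots> = (\<integral>x. f n x - min (f n x) (real K) \<partial>M)"
        by (intro Bochner_Integration.integral_cong) (auto simp: e_def)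
      finally show "(\<integral>x. f n x * indicator A x \<partial>M) \<le> (\<integral>x. e K n x * indicator A x \<partial>M) + \<epsilon>"
        using K[of n] by simp
    qed
    then show ?thesis by blast
  qed
  define L where "L A = lim (\<lambda>n. \<integral>x. f (s n) x * indicator A x \<partial>M)" for A
  have L: "(\<lambda>n. \<integral>x. f (s n) x * indicator A x \<partial>M) \<longlonglongrightarrow> L A" if A: "A \<in> sets M" for A
  proof -
    have "convergent (\<lambda>n. \<integral>x. f (s n) x * indicator A x \<partial>M)"
    proof (rule convergent_uniform_approx)
      fix \<epsilon> :: real assume "\<epsilon> > 0"
      then obtain K where K: "\<And>n. (\<integral>x. e K n x * indicator A x \<partial>M) \<le> (\<integral>x. f n x * indicator A x \<partial>M)"
        "\<And>n. (\<integral>x. f n x * indicator A x \<partial>M) \<le> (\<integral>x. e K n x * indicator A x \<partial>M) + \<epsilon>"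
        using trunc[OF \<open>\<epsilon> > 0\<close>] A by blast
      show "\<exists>y. convergent y \<and> (\<forall>n. \<bar>(\<integral>x. f (s n) x * indicator A x \<partial>M) - y n\<bar> \<le> \<epsilon>)"
      proof (intro exI conjI allI)
        show "convergent (\<lambda>n. \<integral>x. e K (s n) x * indicator A x \<partial>M)" by (rule eind[OF A])
        show "\<bar>(\<integral>x. f (s n) x * indicator A x \<partial>M) - (\<integral>x. e K (s n) x * indicator A x \<partial>M)\<bar> \<le> \<epsilon>" for n
          using K[of "s n"] \<open>\<epsilon> > 0\<close> by linarith
      qed
    qed
    then show ?thesis unfolding L_def by (simp add: convergent_LIMSEQ_iff)
  qed
  have Lnn: "L A \<ge> 0" if "A \<in> sets M" for A
    by (rule LIMSEQ_le_const[OF L[OF that]]) (use f(2) in \<open>auto intro!: integral_nonneg_AE\<close>)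
  \<comment> \<open>Uniform integrability in the form inherited by \<open>L\<close>. It yields
    continuity at the empty set, hence countable additivity, and also absolute continuity.\<close>
  have Lle: "\<exists>K. \<forall>A\<in>sets M. L A \<le> \<epsilon> + K * measure M A" if "\<epsilon> > 0" for \<epsilon>
  proof -
    obtain K where K: "\<And>n A. A \<in> sets M \<Longrightarrow> (\<integral>x. f n x * indicator A x \<partial>M) \<le> (\<integral>x. e K n x * indicator A x \<partial>M) + \<epsilon>"
      using trunc[OF \<open>\<epsilon> > 0\<close>] by blast
    have "L A \<le> \<epsilon> + real K * measure M A" if A: "A \<in> sets M" for A
    proof (rule LIMSEQ_le_const2[OF L[OF A]], intro exI allI impI)
      fix n
      have "(\<integral>x. e K (s n) x * indicator A x \<partial>M) \<le> (\<integral>x. real K * indicator A x \<partial>M)"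
        using A by (intro integral_mono ind_int eint mult_right_mono)
           (auto simp: abs_le_iff dest: eb)
      then show "(\<integral>x. f (s n) x * indicator A x \<partial>M) \<le> \<epsilon> + real K * measure M A"
        using K[OF A, of "s n"] A by simp
    qed
    then show ?thesis by blast
  qed
  have Ladd: "L (A \<union> B) = L A + L B" if "A \<in> sets M" "B \<in> sets M" "A \<inter> B = {}" for A B
  proof (rule LIMSEQ_unique[OF L])
    have "(\<integral>x. f n x * indicator (A \<union> B) x \<partial>M) = (\<integral>x. f n x * indicator A x \<partial>M) + (\<integral>x. f n x * indicator B x \<partial>M)" for n
      using that ind_int f(1)
      by (subst Bochner_Integration.integral_add[symmetric]) (auto simp: indicator_add[symmetric] distrib_left)
    then show "(\<lambda>n. \<integral>x. f (s n) x * indicator (A \<union> B) x \<partial>M) \<longlonglongrightarrow> L A + L B"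
      using tendsto_add[OF L[OF that(1)] L[OF that(2)]] by simp
  qed (use that in auto)
  have Lempty: "L {} = 0" unfolding L_def by simp
  define \<mu> where "\<mu> A = ennreal (L A)" for A
  define N where "N = measure_of (space M) (sets M) \<mu>"
  have ca: "countably_additive (sets M) \<mu>"
  proof (rule sets.empty_continuous_imp_countably_additive)
    show pos: "positive (sets M) \<mu>" by (simp add: positive_def \<mu>_def Lempty)
    show "additive (sets M) \<mu>"
      unfolding additive_def \<mu>_def using Ladd Lnn by (auto simp: ennreal_plus)
    show "\<forall>A\<in>sets M. \<mu> A \<noteq> \<infinity>" by (simp add: \<mu>_def)
    fix A :: "nat \<Rightarrow> 'a set" assume A: "range A \<subseteq> sets M" "decseq A" "(\<Inter>i. A i) = {}"
    have mA: "(\<lambda>n. measure M (A n)) \<longlonglongrightarrow> 0"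
      using finite_Lim_measure_decseq[OF A(1,2)] A(3) by simp
    have "(\<lambda>n. L (A n)) \<longlonglongrightarrow> 0"
    proof (rule LIMSEQ_I)
      fix r :: real assume "r > 0"
      then obtain K where K: "\<And>A. A \<in> sets M \<Longrightarrow> L A \<le> r / 2 + K * measure M A" using Lle[of "r/2"] by auto
      have "(\<lambda>n. K * measure M (A n)) \<longlonglongrightarrow> 0" using tendsto_mult_right_zero[OF mA] .
      then obtain n0 where n0: "\<And>n. n \<ge> n0 \<Longrightarrow> norm (K * measure M (A n) - 0) < r/2"
        using LIMSEQ_D[of "\<lambda>n. K * measure M (A n)" 0 "r/2"] \<open>r > 0\<close> by auto
      have "norm (L (A n) - 0) < r" if "n \<ge> n0" for n
        using n0[OF that] K[of "A n"] Lnn[of "A n"] A(1) by (auto simp: image_subset_iff abs_less_iff)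
      then show "\<exists>no. \<forall>n\<ge>no. norm (L (A n) - 0) < r" by blast
    qed
    then show "(\<lambda>i. \<mu> (A i)) \<longlonglongrightarrow> 0" unfolding \<mu>_def by (simp flip: ennreal_0)
  qed
  have sN: "sets N = sets M" unfolding N_def by (simp add: sets.space_closed sets.sigma_sets_eq)
  have eN: "emeasure N A = ennreal (L A)" if "A \<in> sets M" for A
    unfolding N_def using emeasure_measure_of_sigma[OF sets.sigma_algebra_axioms _ ca] that
    by (simp add: \<mu>_def positive_def Lempty)
  have "absolutely_continuous M N"
    unfolding absolutely_continuous_def
  proof
    fix A assume A: "A \<in> null_sets M"
    have "L A \<le> 0 + \<epsilon>" if "\<epsilon> > 0" for \<epsilon>
      using Lle[OF that] A by (auto simp: null_sets_def measure_def)
    then have "L A \<le> 0" by (rule field_le_epsilon)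
    then show "A \<in> null_sets N" using A eN[of A] by (auto simp: null_sets_def sN ennreal_neg)
  qed
  from Radon_Nikodym[OF this sN] obtain G where G[measurable]: "G \<in> borel_measurable M" and dG: "density M G = N" by blast
  have GL: "(\<integral>\<^sup>+x. G x * indicator A x \<partial>M) = ennreal (L A)" if "A \<in> sets M" for A
    using eN[OF that] that unfolding dG[symmetric] by (simp add: emeasure_density)
  have fin: "(\<integral>\<^sup>+x. G x \<partial>M) < \<infinity>"
  proof -
    have "(\<integral>\<^sup>+x. G x \<partial>M) = (\<integral>\<^sup>+x. G x * indicator (space M) x \<partial>M)"
      by (intro nn_integral_cong) auto
    then show ?thesis using GL[of "space M"] by simp
  qed
  then have Gf: "AE x in M. G x \<noteq> \<infinity>" by (intro nn_integral_PInf_AE) auto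
  define g where "g x = enn2real (G x)" for x
  have gG: "AE x in M. ennreal (g x) = G x" using Gf
    by eventually_elim (simp add: g_def ennreal_enn2real top.not_eq_extremum)
  have gm[measurable]: "g \<in> borel_measurable M" unfolding g_def by measurable
  have gi: "integrable M g"
  proof (rule integrableI_nonneg)
    have "(\<integral>\<^sup>+x. ennreal (g x) \<partial>M) = (\<integral>\<^sup>+x. G x \<partial>M)" using gG by (intro nn_integral_cong_AE)
    then show "(\<integral>\<^sup>+x. ennreal (g x) \<partial>M) < \<infinity>" using fin by simp
  qed (auto simp: g_def)
  have "(\<integral>x. g x * indicator A x \<partial>M) = L A" if A: "A \<in> sets M" for A
  proof (rule integral_eq_nn_integral[THEN trans])
    have "(\<integral>\<^sup>+x. ennreal (g x * indicator A x) \<partial>M) = (\<integral>\<^sup>+x. G x * indicator A x \<partial>M)"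
      using gG by (intro nn_integral_cong_AE) (auto elim!: eventually_mono simp: indicator_def)
    then show "enn2real (\<integral>\<^sup>+x. ennreal (g x * indicator A x) \<partial>M) = L A"
      using GL[OF A] Lnn[OF A] by simp
  qed (use A in \<open>auto simp: g_def\<close>)
  then have "\<forall>A\<in>sets M. (\<lambda>n. \<integral>x. f (s n) x * indicator A x \<partial>M) \<longlonglongrightarrow> (\<integral>x. g x * indicator A x \<partial>M)"
    using L by simp
  then show ?thesis using s(1) gi by blast
qed

end

section \<open>Sequences bounded in L^p\<close>

lemma abs_le_one_plus_powr:
  fixes u p :: real
  assumes "p \<ge> 1"
  shows "\<bar>u\<bar> \<le> 1 + \<bar>u\<bar> powr p"
proof (cases "\<bar>u\<bar> \<le> 1")
  case True
  then show ?thesis using powr_ge_zero[of "\<bar>u\<bar>" p] by linarith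
next
  case False
  then have "\<bar>u\<bar> powr 1 \<le> \<bar>u\<bar> powr p" using assms by (intro powr_mono) auto
  then show ?thesis using False by simp
qed 
lemma powr_tail_tendsto_0: "p > 1 \<Longrightarrow> (\<lambda>K. real K powr (1 - p)) \<longlonglongrightarrow> 0"
  by (rule tendsto_neg_powr[OF _ filterlim_real_sequentially]) simp

text \<open>Above height K a function is at most K^(1-p) times its p-th power. For p > 1 an L^p
  bound therefore makes tails uniformly small.\<close>

lemma tail_le_powr:
  fixes u p K :: real
  assumes "p \<ge> 1" "u > K" "K > 0"
  shows "u \<le> K powr (1 - p) * u powr p"
proof -
  have "u = u powr (1 - p) * u powr p" using assms by (simp flip: powr_add)
  also have "\<dots> \<le> K powr (1 - p) * u powr p"
    using assms by (intro mult_right_mono powr_mono2') auto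
  finally show ?thesis .
qed

context finite_measure begin

lemma integrable_if_powr:
  fixes f :: "'a \<Rightarrow> real"
  assumes "f \<in> borel_measurable M" "integrable M (\<lambda>x. \<bar>f x\<bar> powr p)" "p \<ge> 1"
  shows "integrable M f"
proof (rule Bochner_Integration.integrable_bound)
  show "integrable M (\<lambda>x. 1 + \<bar>f x\<bar> powr p)" using assms(2) by simp
  show "AE x in M. norm (f x) \<le> norm (1 + \<bar>f x\<bar> powr p)"
    using abs_le_one_plus_powr[OF assms(3)] by (intro AE_I2) (simp add: abs_of_nonneg add_nonneg_nonneg)
qed (rule assms(1))

text \<open>Positive and negative parts are treated one after the other, the second along a
  subsequence of the first, because the compactness criterion is one for nonnegative functions. Test
  functions bounded only almost everywhere are clamped to [-|C|, |C|].\<close>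

lemma Lp_bounded_subsequence:
  fixes f :: "nat \<Rightarrow> 'a \<Rightarrow> real"
  assumes p: "p > 1" and f: "\<And>n. f n \<in> borel_measurable M" "\<And>n. integrable M (\<lambda>x. \<bar>f n x\<bar> powr p)"
    and B: "\<And>n. (\<integral>x. \<bar>f n x\<bar> powr p \<partial>M) \<le> B"
  shows "\<exists>s g. strict_mono (s :: nat \<Rightarrow> nat) \<and> integrable M g \<and>
    (\<forall>h\<in>borel_measurable M. (\<exists>C. AE x in M. \<bar>h x\<bar> \<le> C) \<longrightarrow>
      (\<lambda>n. \<integral>x. f (s n) x * h x \<partial>M) \<longlonglongrightarrow> (\<integral>x. g x * h x \<partial>M))"
proof -
  note [measurable] = f(1)
  have fi: "integrable M (f n)" for n by (rule integrable_if_powr[OF f less_imp_le[OF p]])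
  \<comment> \<open>The sign \<sigma> lets one tail estimate serve both parts.\<close>
  have ui: "\<exists>K::nat. \<forall>n. (\<integral>x. max 0 (\<sigma> * f n x) - min (max 0 (\<sigma> * f n x)) (real K) \<partial>M) \<le> \<epsilon>"
    if e: "\<epsilon> > 0" and \<sigma>: "\<bar>\<sigma>\<bar> = 1" for \<epsilon> \<sigma> :: real
  proof -
    have "(\<lambda>K. real K powr (1 - p) * B) \<longlonglongrightarrow> 0 * B"
      by (intro tendsto_mult tendsto_const powr_tail_tendsto_0 p)
    then have "\<forall>\<^sub>F K in sequentially. real K powr (1 - p) * B < \<epsilon>" using e by (intro order_tendstoD(2)) auto
    then obtain K0 where K0: "\<And>K. K \<ge> K0 \<Longrightarrow> real K powr (1 - p) * B < \<epsilon>"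
      unfolding eventually_sequentially by blast
    define K where "K = max K0 1"
    have K: "real K powr (1 - p) * B < \<epsilon>" "K \<ge> 1" using K0[of K] by (simp_all add: K_def)
    have "(\<integral>x. max 0 (\<sigma> * f n x) - min (max 0 (\<sigma> * f n x)) (real K) \<partial>M) \<le> \<epsilon>" for n
    proof -
      have "(\<integral>x. max 0 (\<sigma> * f n x) - min (max 0 (\<sigma> * f n x)) (real K) \<partial>M)
          \<le> (\<integral>x. real K powr (1 - p) * \<bar>f n x\<bar> powr p \<partial>M)"
      proof (rule integral_mono)
        show "integrable M (\<lambda>x. max 0 (\<sigma> * f n x) - min (max 0 (\<sigma> * f n x)) (real K))"
          by (rule Bochner_Integration.integrable_bound[OF integrable_abs[OF fi[of n]]])
             (use \<sigma> in \<open>auto simp: max_def min_def abs_if split: if_splits\<close>)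
        show "max 0 (\<sigma> * f n x) - min (max 0 (\<sigma> * f n x)) (real K) \<le> real K powr (1 - p) * \<bar>f n x\<bar> powr p" for x
        proof (cases "\<sigma> * f n x \<le> real K")
          case False
          then have "\<sigma> * f n x = \<bar>f n x\<bar>" using \<sigma> by (auto simp: abs_if split: if_splits)
          with False show ?thesis using tail_le_powr[of p "real K" "\<bar>f n x\<bar>"] p K(2) by auto
        qed (auto simp: max_def min_def)
      qed (use f(2) in auto)
      also have "\<dots> \<le> real K powr (1 - p) * B" using B[of n] f(2) by (simp add: mult_left_mono)
      finally show ?thesis using K(1) by simp
    qed
    then show ?thesis by blast
  qed
  have pos: "integrable M (\<lambda>x. max 0 (1 * f n x))" "integrable M (\<lambda>x. max 0 (-1 * f n x))" for n
    using fi by auto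
  obtain s1 g1 where 1: "strict_mono s1" "integrable M g1"
    "\<And>A. A \<in> sets M \<Longrightarrow> (\<lambda>n. \<integral>x. max 0 (1 * f (s1 n) x) * indicator A x \<partial>M) \<longlonglongrightarrow> (\<integral>x. g1 x * indicator A x \<partial>M)"
    using uniformly_integrable_nonneg_subsequence[of "\<lambda>n x. max 0 (1 * f n x)", OF pos(1) _ ui] by auto
  obtain s2 g2 where 2: "strict_mono s2" "integrable M g2"
    "\<And>A. A \<in> sets M \<Longrightarrow> (\<lambda>n. \<integral>x. max 0 (-1 * f (s1 (s2 n)) x) * indicator A x \<partial>M) \<longlonglongrightarrow> (\<integral>x. g2 x * indicator A x \<partial>M)"
  proof -
    have "\<exists>K::nat. \<forall>n. (\<integral>x. max 0 (-1 * f (s1 n) x) - min (max 0 (-1 * f (s1 n) x)) (real K) \<partial>M) \<le> \<epsilon>"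
      if "\<epsilon> > 0" for \<epsilon> using ui[OF that, of "-1"] by auto
    from uniformly_integrable_nonneg_subsequence[of "\<lambda>n x. max 0 (-1 * f (s1 n) x)", OF pos(2) _ this]
    show ?thesis using that by auto
  qed
  define s where "s n = s1 (s2 n)" for n
  define g where "g x = g1 x - g2 x" for x
  have gi: "integrable M g" unfolding g_def using 1(2) 2(2) by simp
  have ind: "(\<lambda>n. \<integral>x. f (s n) x * indicator A x \<partial>M) \<longlonglongrightarrow> (\<integral>x. g x * indicator A x \<partial>M)" if A: "A \<in> sets M" for A
  proof -
    have ii: "integrable M (\<lambda>x. u x * indicator A x)" if "integrable M u" for u :: "'a \<Rightarrow> real"
      using integrable_real_mult_indicator[OF A that] by (simp add: mult.commute)
    have "(\<lambda>n. (\<integral>x. max 0 (1 * f (s n) x) * indicator A x \<partial>M) - (\<integral>x. max 0 (-1 * f (s n) x) * indicator A x \<partial>M))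
        \<longlonglongrightarrow> (\<integral>x. g1 x * indicator A x \<partial>M) - (\<integral>x. g2 x * indicator A x \<partial>M)"
      unfolding s_def using LIMSEQ_subseq_LIMSEQ[OF 1(3)[OF A] 2(1)] 2(3)[OF A]
      by (intro tendsto_diff) (simp_all add: o_def)
    moreover have "(\<integral>x. max 0 (1 * f (s n) x) * indicator A x \<partial>M) - (\<integral>x. max 0 (-1 * f (s n) x) * indicator A x \<partial>M)
        = (\<integral>x. f (s n) x * indicator A x \<partial>M)" for n
      by (subst Bochner_Integration.integral_diff[OF ii[OF pos(1)] ii[OF pos(2)], symmetric])
         (auto intro!: Bochner_Integration.integral_cong simp: max_def indicator_def)
    moreover have "(\<integral>x. g1 x * indicator A x \<partial>M) - (\<integral>x. g2 x * indicator A x \<partial>M) = (\<integral>x. g x * indicator A x \<partial>M)"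
      unfolding g_def left_diff_distrib using ii[OF 1(2)] ii[OF 2(2)] by simp
    ultimately show ?thesis by simp
  qed
  have "(\<lambda>n. \<integral>x. f (s n) x * h x \<partial>M) \<longlonglongrightarrow> (\<integral>x. g x * h x \<partial>M)"
    if h: "h \<in> borel_measurable M" "AE x in M. \<bar>h x\<bar> \<le> C" for h C
  proof -
    define h' where "h' x = max (- \<bar>C\<bar>) (min \<bar>C\<bar> (h x))" for x
    have h'm[measurable]: "h' \<in> borel_measurable M" unfolding h'_def using h(1) by measurable
    note [measurable] = h(1) borel_measurable_integrable[OF gi]
    have hh: "AE x in M. h' x = h x" using h(2) by eventually_elim (auto simp: h'_def)
    have Lb: "(\<integral>x. \<bar>f (s n) x\<bar> \<partial>M) \<le> measure M (space M) + B" for n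
    proof -
      have "(\<integral>x. \<bar>f (s n) x\<bar> \<partial>M) \<le> (\<integral>x. 1 + \<bar>f (s n) x\<bar> powr p \<partial>M)"
        using fi f(2) p by (intro integral_mono abs_le_one_plus_powr) auto
      also have "\<dots> \<le> measure M (space M) + B" using f(2) B[of "s n"] by simp
      finally show ?thesis .
    qed
    have "\<bar>h' x\<bar> \<le> \<bar>C\<bar>" for x unfolding h'_def by linarith
    then have "(\<lambda>n. \<integral>x. f (s n) x * h' x \<partial>M) \<longlonglongrightarrow> (\<integral>x. g x * h' x \<partial>M)"
      using tendsto_integral_bounded_test[OF fi Lb gi ind h'm] by blast
    moreover have "(\<integral>x. u x * h' x \<partial>M) = (\<integral>x. u x * h x \<partial>M)" if [measurable]: "u \<in> borel_measurable M" for u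
      by (rule integral_cong_AE) (measurable, use hh in eventually_elim, simp)
    ultimately show ?thesis by simp
  qed
  moreover have "strict_mono s" unfolding s_def using strict_mono_o[OF 1(1) 2(1)] by (simp add: o_def)
  ultimately show ?thesis using gi by blast
qed

end

section \<open>Hoelder's inequality for \<open>Lp_norm\<close>\<close>

lemma Lp_norm_nonneg: "Lp_norm M p f \<ge> 0"
  by (simp add: Lp_norm_def)

text \<open>Young's inequality for |u| and |v| / N, with N the L^q norm of \<open>v\<close>; after
  integration the two terms contribute at most 1/p + 1/q = 1. A vanishing norm is treated apart
  because N is a divisor. The bound 1 on \<open>u\<close> is the form in which the unit ball of
  L^\<infinity>(L^p) supplies it.\<close>

lemma Holder_Lp_norm:
  fixes u v :: "'a \<Rightarrow> real"
  assumes p: "p > 1" and q: "q = p / (p - 1)"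
    and [measurable]: "u \<in> borel_measurable M" "v \<in> borel_measurable M"
    and u: "(\<integral>\<^sup>+\<omega>. ennreal (\<bar>u \<omega>\<bar> powr p) \<partial>M) \<le> 1" and v: "Lp_finite M q v"
  shows "(\<integral>\<^sup>+\<omega>. ennreal \<bar>u \<omega> * v \<omega>\<bar> \<partial>M) \<le> ennreal (Lp_norm M q v)"
proof -
  have q1: "q > 1" using p by (simp add: q field_simps)
  have pq: "1 / p + 1 / q = 1" using p by (simp add: q field_simps)
  define S where "S = (\<integral>\<^sup>+\<omega>. ennreal (\<bar>v \<omega>\<bar> powr q) \<partial>M)"
  have Sf: "S < \<infinity>" using v unfolding Lp_finite_def S_def .
  define N where "N = Lp_norm M q v"
  have N: "N = enn2real S powr (1 / q)" unfolding N_def Lp_norm_def S_def ..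
  show ?thesis
  proof (cases "S = 0")
    case True
    then have "AE \<omega> in M. ennreal (\<bar>v \<omega>\<bar> powr q) = 0"
      unfolding S_def by (subst (asm) nn_integral_0_iff_AE) auto
    then have "AE \<omega> in M. ennreal \<bar>u \<omega> * v \<omega>\<bar> = 0" by eventually_elim (use q1 in auto)
    then have "(\<integral>\<^sup>+\<omega>. ennreal \<bar>u \<omega> * v \<omega>\<bar> \<partial>M) = 0" by (subst nn_integral_0_iff_AE) auto
    then show ?thesis by simp
  next
    case False
    then have Sr: "enn2real S > 0" using Sf by (auto simp: enn2real_positive_iff zero_less_iff_neq_zero)
    then have N0: "N > 0" unfolding N by simp
    have Nq: "N powr q = enn2real S" unfolding N powr_powr using q1 Sr by simp
    have pt: "\<bar>u \<omega> * v \<omega>\<bar> \<le> N * (1 / p * \<bar>u \<omega>\<bar> powr p + 1 / (q * enn2real S) * \<bar>v \<omega>\<bar> powr q)" for \<omega>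
    proof -
      have "\<bar>u \<omega>\<bar> * (\<bar>v \<omega>\<bar> / N) \<le> \<bar>u \<omega>\<bar> powr p / p + (\<bar>v \<omega>\<bar> / N) powr q / q"
        using p q1 pq N0 by (intro Youngs_inequality) auto
      also have "\<dots> = 1 / p * \<bar>u \<omega>\<bar> powr p + 1 / (q * enn2real S) * \<bar>v \<omega>\<bar> powr q"
        using N0 Nq by (simp add: powr_divide)
      finally show ?thesis using N0 by (simp add: abs_mult field_simps)
    qed
    have "(\<integral>\<^sup>+\<omega>. ennreal \<bar>u \<omega> * v \<omega>\<bar> \<partial>M) \<le>
        (\<integral>\<^sup>+\<omega>. ennreal N * (ennreal (1 / p) * ennreal (\<bar>u \<omega>\<bar> powr p) + ennreal (1 / (q * enn2real S)) * ennreal (\<bar>v \<omega>\<bar> powr q)) \<partial>M)"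
      using pt N0 p q1 Sr by (intro nn_integral_mono) (simp flip: ennreal_mult ennreal_plus)
    also have "\<dots> = ennreal N * (ennreal (1 / p) * (\<integral>\<^sup>+\<omega>. ennreal (\<bar>u \<omega>\<bar> powr p) \<partial>M) + ennreal (1 / (q * enn2real S)) * S)"
      unfolding S_def by (simp add: nn_integral_cmult nn_integral_add)
    also have "\<dots> \<le> ennreal N * (ennreal (1 / p) * 1 + ennreal (1 / (q * enn2real S)) * S)"
      using u by (intro mult_left_mono add_right_mono) auto
    also have "ennreal (1 / (q * enn2real S)) * S = ennreal (1 / q)"
    proof -
      have "S = ennreal (enn2real S)" using Sf by simp
      then have "ennreal (1 / (q * enn2real S)) * S = ennreal (1 / (q * enn2real S) * enn2real S)"
        using q1 Sr by (subst ennreal_mult') auto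
      then show ?thesis using Sr by simp
    qed
    also have "ennreal N * (ennreal (1 / p) * 1 + ennreal (1 / q)) = ennreal N"
      using p q1 pq by (simp flip: ennreal_plus)
    finally show ?thesis unfolding N_def .
  qed
qed

section \<open>Fields bounded in \<open>L\<^sup>\<infinity>(L\<^sup>p)\<close>\<close>

text \<open>1 + u is at most 2 max(1, u), the other factor 2 of the 4 contributes 2^(-p) \<le> 1/2,
  and max(1, u)^p \<le> 1 + u^p. If u^p has mean at most 1, so has the right side; that is its use
  in \<open>Lp_ball_scale\<close>.\<close>

lemma powr_one_plus_quarter:
  fixes u p :: real
  assumes "p \<ge> 1" "u \<ge> 0"
  shows "((1 + u) / 4) powr p \<le> 1 / 2 * (1 + u powr p)"
proof -
  have "((1 + u) / 4) powr p \<le> (max 1 u / 2) powr p"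
    using assms by (intro powr_mono2) auto
  also have "\<dots> = max 1 u powr p * (1 / 2) powr p" using assms by (simp add: powr_divide)
  also have "\<dots> \<le> max 1 u powr p * (1 / 2)"
    using assms powr_mono'[of 1 p "1 / 2"] by (intro mult_left_mono) auto
  also have "max 1 u powr p \<le> 1 + u powr p" by (auto simp: max_def)
  finally show ?thesis by simp
qed

section \<open>The unit ball of L^\<infinity>(L^p)\<close>

context ergodic_Z_system begin

text \<open>The fibre integral is bounded directly, so neither an essential supremum nor a root
  enters, and functions live on the product space, where weak limits are taken.\<close>

definition Lp_ball :: "real \<Rightarrow> (real \<times> 'a \<Rightarrow> real) \<Rightarrow> bool" where
  "Lp_ball p f \<longleftrightarrow> f \<in> borel_measurable CM \<and>
     (AE x in cell. (\<integral>\<^sup>+\<omega>. ennreal (\<bar>f (x, \<omega>)\<bar> powr p) \<partial>M) \<le> 1)"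

lemma Lp_ball_integrable:
  assumes "Lp_ball p f"
  shows "integrable CM (\<lambda>z. \<bar>f z\<bar> powr p)" "(\<integral>z. \<bar>f z\<bar> powr p \<partial>CM) \<le> 1"
proof -
  have [measurable]: "f \<in> borel_measurable CM"
    and b: "AE x in cell. (\<integral>\<^sup>+\<omega>. ennreal (\<bar>f (x, \<omega>)\<bar> powr p) \<partial>M) \<le> 1"
    using assms unfolding Lp_ball_def by auto
  have "(\<integral>\<^sup>+z. ennreal (\<bar>f z\<bar> powr p) \<partial>CM) = (\<integral>\<^sup>+x. \<integral>\<^sup>+\<omega>. ennreal (\<bar>f (x, \<omega>)\<bar> powr p) \<partial>M \<partial>cell)"
    by (rule M.nn_integral_fst[symmetric]) measurable
  also have "\<dots> \<le> (\<integral>\<^sup>+x. 1 \<partial>cell)" using b by (rule nn_integral_mono_AE)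
  also have "\<dots> = 1" by (simp add: cell.emeasure_space_1)
  finally have le: "(\<integral>\<^sup>+z. ennreal (\<bar>f z\<bar> powr p) \<partial>CM) \<le> 1" .
  show i: "integrable CM (\<lambda>z. \<bar>f z\<bar> powr p)"
  proof (rule integrableI_bounded)
    show "(\<integral>\<^sup>+z. ennreal (norm (\<bar>f z\<bar> powr p)) \<partial>CM) < \<infinity>"
      using le by (simp add: le_less_trans[OF _ ennreal_one_less_top])
  qed measurable
  show "(\<integral>z. \<bar>f z\<bar> powr p \<partial>CM) \<le> 1"
    using le nn_integral_eq_integral[OF i] by simp
qed

text \<open>The difference quotients of the correctors are dominated by 1 + |u| rather than by |u|.
  Up to the fixed factor 4 L this keeps them in the ball.\<close>

lemma Lp_ball_scale:
  assumes u: "Lp_ball p u" and p: "p > 1" and L: "L > 0"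
    and fm[measurable]: "f \<in> borel_measurable CM"
    and b: "AE z in CM. \<bar>f z\<bar> \<le> L * (1 + \<bar>u z\<bar>)"
  shows "Lp_ball p (\<lambda>z. f z / (4 * L))"
proof -
  have [measurable]: "u \<in> borel_measurable CM"
    and ub: "AE x in cell. (\<integral>\<^sup>+\<omega>. ennreal (\<bar>u (x, \<omega>)\<bar> powr p) \<partial>M) \<le> 1"
    using u unfolding Lp_ball_def by auto
  have "AE x in cell. AE \<omega> in M. \<bar>f (x, \<omega>)\<bar> \<le> L * (1 + \<bar>u (x, \<omega>)\<bar>)"
    by (rule P.AE_pair[OF b])
  then have "AE x in cell. (\<integral>\<^sup>+\<omega>. ennreal (\<bar>f (x, \<omega>) / (4 * L)\<bar> powr p) \<partial>M) \<le> 1"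
    using ub AE_space
  proof eventually_elim
    case (elim x)
    note [measurable] = elim(3)
    have "(\<integral>\<^sup>+\<omega>. ennreal (\<bar>f (x, \<omega>) / (4 * L)\<bar> powr p) \<partial>M) \<le>
        (\<integral>\<^sup>+\<omega>. ennreal (1 / 2) * (1 + ennreal (\<bar>u (x, \<omega>)\<bar> powr p)) \<partial>M)"
    proof (rule nn_integral_mono_AE)
      show "AE \<omega> in M. ennreal (\<bar>f (x, \<omega>) / (4 * L)\<bar> powr p) \<le> ennreal (1 / 2) * (1 + ennreal (\<bar>u (x, \<omega>)\<bar> powr p))"
        using elim(1)
      proof eventually_elim
        case (elim \<omega>)
        have "\<bar>f (x, \<omega>) / (4 * L)\<bar> powr p \<le> ((1 + \<bar>u (x, \<omega>)\<bar>) / 4) powr p"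
          using elim L p by (intro powr_mono2) (auto simp: field_simps)
        also have "\<dots> \<le> 1 / 2 * (1 + \<bar>u (x, \<omega>)\<bar> powr p)" using p by (intro powr_one_plus_quarter) auto
        finally have "ennreal (\<bar>f (x, \<omega>) / (4 * L)\<bar> powr p) \<le> ennreal (1 / 2 * (1 + \<bar>u (x, \<omega>)\<bar> powr p))"
          by (rule ennreal_leI)
        also have "\<dots> = ennreal (1 / 2) * (1 + ennreal (\<bar>u (x, \<omega>)\<bar> powr p))"
          by (subst ennreal_mult) (auto simp: ennreal_plus[symmetric] simp del: ennreal_plus simp flip: ennreal_1)
        finally show ?case .
      qed
    qed
    also have "\<dots> = ennreal (1 / 2) * (1 + (\<integral>\<^sup>+\<omega>. ennreal (\<bar>u (x, \<omega>)\<bar> powr p) \<partial>M))"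
      by (simp add: nn_integral_cmult nn_integral_add M.emeasure_space_1)
    also have "\<dots> \<le> ennreal (1 / 2) * (1 + 1)"
      using elim(2) by (intro mult_left_mono add_left_mono) auto
    also have "\<dots> = 1"
    proof -
      have "ennreal (1 / 2) * ennreal 2 = ennreal (1 / 2 * 2)" by (rule ennreal_mult[symmetric]) auto
      then show ?thesis by simp
    qed
    finally show ?case .
  qed
  then show ?thesis unfolding Lp_ball_def by simp
qed

text \<open>Weak lower semicontinuity of the norm, localised in x. Testing with sgn g min(|g|,
  K)^(p-1) over x in A gives, for the integral J of min(|g|, K)^p there, J \<le> |A|/p + J/q by
  Young's inequality, hence J \<le> |A|. Taking for A the set where the truncated fibre integral
  exceeds 1 shows that this set is null, and Fatou's lemma removes K.\<close>

lemma Lp_ball_weak_limit: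
  assumes p: "p > 1" and u: "\<And>n. Lp_ball p (u n)" and g: "integrable CM g"
    and lim: "\<And>h C. h \<in> borel_measurable CM \<Longrightarrow> AE z in CM. \<bar>h z\<bar> \<le> C \<Longrightarrow>
      (\<lambda>n. \<integral>z. u n z * h z \<partial>CM) \<longlonglongrightarrow> (\<integral>z. g z * h z \<partial>CM)"
  shows "Lp_ball p g"
proof -
  note gm[measurable] = borel_measurable_integrable[OF g]
  have um[measurable]: "u n \<in> borel_measurable CM" for n using u unfolding Lp_ball_def by blast
  define q where "q = p / (p - 1)"
  have q1: "q > 1" using p by (simp add: q_def field_simps)
  have pq: "1 / p + 1 / q = 1" using p by (simp add: q_def field_simps)
  have pq': "(p - 1) * q = p" using p by (simp add: q_def)
  \<comment> \<open>Truncation keeps the test function bounded, as the hypothesis on convergence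
    demands, and J finite, so that J/q can be moved to the left.\<close>
  define t where "t K z = min \<bar>g z\<bar> (real K)" for K z
  have tm[measurable]: "t K \<in> borel_measurable CM" for K unfolding t_def[abs_def] by measurable
  have tb: "0 \<le> t K z" "t K z \<le> real K" for K z unfolding t_def by auto
  have tpb: "t K z powr p \<le> real K powr p" for K z using tb[of K z] p by (intro powr_mono2) auto
  have tpi: "integrable CM (\<lambda>z. t K z powr p)" for K
    by (rule P.integrable_bounded[where C="real K powr p"]) (use tpb in auto)
  have setb: "(\<integral>z. t K z powr p * indicator A (fst z) \<partial>CM) \<le> measure cell A"
    if A[measurable]: "A \<in> sets cell" for K A
  proof -
    define J where "J = (\<integral>z. t K z powr p * indicator A (fst z) \<partial>CM)"
    define h where "h z = sgn (g z) * t K z powr (p - 1) * indicator A (fst z)" for z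
    have [measurable]: "h \<in> borel_measurable CM" unfolding h_def by measurable
    have hb: "\<bar>h z\<bar> \<le> t K z powr (p - 1) * indicator A (fst z)" for z
      unfolding h_def by (auto simp: abs_mult abs_sgn_eq indicator_def)
    have hK: "\<bar>h z\<bar> \<le> real K powr (p - 1)" for z
    proof -
      have "\<bar>h z\<bar> \<le> t K z powr (p - 1) * 1" by (rule order.trans[OF hb mult_left_mono]) (auto simp: indicator_def)
      also have "\<dots> \<le> real K powr (p - 1)" using tb[of K z] p by (simp add: powr_mono2)
      finally show ?thesis .
    qed
    have hu: "norm (v * h z) \<le> norm (real K powr (p - 1) * \<bar>v\<bar>)" for v z
    proof -
      have "\<bar>v\<bar> * \<bar>h z\<bar> \<le> \<bar>v\<bar> * real K powr (p - 1)" by (rule mult_left_mono[OF hK abs_ge_zero])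
      then show ?thesis by (simp add: abs_mult mult.commute)
    qed
    have Ji: "integrable CM (\<lambda>z. t K z powr p * indicator A (fst z))"
      by (rule Bochner_Integration.integrable_bound[OF tpi[of K]]) (measurable, auto simp: indicator_def)
    have [measurable]: "(\<lambda>z. indicator A (fst z) :: real) \<in> borel_measurable CM"
      by (rule measurable_compose[OF measurable_fst]) (use A in simp)
    have Ai: "integrable CM (\<lambda>z. indicator A (fst z) :: real)"
      by (rule P.integrable_bounded[where C=1]) (simp_all add: indicator_def)
    have Am: "(\<integral>z. indicator A (fst z) \<partial>CM) = measure cell A"
    proof -
      have "(\<integral>x. \<integral>\<omega>. indicator A x \<partial>M \<partial>cell) = (\<integral>z. indicator A (fst z) \<partial>CM :: real)"
        by (subst P.integral_fst) (use Ai in \<open>simp_all add: case_prod_beta'\<close>)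
      then show ?thesis by (simp add: M.prob_space)
    qed
    have low: "t K z powr p * indicator A (fst z) \<le> g z * h z" for z
    proof (cases "t K z = 0")
      case False
      then have "t K z powr p = t K z * t K z powr (p - 1)" using tb[of K z] by (simp add: powr_mult_base)
      also have "\<dots> \<le> \<bar>g z\<bar> * t K z powr (p - 1)" by (intro mult_right_mono) (auto simp: t_def)
      finally show ?thesis unfolding h_def by (auto simp: indicator_def abs_sgn mult.assoc)
    next
      case True
      then show ?thesis using p by (simp add: h_def)
    qed
    have upi: "integrable CM (\<lambda>z. \<bar>u n z\<bar> powr p)" for n by (rule Lp_ball_integrable(1)[OF u])
    have ubnd: "(\<integral>z. \<bar>u n z\<bar> powr p * indicator A (fst z) \<partial>CM) \<le> measure cell A"
      and upAi: "integrable CM (\<lambda>z. \<bar>u n z\<bar> powr p * indicator A (fst z))" for n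
    proof -
      show i: "integrable CM (\<lambda>z. \<bar>u n z\<bar> powr p * indicator A (fst z))"
        by (rule Bochner_Integration.integrable_bound[OF upi[of n]]) (measurable, auto simp: indicator_def)
      have "(\<integral>\<^sup>+z. ennreal (\<bar>u n z\<bar> powr p * indicator A (fst z)) \<partial>CM) =
          (\<integral>\<^sup>+x. \<integral>\<^sup>+\<omega>. ennreal (\<bar>u n (x, \<omega>)\<bar> powr p * indicator A (fst (x, \<omega>))) \<partial>M \<partial>cell)"
        by (rule M.nn_integral_fst[symmetric]) measurable
      also have "\<dots> \<le> (\<integral>\<^sup>+x. indicator A x \<partial>cell)"
      proof (rule nn_integral_mono_AE)
        have "AE x in cell. (\<integral>\<^sup>+\<omega>. ennreal (\<bar>u n (x, \<omega>)\<bar> powr p) \<partial>M) \<le> 1" using u unfolding Lp_ball_def by blast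
        then show "AE x in cell. (\<integral>\<^sup>+\<omega>. ennreal (\<bar>u n (x, \<omega>)\<bar> powr p * indicator A (fst (x, \<omega>))) \<partial>M) \<le> indicator A x"
          by eventually_elim (auto simp: indicator_def)
      qed
      also have "\<dots> = ennreal (measure cell A)" by (simp add: cell.emeasure_eq_measure)
      finally show "(\<integral>z. \<bar>u n z\<bar> powr p * indicator A (fst z) \<partial>CM) \<le> measure cell A"
        using nn_integral_eq_integral[OF i] by simp
    qed
    have up: "(\<integral>z. u n z * h z \<partial>CM) \<le> measure cell A / p + J / q" for n
    proof -
      have pt: "u n z * h z \<le> \<bar>u n z\<bar> powr p * indicator A (fst z) / p + t K z powr p * indicator A (fst z) / q" for z
      proof -
        have "u n z * h z \<le> \<bar>u n z\<bar> * \<bar>h z\<bar>" by (metis abs_ge_self abs_mult)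
        also have "\<dots> \<le> \<bar>u n z\<bar> * (t K z powr (p - 1) * indicator A (fst z))" using hb by (intro mult_left_mono) auto
        also have "\<dots> = (\<bar>u n z\<bar> * t K z powr (p - 1)) * indicator A (fst z)" by simp
        also have "\<dots> \<le> (\<bar>u n z\<bar> powr p / p + (t K z powr (p - 1)) powr q / q) * indicator A (fst z)"
          using p q1 pq by (intro mult_right_mono Youngs_inequality) auto
        finally show ?thesis by (simp add: powr_powr pq' distrib_right)
      qed
      have "(\<integral>z. u n z * h z \<partial>CM) \<le>
          (\<integral>z. \<bar>u n z\<bar> powr p * indicator A (fst z) / p + t K z powr p * indicator A (fst z) / q \<partial>CM)"
      proof (rule integral_mono)
        have "integrable CM (u n)" by (rule P.integrable_if_powr[OF um upi less_imp_le[OF p]])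
        then have "integrable CM (\<lambda>z. real K powr (p - 1) * \<bar>u n z\<bar>)" by simp
        then show "integrable CM (\<lambda>z. u n z * h z)"
        proof (rule Bochner_Integration.integrable_bound)
          show "AE z in CM. norm (u n z * h z) \<le> norm (real K powr (p - 1) * \<bar>u n z\<bar>)"
            by (intro AE_I2 hu)
        qed measurable
      qed (use upAi Ji pt in auto)
      also have "\<dots> = (\<integral>z. \<bar>u n z\<bar> powr p * indicator A (fst z) \<partial>CM) / p + J / q"
        unfolding J_def using upAi Ji by simp
      also have "\<dots> \<le> measure cell A / p + J / q"
        using ubnd p by (intro add_right_mono divide_right_mono) auto
      finally show ?thesis .
    qed
    have "J \<le> (\<integral>z. g z * h z \<partial>CM)"
      unfolding J_def
    proof (rule integral_mono[OF Ji _ low])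
      have "integrable CM (\<lambda>z. real K powr (p - 1) * \<bar>g z\<bar>)" using g by simp
      then show "integrable CM (\<lambda>z. g z * h z)"
      proof (rule Bochner_Integration.integrable_bound)
        show "AE z in CM. norm (g z * h z) \<le> norm (real K powr (p - 1) * \<bar>g z\<bar>)"
          by (intro AE_I2 hu)
      qed measurable
    qed
    also have "\<dots> \<le> measure cell A / p + J / q"
      by (rule LIMSEQ_le_const2[OF lim[of h "real K powr (p - 1)"]]) (use hK up in auto)
    finally have "J * (1 - 1 / q) \<le> measure cell A / p" by (simp add: algebra_simps)
    moreover have "1 - 1 / q = 1 / p" using pq by simp
    ultimately have "J / p \<le> measure cell A / p" by simp
    then show ?thesis unfolding J_def using p by (simp add: divide_le_cancel)
  qed
  have NK: "AE x in cell. (\<integral>\<omega>. t K (x, \<omega>) powr p \<partial>M) \<le> 1" for K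
  proof -
    define NN where "NN x = (\<integral>\<omega>. t K (x, \<omega>) powr p \<partial>M)" for x
    have Nm[measurable]: "NN \<in> borel_measurable cell" unfolding NN_def by measurable
    have Ni: "integrable cell NN" unfolding NN_def by (rule P.integrable_fst'[OF tpi])
    define A where "A = {x \<in> space cell. NN x > 1}"
    have A[measurable]: "A \<in> sets cell" unfolding A_def by measurable
    have NAi: "integrable cell (\<lambda>x. NN x * indicator A x)"
      using integrable_real_mult_indicator[OF A Ni] by (simp add: mult.commute)
    have "(\<integral>x. NN x * indicator A x \<partial>cell) = (\<integral>z. t K z powr p * indicator A (fst z) \<partial>CM)"
    proof -
      have "integrable CM (\<lambda>z. t K z powr p * indicator A (fst z))"
        by (rule Bochner_Integration.integrable_bound[OF tpi[of K]]) (measurable, auto simp: indicator_def)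
      from P.integral_fst'[OF this] show ?thesis unfolding NN_def by simp
    qed
    also have "\<dots> \<le> measure cell A" by (rule setb[OF A])
    finally have le: "(\<integral>x. NN x * indicator A x \<partial>cell) \<le> measure cell A" .
    have nn: "AE x in cell. 0 \<le> (NN x - 1) * indicator A x" by (auto simp: A_def indicator_def)
    have Ai: "integrable cell (\<lambda>x. indicator A x :: real)"
      by (intro integrable_real_indicator A) (simp add: cell.emeasure_finite less_top[symmetric])
    have di: "integrable cell (\<lambda>x. (NN x - 1) * indicator A x)"
      using NAi Ai by (simp add: left_diff_distrib)
    have "(\<integral>x. (NN x - 1) * indicator A x \<partial>cell) \<le> 0"
      using NAi Ai A le by (simp add: left_diff_distrib)
    then have "(\<integral>x. (NN x - 1) * indicator A x \<partial>cell) = 0"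
      using integral_nonneg_AE[OF nn] by simp
    then have "AE x in cell. (NN x - 1) * indicator A x = 0"
      using integral_nonneg_eq_0_iff_AE[OF di nn] by simp
    then show ?thesis using AE_space unfolding NN_def[symmetric]
      by eventually_elim (auto simp: A_def indicator_def split: if_splits)
  qed
  have "AE x in cell. \<forall>K. (\<integral>\<omega>. t K (x, \<omega>) powr p \<partial>M) \<le> 1" unfolding AE_all_countable using NK by blast
  then have "AE x in cell. (\<integral>\<^sup>+\<omega>. ennreal (\<bar>g (x, \<omega>)\<bar> powr p) \<partial>M) \<le> 1"
    using AE_space
  proof eventually_elim
    case (elim x)
    note [measurable] = elim(2)
    have tle: "(\<integral>\<^sup>+\<omega>. ennreal (t K (x, \<omega>) powr p) \<partial>M) \<le> 1" for K
    proof -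
      have "integrable M (\<lambda>\<omega>. t K (x, \<omega>) powr p)"
        by (rule M.integrable_bounded[where C="real K powr p"]) (measurable, use tpb in auto)
      from nn_integral_eq_integral[OF this] show ?thesis using elim(1)[rule_format, of K] by simp
    qed
    have "(\<lambda>K. ennreal (t K (x, \<omega>) powr p)) \<longlonglongrightarrow> ennreal (\<bar>g (x, \<omega>)\<bar> powr p)" for \<omega>
    proof (rule tendsto_eventually)
      obtain N :: nat where "\<bar>g (x, \<omega>)\<bar> \<le> real N" using real_arch_simple by blast
      then show "\<forall>\<^sub>F K in sequentially. ennreal (t K (x, \<omega>) powr p) = ennreal (\<bar>g (x, \<omega>)\<bar> powr p)"
        unfolding eventually_sequentially t_def by (intro exI[of _ N]) (auto simp: min_def)
    qed
    then have "ennreal (\<bar>g (x, \<omega>)\<bar> powr p) = liminf (\<lambda>K. ennreal (t K (x, \<omega>) powr p))" for \<omega>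
      by (intro lim_imp_Liminf[symmetric]) auto
    then have "(\<integral>\<^sup>+\<omega>. ennreal (\<bar>g (x, \<omega>)\<bar> powr p) \<partial>M) = (\<integral>\<^sup>+\<omega>. liminf (\<lambda>K. ennreal (t K (x, \<omega>) powr p)) \<partial>M)"
      by simp
    also have "\<dots> \<le> liminf (\<lambda>K. \<integral>\<^sup>+\<omega>. ennreal (t K (x, \<omega>) powr p) \<partial>M)"
      by (rule nn_integral_liminf) measurable
    also have "\<dots> \<le> liminf (\<lambda>K::nat. 1)" by (rule Liminf_mono) (use tle in auto)
    also have "\<dots> = 1" by (simp add: Liminf_const)
    finally show ?case .
  qed
  then show ?thesis unfolding Lp_ball_def by simp
qed

section \<open>Duality with L^1(L^q)\<close>

lemma nn_integral_Holder_cell: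
  assumes p: "p > 1" and q: "q = p / (p - 1)" and f: "Lp_ball p f"
    and gm: "g \<in> borel_measurable CM" and gq: "AE x in cell. Lp_finite M q (\<lambda>\<omega>. g (x, \<omega>))"
  shows "(\<integral>\<^sup>+z. ennreal \<bar>f z * g z\<bar> \<partial>CM) \<le> (\<integral>\<^sup>+x. ennreal (Lp_norm M q (\<lambda>\<omega>. g (x, \<omega>))) \<partial>cell)"
proof -
  note [measurable] = gm
  have [measurable]: "f \<in> borel_measurable CM"
    and fb: "AE x in cell. (\<integral>\<^sup>+\<omega>. ennreal (\<bar>f (x, \<omega>)\<bar> powr p) \<partial>M) \<le> 1"
    using f unfolding Lp_ball_def by auto
  have "(\<integral>\<^sup>+z. ennreal \<bar>f z * g z\<bar> \<partial>CM) = (\<integral>\<^sup>+x. \<integral>\<^sup>+\<omega>. ennreal \<bar>f (x, \<omega>) * g (x, \<omega>)\<bar> \<partial>M \<partial>cell)"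
    by (rule M.nn_integral_fst[symmetric]) measurable
  also have "\<dots> \<le> (\<integral>\<^sup>+x. ennreal (Lp_norm M q (\<lambda>\<omega>. g (x, \<omega>))) \<partial>cell)"
  proof (rule nn_integral_mono_AE)
    show "AE x in cell. (\<integral>\<^sup>+\<omega>. ennreal \<bar>f (x, \<omega>) * g (x, \<omega>)\<bar> \<partial>M) \<le> ennreal (Lp_norm M q (\<lambda>\<omega>. g (x, \<omega>)))"
      using fb gq AE_space
    proof eventually_elim
      case (elim x)
      note [measurable] = elim(3)
      show ?case by (rule Holder_Lp_norm[OF p q _ _ elim(1,2)]) measurable
    qed
  qed
  finally show ?thesis .
qed

lemma Lp_norm_measurable [measurable]:
  assumes [measurable]: "g \<in> borel_measurable CM"
  shows "(\<lambda>x. Lp_norm M q (\<lambda>\<omega>. g (x, \<omega>))) \<in> borel_measurable cell"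
  unfolding Lp_norm_def by measurable

text \<open>Dominated convergence twice: in \<omega> for fixed x, so that the fibre norm of the tail
  vanishes, then in x with the full fibre norm as majorant.\<close>

lemma Lp_norm_tail_tendsto_0:
  assumes q: "q > 1" and gm: "g \<in> borel_measurable CM"
    and gq: "AE x in cell. Lp_finite M q (\<lambda>\<omega>. g (x, \<omega>))"
    and g1: "(\<integral>\<^sup>+x. ennreal (Lp_norm M q (\<lambda>\<omega>. g (x, \<omega>))) \<partial>cell) < \<infinity>"
  shows "(\<lambda>K::nat. \<integral>\<^sup>+x. ennreal (Lp_norm M q (\<lambda>\<omega>. g (x, \<omega>) * indicator {v. \<bar>v\<bar> > real K} (g (x, \<omega>)))) \<partial>cell) \<longlonglongrightarrow> 0"
proof -
  note [measurable] = gm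
  define gK where "gK K z = g z * indicator {v. \<bar>v\<bar> > real K} (g z)" for K z
  have [measurable]: "gK K \<in> borel_measurable CM" for K unfolding gK_def by measurable
  have gKle: "\<bar>gK K z\<bar> powr q \<le> \<bar>g z\<bar> powr q" for K z
    using q by (intro powr_mono2) (auto simp: gK_def indicator_def)
  have "(\<lambda>K. \<integral>\<^sup>+x. ennreal (Lp_norm M q (\<lambda>\<omega>. gK K (x, \<omega>))) \<partial>cell) \<longlonglongrightarrow> (\<integral>\<^sup>+x. 0 \<partial>cell)"
  proof (rule nn_integral_dominated_convergence[OF _ _ _ _ g1])
    show "AE x in cell. ennreal (Lp_norm M q (\<lambda>\<omega>. gK K (x, \<omega>))) \<le> ennreal (Lp_norm M q (\<lambda>\<omega>. g (x, \<omega>)))" for K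
      using gq
    proof eventually_elim
      case (elim x)
      have "(\<integral>\<^sup>+\<omega>. ennreal (\<bar>gK K (x, \<omega>)\<bar> powr q) \<partial>M) \<le> (\<integral>\<^sup>+\<omega>. ennreal (\<bar>g (x, \<omega>)\<bar> powr q) \<partial>M)"
        by (intro nn_integral_mono ennreal_leI gKle)
      then show ?case using elim q unfolding Lp_norm_def Lp_finite_def
        by (intro ennreal_leI powr_mono2 enn2real_mono) auto
    qed
    show "AE x in cell. (\<lambda>K. ennreal (Lp_norm M q (\<lambda>\<omega>. gK K (x, \<omega>)))) \<longlonglongrightarrow> 0"
      using gq AE_space
    proof eventually_elim
      case (elim x)
      note [measurable] = elim(2)
      have "(\<lambda>K. \<integral>\<^sup>+\<omega>. ennreal (\<bar>gK K (x, \<omega>)\<bar> powr q) \<partial>M) \<longlonglongrightarrow> (\<integral>\<^sup>+\<omega>. 0 \<partial>M)"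
      proof (rule nn_integral_dominated_convergence)
        show "AE \<omega> in M. ennreal (\<bar>gK K (x, \<omega>)\<bar> powr q) \<le> ennreal (\<bar>g (x, \<omega>)\<bar> powr q)" for K
          by (intro AE_I2 ennreal_leI gKle)
        show "(\<integral>\<^sup>+\<omega>. ennreal (\<bar>g (x, \<omega>)\<bar> powr q) \<partial>M) < \<infinity>" using elim(1) unfolding Lp_finite_def .
        show "AE \<omega> in M. (\<lambda>K. ennreal (\<bar>gK K (x, \<omega>)\<bar> powr q)) \<longlonglongrightarrow> 0"
        proof (rule AE_I2, rule tendsto_eventually)
          fix \<omega>
          obtain N :: nat where "\<bar>g (x, \<omega>)\<bar> \<le> real N" using real_arch_simple by blast
          then show "\<forall>\<^sub>F K in sequentially. ennreal (\<bar>gK K (x, \<omega>)\<bar> powr q) = 0"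
            unfolding eventually_sequentially by (intro exI[of _ N]) (auto simp: gK_def indicator_def)
        qed
      qed measurable
      then have "(\<lambda>K. enn2real (\<integral>\<^sup>+\<omega>. ennreal (\<bar>gK K (x, \<omega>)\<bar> powr q) \<partial>M)) \<longlonglongrightarrow> 0"
        by (intro tendsto_enn2real) simp_all
      then have "(\<lambda>K. Lp_norm M q (\<lambda>\<omega>. gK K (x, \<omega>))) \<longlonglongrightarrow> 0"
        unfolding Lp_norm_def using q by (intro tendsto_zero_powrI[OF _ tendsto_const]) auto
      then show ?case using tendsto_ennrealI[of _ 0] by simp
    qed
  qed measurable
  then show ?thesis unfolding gK_def by simp
qed

lemma Lp_ball_integrable_mult:
  assumes p: "p > 1" and q: "q = p / (p - 1)" and f: "Lp_ball p f"
    and gm: "g \<in> borel_measurable CM" and gq: "AE x in cell. Lp_finite M q (\<lambda>\<omega>. g (x, \<omega>))"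
    and g1: "(\<integral>\<^sup>+x. ennreal (Lp_norm M q (\<lambda>\<omega>. g (x, \<omega>))) \<partial>cell) < \<infinity>"
  shows "integrable CM (\<lambda>z. f z * g z)"
proof (rule integrableI_bounded)
  show "(\<lambda>z. f z * g z) \<in> borel_measurable CM" using f gm unfolding Lp_ball_def by (intro borel_measurable_times) auto
  show "(\<integral>\<^sup>+z. ennreal (norm (f z * g z)) \<partial>CM) < \<infinity>"
    using le_less_trans[OF nn_integral_Holder_cell[OF p q f gm gq] g1] by simp
qed

text \<open>The test function \<open>g\<close> is cut at height K. By Hoelder's inequality its tail
  contributes at most \<epsilon> uniformly over the unit ball, hence for all \<open>f n\<close> and
  for the limit alike; the bounded part is covered by the assumed convergence.\<close>

lemma Lp_ball_tendsto_integral: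
  assumes p: "p > 1" and q: "q = p / (p - 1)" and f: "\<And>n. Lp_ball p (f n)" and f0: "Lp_ball p f0"
    and lim: "\<And>h C. h \<in> borel_measurable CM \<Longrightarrow> AE z in CM. \<bar>h z\<bar> \<le> C \<Longrightarrow>
      (\<lambda>n. \<integral>z. f n z * h z \<partial>CM) \<longlonglongrightarrow> (\<integral>z. f0 z * h z \<partial>CM)"
    and gm: "g \<in> borel_measurable CM" and gq: "AE x in cell. Lp_finite M q (\<lambda>\<omega>. g (x, \<omega>))"
    and g1: "(\<integral>\<^sup>+x. ennreal (Lp_norm M q (\<lambda>\<omega>. g (x, \<omega>))) \<partial>cell) < \<infinity>"
  shows "(\<lambda>n. \<integral>z. f n z * g z \<partial>CM) \<longlonglongrightarrow> (\<integral>z. f0 z * g z \<partial>CM)"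
proof (rule tendsto_uniform_approx)
  fix \<epsilon> :: real assume \<epsilon>: "\<epsilon> > 0"
  have q1: "q > 1" using p by (simp add: q field_simps)
  note [measurable] = gm
  have "\<forall>\<^sub>F K in sequentially. (\<integral>\<^sup>+x. ennreal (Lp_norm M q (\<lambda>\<omega>. g (x, \<omega>) * indicator {v. \<bar>v\<bar> > real K} (g (x, \<omega>)))) \<partial>cell) < ennreal \<epsilon>"
    using Lp_norm_tail_tendsto_0[OF q1 gm gq g1] \<epsilon> by (intro order_tendstoD(2)) auto
  then obtain K where K: "(\<integral>\<^sup>+x. ennreal (Lp_norm M q (\<lambda>\<omega>. g (x, \<omega>) * indicator {v. \<bar>v\<bar> > real K} (g (x, \<omega>)))) \<partial>cell) < ennreal \<epsilon>"
    unfolding eventually_sequentially by blast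
  define gt where "gt z = g z * indicator {v. \<bar>v\<bar> > real K} (g z)" for z
  define gb where "gb z = g z * indicator {v. \<bar>v\<bar> \<le> real K} (g z)" for z
  have gt[measurable]: "gt \<in> borel_measurable CM" and gb[measurable]: "gb \<in> borel_measurable CM"
    unfolding gt_def gb_def by measurable
  have split: "g z = gb z + gt z" for z unfolding gb_def gt_def by (auto simp: indicator_def)
  have gtle: "\<bar>gt z\<bar> powr q \<le> \<bar>g z\<bar> powr q" for z
    using q1 by (intro powr_mono2) (auto simp: gt_def indicator_def)
  have gtq: "AE x in cell. Lp_finite M q (\<lambda>\<omega>. gt (x, \<omega>))"
    using gq
  proof eventually_elim
    case (elim x)
    have "(\<integral>\<^sup>+\<omega>. ennreal (\<bar>gt (x, \<omega>)\<bar> powr q) \<partial>M) \<le> (\<integral>\<^sup>+\<omega>. ennreal (\<bar>g (x, \<omega>)\<bar> powr q) \<partial>M)"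
      by (intro nn_integral_mono ennreal_leI gtle)
    then show ?case using elim unfolding Lp_finite_def by (rule le_less_trans)
  qed
  have appr: "\<bar>(\<integral>z. u z * g z \<partial>CM) - (\<integral>z. u z * gb z \<partial>CM)\<bar> \<le> \<epsilon>" if u: "Lp_ball p u" for u
  proof -
    have ig: "integrable CM (\<lambda>z. u z * g z)"
      by (rule Lp_ball_integrable_mult[OF p q u gm gq g1])
    have le: "(\<integral>\<^sup>+z. ennreal \<bar>u z * gt z\<bar> \<partial>CM) \<le> ennreal \<epsilon>"
      using nn_integral_Holder_cell[OF p q u gt gtq] K unfolding gt_def by (auto intro: order.trans less_imp_le)
    have [measurable]: "u \<in> borel_measurable CM" using u unfolding Lp_ball_def by blast
    have it: "integrable CM (\<lambda>z. u z * gt z)"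
      by (rule integrableI_bounded) (measurable, use le_less_trans[OF le] in simp)
    have ib: "integrable CM (\<lambda>z. u z * gb z)"
      using Bochner_Integration.integrable_diff[OF ig it] by (simp add: split algebra_simps)
    have "(\<integral>z. u z * g z \<partial>CM) - (\<integral>z. u z * gb z \<partial>CM) = (\<integral>z. u z * gt z \<partial>CM)"
      unfolding split distrib_left using ib it by simp
    also have "\<bar>\<dots>\<bar> \<le> (\<integral>z. \<bar>u z * gt z\<bar> \<partial>CM)" by (rule integral_abs_bound)
    also have "\<dots> \<le> \<epsilon>"
      using le nn_integral_eq_integral[OF integrable_abs[OF it]] \<epsilon> by simp
    finally show ?thesis .
  qed
  show "\<exists>y m. y \<longlonglongrightarrow> m \<and> (\<forall>\<^sub>F n in sequentially. \<bar>(\<integral>z. f n z * g z \<partial>CM) - y n\<bar> \<le> \<epsilon>) \<and>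
      \<bar>m - (\<integral>z. f0 z * g z \<partial>CM)\<bar> \<le> \<epsilon>"
  proof (intro exI conjI always_eventually allI)
    show "(\<lambda>n. \<integral>z. f n z * gb z \<partial>CM) \<longlonglongrightarrow> (\<integral>z. f0 z * gb z \<partial>CM)"
      by (rule lim[OF gb, of "real K"]) (auto simp: gb_def indicator_def)
    show "\<bar>(\<integral>z. f n z * g z \<partial>CM) - (\<integral>z. f n z * gb z \<partial>CM)\<bar> \<le> \<epsilon>" for n by (rule appr[OF f])
    show "\<bar>(\<integral>z. f0 z * gb z \<partial>CM) - (\<integral>z. f0 z * g z \<partial>CM)\<bar> \<le> \<epsilon>"
      using appr[OF f0] by (simp add: abs_minus_commute)
  qed
qed

text \<open>The functions \<open>f n\<close> need not lie in the ball, but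
  \<open>f n / (4 * L)\<close> does by \<open>Lp_ball_scale\<close>; convergence is transported
  through this scaling and back.\<close>

lemma dominated_tendsto_integral:
  assumes p: "p > 1" and q: "q = p / (p - 1)" and u: "\<And>n. Lp_ball p (u n)" and u0: "Lp_ball p u0" and L: "L > 0"
    and fm: "\<And>n. f n \<in> borel_measurable CM" and f0m: "f0 \<in> borel_measurable CM"
    and fb: "\<And>n. AE z in CM. \<bar>f n z\<bar> \<le> L * (1 + \<bar>u n z\<bar>)"
    and f0b: "AE z in CM. \<bar>f0 z\<bar> \<le> L * (1 + \<bar>u0 z\<bar>)"
    and lim: "\<And>h C. h \<in> borel_measurable CM \<Longrightarrow> AE z in CM. \<bar>h z\<bar> \<le> C \<Longrightarrow>
      (\<lambda>n. \<integral>z. f n z * h z \<partial>CM) \<longlonglongrightarrow> (\<integral>z. f0 z * h z \<partial>CM)"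
    and gm: "g \<in> borel_measurable CM" and gq: "AE x in cell. Lp_finite M q (\<lambda>\<omega>. g (x, \<omega>))"
    and g1: "(\<integral>\<^sup>+x. ennreal (Lp_norm M q (\<lambda>\<omega>. g (x, \<omega>))) \<partial>cell) < \<infinity>"
  shows "(\<lambda>n. \<integral>z. f n z * g z \<partial>CM) \<longlonglongrightarrow> (\<integral>z. f0 z * g z \<partial>CM)"
    and "integrable CM (\<lambda>z. f n z * g z)" and "integrable CM (\<lambda>z. f0 z * g z)"
proof -
  have B: "Lp_ball p (\<lambda>z. f n z / (4 * L))" for n by (rule Lp_ball_scale[OF u p L fm fb])
  have B0: "Lp_ball p (\<lambda>z. f0 z / (4 * L))" by (rule Lp_ball_scale[OF u0 p L f0m f0b])
  have eq: "(\<integral>z. v z / (4 * L) * h z \<partial>CM) = (\<integral>z. v z * h z \<partial>CM) / (4 * L)" for v h :: "real \<times> 'a \<Rightarrow> real"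
    by simp
  have "(\<lambda>n. \<integral>z. f n z / (4 * L) * g z \<partial>CM) \<longlonglongrightarrow> (\<integral>z. f0 z / (4 * L) * g z \<partial>CM)"
  proof (rule Lp_ball_tendsto_integral[OF p q B B0 _ gm gq g1])
    fix h :: "real \<times> 'a \<Rightarrow> real" and C assume h: "h \<in> borel_measurable CM" "AE z in CM. \<bar>h z\<bar> \<le> C"
    show "(\<lambda>n. \<integral>z. f n z / (4 * L) * h z \<partial>CM) \<longlonglongrightarrow> (\<integral>z. f0 z / (4 * L) * h z \<partial>CM)"
      unfolding eq using L by (intro tendsto_divide lim[OF h] tendsto_const) auto
  qed
  then have "(\<lambda>n. (\<integral>z. f n z * g z \<partial>CM) / (4 * L) * (4 * L)) \<longlonglongrightarrow> (\<integral>z. f0 z * g z \<partial>CM) / (4 * L) * (4 * L)"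
    unfolding eq by (intro tendsto_mult tendsto_const)
  then show "(\<lambda>n. \<integral>z. f n z * g z \<partial>CM) \<longlonglongrightarrow> (\<integral>z. f0 z * g z \<partial>CM)"
    using L by simp
  show "integrable CM (\<lambda>z. f n z * g z)"
    using integrable_mult_right[OF Lp_ball_integrable_mult[OF p q B gm gq g1], of "4 * L" n] L by simp
  show "integrable CM (\<lambda>z. f0 z * g z)"
    using integrable_mult_right[OF Lp_ball_integrable_mult[OF p q B0 gm gq g1], of "4 * L"] L by simp
qed

section \<open>Normalisation of the perturbation\<close>

lemma Linf_Lp_norm_bounded_field:
  assumes p: "p > 1" and bm: "(\<lambda>z. b (fst z) (snd z)) \<in> borel_measurable CM"
    and bb: "AE z in CM. \<bar>b (fst z) (snd z)\<bar> \<le> Mb"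
  defines "m \<equiv> real_of_ereal (Linf_Lp_norm M p b)"
  shows "m \<ge> 0" and "AE x in cell. (\<integral>\<^sup>+\<omega>. ennreal (\<bar>b x \<omega>\<bar> powr p) \<partial>M) \<le> ennreal (m powr p)"
proof -
  have p0: "p > 0" using p by simp
  have AEb: "AE x in cell. AE \<omega> in M. \<bar>b x \<omega>\<bar> \<le> Mb" using P.AE_pair[OF bb] by simp
  have nb: "AE x in cell. (\<integral>\<^sup>+\<omega>. ennreal (\<bar>b x \<omega>\<bar> powr p) \<partial>M) \<le> ennreal (\<bar>Mb\<bar> powr p)"
    using AEb
  proof eventually_elim
    case (elim x)
    have "(\<integral>\<^sup>+\<omega>. ennreal (\<bar>b x \<omega>\<bar> powr p) \<partial>M) \<le> (\<integral>\<^sup>+\<omega>. ennreal (\<bar>Mb\<bar> powr p) \<partial>M)"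
    proof (rule nn_integral_mono_AE)
      show "AE \<omega> in M. ennreal (\<bar>b x \<omega>\<bar> powr p) \<le> ennreal (\<bar>Mb\<bar> powr p)"
        using elim by eventually_elim (use p0 in \<open>auto intro!: ennreal_leI powr_mono2\<close>)
    qed
    then show ?case by (simp add: M.emeasure_space_1)
  qed
  have fin: "AE x in cell. Lp_finite M p (b x)"
    using nb unfolding Lp_finite_def by eventually_elim (erule le_less_trans, simp)
  have Nle: "AE x in cell. Lp_norm M p (b x) \<le> \<bar>Mb\<bar>"
    using nb
  proof eventually_elim
    case (elim x)
    have "enn2real (\<integral>\<^sup>+\<omega>. ennreal (\<bar>b x \<omega>\<bar> powr p) \<partial>M) \<le> \<bar>Mb\<bar> powr p"
      using enn2real_mono[OF elim] by simp
    then have "Lp_norm M p (b x) \<le> (\<bar>Mb\<bar> powr p) powr (1 / p)"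
      unfolding Lp_norm_def using p0 by (intro powr_mono2) auto
    then show ?case using p0 by (simp add: powr_powr)
  qed
  have meas: "(\<lambda>x. ereal (Lp_norm M p (b x))) \<in> borel_measurable cell"
    using Lp_norm_measurable[OF bm] by simp
  define E where "E = esssup cell (\<lambda>x. ereal (Lp_norm M p (b x)))"
  have LE: "Linf_Lp_norm M p b = E" unfolding Linf_Lp_norm_def E_def using fin by simp
  have Eup: "E \<le> ereal \<bar>Mb\<bar>" unfolding E_def using meas Nle by (intro esssup_I) auto
  have AEE: "AE x in cell. ereal (Lp_norm M p (b x)) \<le> E" unfolding E_def by (rule esssup_AE)
  have Elow: "0 \<le> E"
  proof -
    have "AE x in cell. 0 \<le> E" using AEE by eventually_elim (rule order.trans[rotated], auto simp: Lp_norm_nonneg)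
    then show ?thesis by simp
  qed
  \<comment> \<open>E lies between 0 and |Mb|, so \<open>real_of_ereal\<close>, which sends infinite
    values to 0, loses nothing.\<close>
  have Em: "E = ereal m" unfolding m_def LE using Eup Elow by (cases E) auto
  show "m \<ge> 0" using Elow Em by simp
  show "AE x in cell. (\<integral>\<^sup>+\<omega>. ennreal (\<bar>b x \<omega>\<bar> powr p) \<partial>M) \<le> ennreal (m powr p)"
    using AEE fin
  proof eventually_elim
    case (elim x)
    define S where "S = (\<integral>\<^sup>+\<omega>. ennreal (\<bar>b x \<omega>\<bar> powr p) \<partial>M)"
    have S: "S = ennreal (enn2real S)" using elim(2) unfolding S_def Lp_finite_def by simp
    have "enn2real S powr (1 / p) \<le> m" using elim(1) unfolding Em Lp_norm_def S_def by simp
    then have "(enn2real S powr (1 / p)) powr p \<le> m powr p" using p0 by (intro powr_mono2) auto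
    then have "enn2real S \<le> m powr p" using p0 by (simp add: powr_powr)
    then have "ennreal (enn2real S) \<le> ennreal (m powr p)" by (rule ennreal_leI)
    then show ?case using S unfolding S_def by simp
  qed
qed

text \<open>For m = 0 the quotient is 0 by the convention for division, and b vanishes almost
  everywhere because its fibre integrals do; both claims survive in this case.\<close>

lemma Lp_ball_normalised:
  assumes p: "p > 1" and bm: "(\<lambda>z. b (fst z) (snd z)) \<in> borel_measurable CM"
    and bb: "AE z in CM. \<bar>b (fst z) (snd z)\<bar> \<le> Mb"
  defines "m \<equiv> real_of_ereal (Linf_Lp_norm M p b)"
  shows "Lp_ball p (\<lambda>z. b (fst z) (snd z) / m)"
    and "AE z in CM. b (fst z) (snd z) = m * (b (fst z) (snd z) / m)"
proof -
  note [measurable] = bm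
  have m: "m \<ge> 0" and nb: "AE x in cell. (\<integral>\<^sup>+\<omega>. ennreal (\<bar>b x \<omega>\<bar> powr p) \<partial>M) \<le> ennreal (m powr p)"
    using Linf_Lp_norm_bounded_field[OF p bm bb] unfolding m_def by auto
  have "AE x in cell. (\<integral>\<^sup>+\<omega>. ennreal (\<bar>b x \<omega> / m\<bar> powr p) \<partial>M) \<le> 1"
  proof (cases "m = 0")
    case False
    show ?thesis using nb AE_space
    proof eventually_elim
      case (elim x)
      note [measurable] = elim(2)
      have [measurable]: "b x \<in> borel_measurable M"
        using measurable_compose[OF measurable_Pair1'[OF elim(2)] bm] by simp
      have "(\<integral>\<^sup>+\<omega>. ennreal (\<bar>b x \<omega> / m\<bar> powr p) \<partial>M) = (\<integral>\<^sup>+\<omega>. ennreal (1 / m powr p) * ennreal (\<bar>b x \<omega>\<bar> powr p) \<partial>M)"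
        using m by (intro nn_integral_cong) (simp add: powr_divide ennreal_mult[symmetric])
      also have "\<dots> = ennreal (1 / m powr p) * (\<integral>\<^sup>+\<omega>. ennreal (\<bar>b x \<omega>\<bar> powr p) \<partial>M)"
        by (rule nn_integral_cmult) measurable
      also have "\<dots> \<le> ennreal (1 / m powr p) * ennreal (m powr p)" using elim(1) by (rule mult_left_mono) simp
      also have "\<dots> = ennreal (1 / m powr p * m powr p)" by (rule ennreal_mult[symmetric]) auto
      also have "\<dots> = 1" using False m by simp
      finally show ?case .
    qed
  qed (use p in simp)
  then show "Lp_ball p (\<lambda>z. b (fst z) (snd z) / m)" unfolding Lp_ball_def by simp
  show "AE z in CM. b (fst z) (snd z) = m * (b (fst z) (snd z) / m)"
  proof (cases "m = 0")
    case True
    have "(\<integral>\<^sup>+z. ennreal (\<bar>b (fst z) (snd z)\<bar> powr p) \<partial>CM) =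
        (\<integral>\<^sup>+x. \<integral>\<^sup>+\<omega>. ennreal (\<bar>b (fst (x, \<omega>)) (snd (x, \<omega>))\<bar> powr p) \<partial>M \<partial>cell)"
      by (rule M.nn_integral_fst[symmetric]) measurable
    also have "\<dots> = (\<integral>\<^sup>+x. 0 \<partial>cell)"
    proof (rule nn_integral_cong_AE)
      show "AE x in cell. (\<integral>\<^sup>+\<omega>. ennreal (\<bar>b (fst (x, \<omega>)) (snd (x, \<omega>))\<bar> powr p) \<partial>M) = 0"
        using nb by eventually_elim (simp add: True)
    qed
    finally have "(\<integral>\<^sup>+z. ennreal (\<bar>b (fst z) (snd z)\<bar> powr p) \<partial>CM) = 0" by simp
    then have "AE z in CM. ennreal (\<bar>b (fst z) (snd z)\<bar> powr p) = 0"
      by (subst (asm) nn_integral_0_iff_AE) auto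
    then show ?thesis by eventually_elim (use p True in auto)
  qed simp
qed

lemma Linf_Lp_norm_finite:
  assumes p: "p > 1" and f: "Lp_ball p (\<lambda>z. b (fst z) (snd z))"
  shows "Linf_Lp_norm M p b < \<infinity>"
proof -
  have bm: "(\<lambda>z. b (fst z) (snd z)) \<in> borel_measurable CM"
    and nb: "AE x in cell. (\<integral>\<^sup>+\<omega>. ennreal (\<bar>b x \<omega>\<bar> powr p) \<partial>M) \<le> 1"
    using f unfolding Lp_ball_def by auto
  have fin: "AE x in cell. Lp_finite M p (b x)"
    using nb unfolding Lp_finite_def by eventually_elim (erule le_less_trans, simp)
  have Nle: "AE x in cell. Lp_norm M p (b x) \<le> 1"
    using nb
  proof eventually_elim
    case (elim x)
    have "enn2real (\<integral>\<^sup>+\<omega>. ennreal (\<bar>b x \<omega>\<bar> powr p) \<partial>M) \<le> 1"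
      using enn2real_mono[OF elim] by simp
    then show ?case unfolding Lp_norm_def using p by (intro powr_le1) auto
  qed
  have meas: "(\<lambda>x. ereal (Lp_norm M p (b x))) \<in> borel_measurable cell"
    using Lp_norm_measurable[OF bm] by simp
  have "esssup cell (\<lambda>x. ereal (Lp_norm M p (b x))) \<le> 1"
    using meas Nle by (intro esssup_I) (auto simp: one_ereal_def)
  then show ?thesis unfolding Linf_Lp_norm_def using fin by (auto intro: le_less_trans)
qed

text \<open>Translate x back into the cell by \<open>\<lfloor>x + 1/2\<rfloor>\<close> and act on
  \<omega> by the same integer. In this way a weak limit known only on the cell becomes a stationary
  field on the line.\<close>

lemma stationary_extension:
  assumes g: "g \<in> borel_measurable CM"
  shows "\<exists>G. field_measurable M G \<and> stationary M \<tau> G \<and> (AE z in CM. G (fst z) (snd z) = g z)"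
proof -
  define fr where "fr x = x - real_of_int \<lfloor>x + 1/2\<rfloor>" for x :: real
  define G where "G x \<omega> = g (fr x, \<tau> \<lfloor>x + 1/2\<rfloor> \<omega>)" for x \<omega>
  have frc: "fr x \<in> {-1/2..1/2}" for x unfolding fr_def by auto linarith+
  have frm[measurable]: "fr \<in> lborel \<rightarrow>\<^sub>M cell"
    unfolding cell_def by (rule measurable_restrict_space2) (use frc in \<open>auto simp: fr_def[abs_def]\<close>)
  have "field_measurable M G"
    unfolding field_measurable_def G_def
  \<comment> \<open>The integer part takes countably many values, so measurability may be checked
    with it frozen to k.\<close>
  proof (rule measurable_compose_countable[where g="\<lambda>z. \<lfloor>fst z + (1/2 :: real)\<rfloor>" and f="\<lambda>k z. g (fr (fst z), \<tau> k (snd z))"])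
    show "(\<lambda>z. \<lfloor>fst z + (1/2 :: real)\<rfloor>) \<in> lborel \<Otimes>\<^sub>M M \<rightarrow>\<^sub>M count_space UNIV" by measurable
    fix k
    have "(\<lambda>z. (fr (fst z), \<tau> k (snd z))) \<in> lborel \<Otimes>\<^sub>M M \<rightarrow>\<^sub>M CM"
      by (intro measurable_Pair measurable_compose[OF measurable_fst frm] measurable_compose[OF measurable_snd tau_measurable])
    then show "(\<lambda>z. g (fr (fst z), \<tau> k (snd z))) \<in> borel_measurable (lborel \<Otimes>\<^sub>M M)"
      by (rule measurable_compose[OF _ g])
  qed
  moreover have "stationary M \<tau> G"
    unfolding stationary_def
  proof (intro allI ballI)
    fix k x \<omega> assume w: "\<omega> \<in> space M"
    have fl: "\<lfloor>x + real_of_int k + 1/2\<rfloor> = \<lfloor>x + 1/2\<rfloor> + k" by linarith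
    show "G (x + real_of_int k) \<omega> = G x (\<tau> k \<omega>)"
      unfolding G_def fr_def fl using tau_add[OF w] by simp
  qed
  moreover have "AE z in CM. G (fst z) (snd z) = g z"
  proof -
    \<comment> \<open>At the right end of the closed cell the shift is 1 instead of 0, so agreement
      with \<open>g\<close> is claimed off this null set.\<close>
    have "AE x in cell. x \<noteq> 1/2" by (rule AE_cellI[OF AE_lborel_singleton])
    then have "AE x in cell. AE \<omega> in M. G x \<omega> = g (x, \<omega>)"
      using AE_space
    proof eventually_elim
      case (elim x)
      have "\<lfloor>x + 1/2\<rfloor> = 0" using elim unfolding space_cell by (auto simp: floor_eq_iff)
      then show ?case using tau_zero by (intro AE_I2) (simp add: G_def fr_def)
    qed
    then show ?thesis
    proof (intro P.AE_pair_measure)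
      show "{z \<in> space CM. G (fst z) (snd z) = g z} \<in> sets CM"
        using field_measurable_cell[OF \<open>field_measurable M G\<close>] g by measurable
    qed simp
  qed
  ultimately show ?thesis by blast
qed

end

section \<open>Expansion of the flux\<close>

lemma abs_divide_le:
  fixes x y :: real
  assumes "\<bar>x\<bar> \<le> X" "0 < \<delta>" "\<delta> \<le> y"
  shows "\<bar>x / y\<bar> \<le> X / \<delta>"
proof -
  have "\<bar>x\<bar> / \<bar>y\<bar> \<le> X / \<delta>" using assms by (intro frac_le) auto
  then show ?thesis by simp
qed

text \<open>The perturbation is tied to its normalisation \<open>u n\<close> by \<open>b n = m n * u n\<close> rather than by
  \<open>u n = b n / m n\<close>, so that \<open>m n = 0\<close> (where the quotient has the junk value \<open>0\<close>) is allowed.\<close>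

locale coefficient_perturbation = prob_space M for M :: "'b measure" +
  fixes A c :: "'b \<Rightarrow> real" and b u :: "nat \<Rightarrow> 'b \<Rightarrow> real" and u0 :: "'b \<Rightarrow> real"
    and m :: "nat \<Rightarrow> real" and \<alpha> \<beta> \<gamma> Mb p :: real and C :: "nat \<Rightarrow> real" and C0 :: real
  assumes A_meas [measurable]: "A \<in> borel_measurable M" and c_meas [measurable]: "c \<in> borel_measurable M"
    and u_meas [measurable]: "\<And>n. u n \<in> borel_measurable M" and b_meas [measurable]: "\<And>n. b n \<in> borel_measurable M"
    and u0_int: "integrable M u0"
    and alpha: "0 < \<alpha>" and p: "p > 1"
    and A_bound: "AE z in M. \<alpha> \<le> A z \<and> A z \<le> \<beta>"
    and a_bound: "\<And>n. AE z in M. \<alpha> \<le> A z + b n z * c z \<and> A z + b n z * c z \<le> \<beta>"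
    and c_bound: "AE z in M. \<bar>c z\<bar> \<le> \<gamma>"
    and b_bound: "\<And>n. AE z in M. \<bar>b n z\<bar> \<le> Mb"
    and b_eq: "\<And>n. AE z in M. b n z = m n * u n z"
    and m_nonneg: "\<And>n. m n \<ge> 0" and m_lim: "m \<longlonglongrightarrow> 0"
    and u_int: "\<And>n. integrable M (\<lambda>z. \<bar>u n z\<bar> powr p)" and u_le: "\<And>n. (\<integral>z. \<bar>u n z\<bar> powr p \<partial>M) \<le> 1"
    and u_lim: "\<And>h B. h \<in> borel_measurable M \<Longrightarrow> AE z in M. \<bar>h z\<bar> \<le> B \<Longrightarrow>
      (\<lambda>n. \<integral>z. u n z * h z \<partial>M) \<longlonglongrightarrow> (\<integral>z. u0 z * h z \<partial>M)"
    and C: "\<And>n. C n * (\<integral>z. 1 / (A z + b n z * c z) \<partial>M) = 1"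
    and C0: "C0 * (\<integral>z. 1 / A z \<partial>M) = 1"
begin

section \<open>Coefficient bounds and the quadratic remainder\<close>

definition coeff :: "nat \<Rightarrow> 'b \<Rightarrow> real" where "coeff n z = A z + b n z * c z"

lemma coeff_meas [measurable]: "coeff n \<in> borel_measurable M"
  unfolding coeff_def by measurable

lemma coeff_bound: "AE z in M. \<alpha> \<le> coeff n z \<and> coeff n z \<le> \<beta>"
  unfolding coeff_def by (rule a_bound)

lemma u0_meas [measurable]: "u0 \<in> borel_measurable M"
  by (rule borel_measurable_integrable[OF u0_int])

lemma beta_bounds: "\<alpha> \<le> \<beta>" "0 < \<beta>"
proof -
  have "AE z in M. \<alpha> \<le> \<beta>" using A_bound by eventually_elim simp
  then show "\<alpha> \<le> \<beta>" by simp
  then show "0 < \<beta>" using alpha by simp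
qed

lemma gamma_nonneg: "0 \<le> \<gamma>" and Mb_nonneg: "0 \<le> Mb"
proof -
  have "AE z in M. 0 \<le> \<gamma>" using c_bound by eventually_elim simp
  then show "0 \<le> \<gamma>" by simp
  have "AE z in M. 0 \<le> Mb" using b_bound[of 0] by eventually_elim simp
  then show "0 \<le> Mb" by simp
qed

lemma u_integrable: "integrable M (u n)"
  by (rule integrable_if_powr[OF u_meas u_int less_imp_le[OF p]])

lemma integrable_AE_bounded_mult:
  fixes f g :: "'b \<Rightarrow> real"
  assumes f: "integrable M f" and g: "g \<in> borel_measurable M" "AE z in M. \<bar>g z\<bar> \<le> B"
  shows "integrable M (\<lambda>z. f z * g z)"
proof (rule Bochner_Integration.integrable_bound)
  show "integrable M (\<lambda>z. B * \<bar>f z\<bar>)" using f by simp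
  show "AE z in M. norm (f z * g z) \<le> norm (B * \<bar>f z\<bar>)"
    using g(2)
  proof eventually_elim
    case (elim z)
    then have "\<bar>f z\<bar> * \<bar>g z\<bar> \<le> \<bar>f z\<bar> * \<bar>B\<bar>" by (intro mult_left_mono) auto
    then show ?case by (simp add: abs_mult mult.commute)
  qed
qed (use borel_measurable_integrable[OF f] g(1) in measurable)

lemma integral_abs_AE_bounded_mult:
  fixes f g :: "'b \<Rightarrow> real"
  assumes f: "integrable M f" and g: "g \<in> borel_measurable M" "AE z in M. \<bar>g z\<bar> \<le> B"
  shows "\<bar>\<integral>z. f z * g z \<partial>M\<bar> \<le> B * (\<integral>z. \<bar>f z\<bar> \<partial>M)"
proof -
  have "\<bar>\<integral>z. f z * g z \<partial>M\<bar> \<le> (\<integral>z. \<bar>f z * g z\<bar> \<partial>M)" by (rule integral_abs_bound)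
  also have "\<dots> \<le> (\<integral>z. B * \<bar>f z\<bar> \<partial>M)"
  proof (rule integral_mono_AE)
    show "AE z in M. \<bar>f z * g z\<bar> \<le> B * \<bar>f z\<bar>"
      using g(2)
    proof eventually_elim
      case (elim z)
      then have "\<bar>f z\<bar> * \<bar>g z\<bar> \<le> \<bar>f z\<bar> * B" by (intro mult_left_mono) auto
      then show ?case by (simp only: abs_mult mult.commute)
    qed
  qed (use integrable_AE_bounded_mult[OF f g] f in auto)
  finally show ?thesis by simp
qed

text \<open>The product is m u^2, which an L^p bound with p < 2 does not control. Where |u| \<le> K
  one factor is at most K and m tends to 0; elsewhere the bound on \<open>b\<close> replaces one
  factor of u together with m, and the tail of |u| costs K^(1-p). Hence the bound 2 K m + Mb
  K^(1-p), with K chosen before n.\<close>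

lemma remainder_tendsto_0: "(\<lambda>n. \<integral>z. \<bar>u n z * b n z\<bar> \<partial>M) \<longlonglongrightarrow> 0"
proof (rule tendsto_uniform_approx)
  fix \<epsilon> :: real assume e: "\<epsilon> > 0"
  have "(\<lambda>K. Mb * real K powr (1 - p)) \<longlonglongrightarrow> Mb * 0"
    by (intro tendsto_mult tendsto_const powr_tail_tendsto_0 p)
  then have "\<forall>\<^sub>F K in sequentially. Mb * real K powr (1 - p) < \<epsilon> / 2" using e by (intro order_tendstoD(2)) auto
  then obtain K0 where K0: "\<And>K. K \<ge> K0 \<Longrightarrow> Mb * real K powr (1 - p) < \<epsilon> / 2"
    unfolding eventually_sequentially by blast
  define K where "K = max K0 1"
  have K: "Mb * real K powr (1 - p) < \<epsilon> / 2" "K \<ge> 1" using K0[of K] by (simp_all add: K_def)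
  have "(\<lambda>n. 2 * real K * m n) \<longlonglongrightarrow> 2 * real K * 0" by (intro tendsto_mult tendsto_const m_lim)
  then have ev: "\<forall>\<^sub>F n in sequentially. 2 * real K * m n < \<epsilon> / 2" using e by (intro order_tendstoD(2)) auto
  have le: "(\<integral>z. \<bar>u n z * b n z\<bar> \<partial>M) \<le> 2 * real K * m n + Mb * real K powr (1 - p)" for n
  proof -
    have "(\<integral>z. \<bar>u n z * b n z\<bar> \<partial>M) \<le>
        (\<integral>z. real K * m n * (1 + \<bar>u n z\<bar> powr p) + Mb * real K powr (1 - p) * \<bar>u n z\<bar> powr p \<partial>M)"
    proof (rule integral_mono_AE)
      show "integrable M (\<lambda>z. \<bar>u n z * b n z\<bar>)"
        by (intro integrable_abs integrable_AE_bounded_mult[OF u_integrable b_meas b_bound])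
      show "AE z in M. \<bar>u n z * b n z\<bar> \<le>
          real K * m n * (1 + \<bar>u n z\<bar> powr p) + Mb * real K powr (1 - p) * \<bar>u n z\<bar> powr p"
        using b_eq[of n] b_bound[of n]
      proof eventually_elim
        case (elim z)
        show ?case
        proof (cases "\<bar>u n z\<bar> \<le> real K")
          case True
          have "\<bar>u n z * b n z\<bar> = \<bar>u n z\<bar> * m n * \<bar>u n z\<bar>" using elim(1) m_nonneg[of n] by (simp add: abs_mult)
          also have "\<dots> \<le> real K * m n * (1 + \<bar>u n z\<bar> powr p)"
            using True m_nonneg[of n] p by (intro mult_mono abs_le_one_plus_powr) auto
          finally show ?thesis using Mb_nonneg by (simp add: add_increasing2)
        next
          case False
          have "\<bar>u n z * b n z\<bar> \<le> (real K powr (1 - p) * \<bar>u n z\<bar> powr p) * Mb"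
            unfolding abs_mult using False elim(2) p K(2) by (intro mult_mono tail_le_powr) auto
          moreover have "0 \<le> real K * m n * (1 + \<bar>u n z\<bar> powr p)" using m_nonneg[of n] by simp
          ultimately show ?thesis by (simp add: mult.commute mult.left_commute)
        qed
      qed
    qed (use u_int[of n] in auto)
    also have "\<dots> = real K * m n * (1 + (\<integral>z. \<bar>u n z\<bar> powr p \<partial>M)) + Mb * real K powr (1 - p) * (\<integral>z. \<bar>u n z\<bar> powr p \<partial>M)"
      using u_int[of n] by (simp add: prob_space)
    also have "\<dots> \<le> real K * m n * (1 + 1) + Mb * real K powr (1 - p) * 1"
      using u_le[of n] m_nonneg[of n] Mb_nonneg by (intro add_mono mult_left_mono) auto
    finally show ?thesis by simp
  qed
  show "\<exists>y l. y \<longlonglongrightarrow> l \<and> (\<forall>\<^sub>F n in sequentially. \<bar>(\<integral>z. \<bar>u n z * b n z\<bar> \<partial>M) - y n\<bar> \<le> \<epsilon>) \<and> \<bar>l - 0\<bar> \<le> \<epsilon>"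
  proof (intro exI conjI)
    show "(\<lambda>_. 0 :: real) \<longlonglongrightarrow> 0" by simp
    show "\<forall>\<^sub>F n in sequentially. \<bar>(\<integral>z. \<bar>u n z * b n z\<bar> \<partial>M) - 0\<bar> \<le> \<epsilon>"
      using ev
    proof eventually_elim
      case (elim n)
      have "(\<integral>z. \<bar>u n z * b n z\<bar> \<partial>M) \<ge> 0" by simp
      then show ?case using elim le[of n] K(1) by linarith
    qed
  qed (use e in simp)
qed

text \<open>With a the perturbed coefficient, 1/(A a) = 1/A^2 - b c/(A^2 a). The first term gives a
  fixed bounded test function for \<open>u n\<close>, the second a bounded multiple of the vanishing
  remainder. The weight \<open>h\<close> is 1 for the flux constant and arbitrary for the
  correctors.\<close>

lemma flux_tendsto:
  assumes h: "h \<in> borel_measurable M" "AE z in M. \<bar>h z\<bar> \<le> B"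
  shows "(\<lambda>n. \<integral>z. u n z * (h z * c z / (A z * coeff n z)) \<partial>M) \<longlonglongrightarrow> (\<integral>z. u0 z * (h z * c z / (A z * A z)) \<partial>M)"
proof -
  note [measurable] = h(1)
  define g where "g n z = h z * c z * c z / (A z * A z * coeff n z)" for n z
  define G where "G = B * \<gamma> * \<gamma> / (\<alpha> * \<alpha> * \<alpha>)"
  define f where "f z = h z * c z / (A z * A z)" for z
  have [measurable]: "g n \<in> borel_measurable M" "f \<in> borel_measurable M" for n unfolding g_def f_def by measurable
  have gb: "AE z in M. \<bar>g n z\<bar> \<le> G" for n
    using h(2) c_bound A_bound coeff_bound[of n] unfolding g_def G_def
  proof eventually_elim
    case (elim z)
    show ?case
      unfolding times_divide_eq_right
      using elim alpha gamma_nonneg by (intro abs_divide_le) (auto simp: abs_mult intro!: mult_mono)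
  qed
  have fb: "AE z in M. \<bar>f z\<bar> \<le> B * \<gamma> / (\<alpha> * \<alpha>)"
    using h(2) c_bound A_bound unfolding f_def
  proof eventually_elim
    case (elim z)
    show ?case
      using elim alpha gamma_nonneg by (intro abs_divide_le) (auto simp: abs_mult intro!: mult_mono)
  qed
  have ubi: "integrable M (\<lambda>z. u n z * b n z)" for n
    by (rule integrable_AE_bounded_mult[OF u_integrable b_meas b_bound])
  have ufi: "integrable M (\<lambda>z. u n z * f z)" for n
    by (rule integrable_AE_bounded_mult[OF u_integrable _ fb]) measurable
  have ubgi: "integrable M (\<lambda>z. (u n z * b n z) * g n z)" for n
    by (rule integrable_AE_bounded_mult[OF ubi _ gb]) measurable
  have eq: "(\<integral>z. u n z * (h z * c z / (A z * coeff n z)) \<partial>M) = (\<integral>z. u n z * f z \<partial>M) - (\<integral>z. (u n z * b n z) * g n z \<partial>M)" for n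
  proof -
    have "(\<integral>z. u n z * (h z * c z / (A z * coeff n z)) \<partial>M) = (\<integral>z. u n z * f z - (u n z * b n z) * g n z \<partial>M)"
    proof (rule integral_cong_AE)
      show "AE z in M. u n z * (h z * c z / (A z * coeff n z)) = u n z * f z - (u n z * b n z) * g n z"
        using A_bound coeff_bound[of n]
      proof eventually_elim
        case (elim z)
        then have nz: "A z \<noteq> 0" "coeff n z \<noteq> 0" using alpha by auto
        have "u n z * f z - (u n z * b n z) * g n z = u n z * (h z * c z) * ((coeff n z - b n z * c z) / (A z * A z * coeff n z))"
          unfolding f_def g_def using nz by (simp add: field_simps)
        also have "coeff n z - b n z * c z = A z" by (simp add: coeff_def)
        also have "u n z * (h z * c z) * (A z / (A z * A z * coeff n z)) = u n z * (h z * c z / (A z * coeff n z))"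
          using nz by (simp add: field_simps)
        finally show ?case by simp
      qed
    qed measurable
    then show ?thesis using ufi ubgi by simp
  qed
  have "(\<lambda>n. \<integral>z. (u n z * b n z) * g n z \<partial>M) \<longlonglongrightarrow> 0"
  proof (rule tendsto_0_le[where K=G, OF remainder_tendsto_0])
    have "\<bar>\<integral>z. (u n z * b n z) * g n z \<partial>M\<bar> \<le> G * (\<integral>z. \<bar>u n z * b n z\<bar> \<partial>M)" for n
      by (rule integral_abs_AE_bounded_mult[OF ubi _ gb]) measurable
    then show "\<forall>\<^sub>F n in sequentially. norm (\<integral>z. (u n z * b n z) * g n z \<partial>M) \<le> norm (\<integral>z. \<bar>u n z * b n z\<bar> \<partial>M) * G"
      by (intro always_eventually allI) (simp add: mult.commute)
  qed
  moreover have "(\<lambda>n. \<integral>z. u n z * f z \<partial>M) \<longlonglongrightarrow> (\<integral>z. u0 z * f z \<partial>M)"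
    by (rule u_lim[OF _ fb]) measurable
  ultimately show ?thesis unfolding eq using tendsto_diff by (fastforce simp: f_def)
qed

text \<open>\<open>m n * rate n\<close> is exactly the mean of 1/A minus the mean of
  \<open>1 / coeff n\<close>. Since the flux constant is a harmonic mean, its derivative is
  \<open>rate0\<close> times the square of \<open>C0\<close>.\<close>

definition rate :: "nat \<Rightarrow> real" where "rate n = (\<integral>z. u n z * (c z / (A z * coeff n z)) \<partial>M)"
definition rate0 :: real where "rate0 = (\<integral>z. u0 z * (c z / (A z * A z)) \<partial>M)"
definition flux_deriv :: real where "flux_deriv = rate0 * C0 * C0"

lemma rate_tendsto: "rate \<longlonglongrightarrow> rate0"
  using flux_tendsto[of "\<lambda>_. 1" 1] unfolding rate_def[abs_def] rate0_def by simp

lemma inverse_bounds: "AE z in M. 1 / \<beta> \<le> 1 / coeff n z \<and> \<bar>1 / coeff n z\<bar> \<le> 1 / \<alpha>" "AE z in M. 1 / \<beta> \<le> 1 / A z \<and> \<bar>1 / A z\<bar> \<le> 1 / \<alpha>"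
proof -
  show "AE z in M. 1 / \<beta> \<le> 1 / coeff n z \<and> \<bar>1 / coeff n z\<bar> \<le> 1 / \<alpha>"
    using coeff_bound[of n] by eventually_elim (use alpha in \<open>auto intro!: divide_left_mono frac_le\<close>)
  show "AE z in M. 1 / \<beta> \<le> 1 / A z \<and> \<bar>1 / A z\<bar> \<le> 1 / \<alpha>"
    using A_bound by eventually_elim (use alpha in \<open>auto intro!: divide_left_mono frac_le\<close>)
qed

lemma inverse_integrable: "integrable M (\<lambda>z. 1 / coeff n z)" "integrable M (\<lambda>z. 1 / A z)"
proof -
  show "integrable M (\<lambda>z. 1 / coeff n z)"
    by (rule integrable_const_bound[where B="1/\<alpha>"]) (use inverse_bounds(1)[of n] in \<open>auto elim: eventually_mono\<close>)
  show "integrable M (\<lambda>z. 1 / A z)"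
    by (rule integrable_const_bound[where B="1/\<alpha>"]) (use inverse_bounds(2) in \<open>auto elim: eventually_mono\<close>)
qed

lemma integral_inverse_ge: "1 / \<beta> \<le> (\<integral>z. 1 / coeff n z \<partial>M)" "1 / \<beta> \<le> (\<integral>z. 1 / A z \<partial>M)"
proof -
  have "(\<integral>z. 1 / \<beta> \<partial>M) \<le> (\<integral>z. 1 / coeff n z \<partial>M)"
    by (rule integral_mono_AE) (use inverse_integrable inverse_bounds(1)[of n] in \<open>auto elim: eventually_mono\<close>)
  then show "1 / \<beta> \<le> (\<integral>z. 1 / coeff n z \<partial>M)" by (simp add: prob_space)
  have "(\<integral>z. 1 / \<beta> \<partial>M) \<le> (\<integral>z. 1 / A z \<partial>M)"
    by (rule integral_mono_AE) (use inverse_integrable inverse_bounds(2) in \<open>auto elim: eventually_mono\<close>)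
  then show "1 / \<beta> \<le> (\<integral>z. 1 / A z \<partial>M)" by (simp add: prob_space)
qed

lemma C_bounds: "0 < C n" "C n \<le> \<beta>" "0 < C0" "C0 \<le> \<beta>"
proof -
  have *: "0 < k \<and> k \<le> \<beta>" if "k * r = 1" "1 / \<beta> \<le> r" for k r :: real
  proof -
    have r: "0 < r" using that(2) beta_bounds(2) by (meson less_le_trans zero_less_divide_1_iff)
    then have k: "k = 1 / r" using that(1) by (simp add: field_simps)
    have "1 / r \<le> \<beta>" using that(2) r beta_bounds(2) by (simp add: field_simps)
    then show ?thesis using k r by simp
  qed
  have "C n * (\<integral>z. 1 / coeff n z \<partial>M) = 1" unfolding coeff_def by (rule C)
  from *[OF this integral_inverse_ge(1)] *[OF C0 integral_inverse_ge(2)]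
  show "0 < C n" "C n \<le> \<beta>" "0 < C0" "C0 \<le> \<beta>" by auto
qed

text \<open>An identity rather than an expansion: multiply each constant by the other one's
  normalisation and subtract. It remains valid for m n = 0.\<close>

lemma C_diff: "C n - C0 = m n * (rate n * C n * C0)"
proof -
  have ci: "integrable M (\<lambda>z. u n z * (c z / (A z * coeff n z)))"
  proof (rule integrable_AE_bounded_mult[OF u_integrable])
    show "AE z in M. \<bar>c z / (A z * coeff n z)\<bar> \<le> \<gamma> / (\<alpha> * \<alpha>)"
      using c_bound A_bound coeff_bound[of n]
      by eventually_elim (use alpha in \<open>intro abs_divide_le; auto intro!: mult_mono\<close>)
  qed measurable
  have "(\<integral>z. 1 / A z \<partial>M) - (\<integral>z. 1 / coeff n z \<partial>M) = (\<integral>z. 1 / A z - 1 / coeff n z \<partial>M)"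
    using inverse_integrable by simp
  also have "\<dots> = (\<integral>z. m n * (u n z * (c z / (A z * coeff n z))) \<partial>M)"
  proof (rule integral_cong_AE)
    show "AE z in M. 1 / A z - 1 / coeff n z = m n * (u n z * (c z / (A z * coeff n z)))"
      using A_bound coeff_bound[of n] b_eq[of n]
    proof eventually_elim
      case (elim z)
      then have nz: "A z \<noteq> 0" "coeff n z \<noteq> 0" using alpha by auto
      have "1 / A z - 1 / coeff n z = (coeff n z - A z) / (A z * coeff n z)" using nz by (simp add: field_simps)
      also have "coeff n z - A z = m n * u n z * c z" using elim(3) by (simp add: coeff_def)
      finally show ?case by simp
    qed
  qed measurable
  also have "\<dots> = m n * rate n" unfolding rate_def by (rule integral_mult_right_zero)
  finally have r: "(\<integral>z. 1 / A z \<partial>M) - (\<integral>z. 1 / coeff n z \<partial>M) = m n * rate n" .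
  have Cn: "C n * (\<integral>z. 1 / coeff n z \<partial>M) = 1" unfolding coeff_def by (rule C)
  have "C n - C0 = C n * (C0 * (\<integral>z. 1 / A z \<partial>M)) - C0 * (C n * (\<integral>z. 1 / coeff n z \<partial>M))"
    unfolding C0 Cn by simp
  also have "\<dots> = C n * C0 * ((\<integral>z. 1 / A z \<partial>M) - (\<integral>z. 1 / coeff n z \<partial>M))" by (simp only: algebra_simps)
  finally show ?thesis unfolding r by simp
qed

lemma C_tendsto: "C \<longlonglongrightarrow> C0"
proof -
  have "(\<lambda>n. C n - C0) \<longlonglongrightarrow> 0"
  proof (rule tendsto_0_le[where K="\<beta> * \<beta>"])
    show "(\<lambda>n. m n * rate n) \<longlonglongrightarrow> 0" using tendsto_mult[OF m_lim rate_tendsto] by simp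
    show "\<forall>\<^sub>F n in sequentially. norm (C n - C0) \<le> norm (m n * rate n) * (\<beta> * \<beta>)"
    proof (intro always_eventually allI)
      fix n
      have "norm (C n - C0) = norm (m n * rate n) * (C n * C0)"
        unfolding C_diff using C_bounds(1,2)[of n] C_bounds(3,4) by (simp add: abs_mult)
      also have "\<dots> \<le> norm (m n * rate n) * (\<beta> * \<beta>)"
        using C_bounds(1,2)[of n] C_bounds(3,4) beta_bounds by (intro mult_left_mono mult_mono) auto
      finally show "norm (C n - C0) \<le> norm (m n * rate n) * (\<beta> * \<beta>)" .
    qed
  qed
  then show ?thesis by (simp add: LIM_zero_iff)
qed

lemma C_rate_tendsto: "(\<lambda>n. rate n * C n * C0) \<longlonglongrightarrow> flux_deriv"
  unfolding flux_deriv_def by (intro tendsto_mult rate_tendsto C_tendsto tendsto_const)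

text \<open>The quotient of \<open>C n / coeff n z - C0 / A z\<close> by \<open>m n\<close>, written
  without the division so that m n = 0 is harmless. Its terms come from the change of the flux
  constant and from the change of the coefficient; \<open>corr_deriv\<close> is the formal limit and
  later the derivative of v^0.\<close>

definition corr_quot :: "nat \<Rightarrow> 'b \<Rightarrow> real" where
  "corr_quot n z = rate n * C n * C0 / A z - C n * (u n z * (c z / (A z * coeff n z)))"

definition corr_deriv :: "'b \<Rightarrow> real" where
  "corr_deriv z = flux_deriv / A z - C0 * (u0 z * (c z / (A z * A z)))"

lemma corr_quot_meas [measurable]: "corr_quot n \<in> borel_measurable M" "corr_deriv \<in> borel_measurable M"
  unfolding corr_quot_def corr_deriv_def by measurable

lemma flux_diff: "AE z in M. C n / coeff n z - C0 / A z = m n * corr_quot n z"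
  using A_bound coeff_bound[of n] b_eq[of n]
proof eventually_elim
  case (elim z)
  then have nz: "A z \<noteq> 0" "coeff n z \<noteq> 0" using alpha by auto
  have "C n / coeff n z - C0 / A z = (C n - C0) / A z - C n * ((coeff n z - A z) / (A z * coeff n z))"
    using nz by (simp add: field_simps)
  also have "coeff n z - A z = m n * u n z * c z" using elim(3) by (simp add: coeff_def)
  finally show ?case unfolding corr_quot_def C_diff by (simp add: algebra_simps)
qed

lemma corr_quot_tendsto:
  assumes h: "h \<in> borel_measurable M" "AE z in M. \<bar>h z\<bar> \<le> B"
  shows "(\<lambda>n. \<integral>z. corr_quot n z * h z \<partial>M) \<longlonglongrightarrow> (\<integral>z. corr_deriv z * h z \<partial>M)"
proof -
  note [measurable] = h(1)
  have h1: "AE z in M. \<bar>h z / A z\<bar> \<le> B / \<alpha>"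
    using h(2) A_bound by eventually_elim (use alpha in \<open>auto intro!: abs_divide_le simp del: abs_divide\<close>)
  have hi: "integrable M (\<lambda>z. h z / A z)"
    by (rule integrable_const_bound[where B="B / \<alpha>"]) (use h1 in auto)
  have k: "AE z in M. \<bar>h z * c z / (A z * coeff n z)\<bar> \<le> B * \<gamma> / (\<alpha> * \<alpha>)" for n
    using h(2) c_bound A_bound coeff_bound[of n]
    by eventually_elim (use alpha gamma_nonneg in \<open>intro abs_divide_le; auto simp: abs_mult intro!: mult_mono\<close>)
  have k0: "AE z in M. \<bar>h z * c z / (A z * A z)\<bar> \<le> B * \<gamma> / (\<alpha> * \<alpha>)"
    using h(2) c_bound A_bound
    by eventually_elim (use alpha gamma_nonneg in \<open>intro abs_divide_le; auto simp: abs_mult intro!: mult_mono\<close>)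
  have ki: "integrable M (\<lambda>z. u n z * (h z * c z / (A z * coeff n z)))" for n
    by (rule integrable_AE_bounded_mult[OF u_integrable _ k]) measurable
  have ki0: "integrable M (\<lambda>z. u0 z * (h z * c z / (A z * A z)))"
    by (rule integrable_AE_bounded_mult[OF u0_int _ k0]) measurable
  have "(\<integral>z. corr_quot n z * h z \<partial>M) =
      (\<integral>z. (rate n * C n * C0) * (h z / A z) - C n * (u n z * (h z * c z / (A z * coeff n z))) \<partial>M)" for n
    unfolding corr_quot_def by (intro Bochner_Integration.integral_cong refl) (simp add: algebra_simps)
  also have "\<dots> n = rate n * C n * C0 * (\<integral>z. h z / A z \<partial>M) - C n * (\<integral>z. u n z * (h z * c z / (A z * coeff n z)) \<partial>M)" for n
    using hi ki[of n] by (simp only: Bochner_Integration.integral_diff integrable_mult_right integral_mult_right_zero)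
  finally have 1: "(\<integral>z. corr_quot n z * h z \<partial>M) = rate n * C n * C0 * (\<integral>z. h z / A z \<partial>M) - C n * (\<integral>z. u n z * (h z * c z / (A z * coeff n z)) \<partial>M)" for n .
  have "(\<integral>z. corr_deriv z * h z \<partial>M) = (\<integral>z. flux_deriv * (h z / A z) - C0 * (u0 z * (h z * c z / (A z * A z))) \<partial>M)"
    unfolding corr_deriv_def by (intro Bochner_Integration.integral_cong refl) (simp add: algebra_simps)
  also have "\<dots> = flux_deriv * (\<integral>z. h z / A z \<partial>M) - C0 * (\<integral>z. u0 z * (h z * c z / (A z * A z)) \<partial>M)"
    using hi ki0 by (simp only: Bochner_Integration.integral_diff integrable_mult_right integral_mult_right_zero)
  finally have 2: "(\<integral>z. corr_deriv z * h z \<partial>M) = flux_deriv * (\<integral>z. h z / A z \<partial>M) - C0 * (\<integral>z. u0 z * (h z * c z / (A z * A z)) \<partial>M)" .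
  show ?thesis unfolding 1 2
    by (intro tendsto_diff tendsto_mult C_rate_tendsto C_tendsto tendsto_const flux_tendsto[OF h])
qed

text \<open>This domination is what upgrades convergence against bounded functions to L^1(L^q)
  through \<open>dominated_tendsto_integral\<close>. The maximum in \<open>L\<close> makes one
  constant valid for the quotients and for their limit.\<close>

lemma corr_quot_bound:
  "\<exists>L>0. (\<forall>n. AE z in M. \<bar>corr_quot n z\<bar> \<le> L * (1 + \<bar>u n z\<bar>)) \<and> (AE z in M. \<bar>corr_deriv z\<bar> \<le> L * (1 + \<bar>u0 z\<bar>))"
proof -
  obtain K where K: "K > 0" "\<And>n. \<bar>rate n * C n * C0\<bar> \<le> K"
    using convergent_imp_Bseq[OF convergentI[OF C_rate_tendsto]] unfolding Bseq_def by auto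
  define L where "L = max K \<bar>flux_deriv\<bar> / \<alpha> + \<beta> * (\<gamma> / (\<alpha> * \<alpha>))"
  have L: "L > 0" unfolding L_def using K(1) alpha beta_bounds gamma_nonneg by (intro add_pos_nonneg) auto
  have main: "\<bar>d / x - k * (v * (cc / (x * y)))\<bar> \<le> L * (1 + \<bar>v\<bar>)"
    if "\<bar>d\<bar> \<le> max K \<bar>flux_deriv\<bar>" "\<alpha> \<le> x" "\<alpha> \<le> y" "\<bar>cc\<bar> \<le> \<gamma>" "0 < k" "k \<le> \<beta>" for d x y k v cc :: real
  proof -
    have 1: "\<bar>d / x\<bar> \<le> max K \<bar>flux_deriv\<bar> / \<alpha>" using that alpha by (intro abs_divide_le) auto
    have 2: "\<bar>cc / (x * y)\<bar> \<le> \<gamma> / (\<alpha> * \<alpha>)" using that alpha by (intro abs_divide_le mult_mono) (auto intro: mult_pos_pos)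
    have "\<bar>d / x - k * (v * (cc / (x * y)))\<bar> \<le> \<bar>d / x\<bar> + \<bar>k * (v * (cc / (x * y)))\<bar>" by (rule abs_triangle_ineq4)
    also have "\<bar>k * (v * (cc / (x * y)))\<bar> = k * (\<bar>v\<bar> * \<bar>cc / (x * y)\<bar>)" using that by (simp add: abs_mult)
    also have "\<bar>d / x\<bar> + \<dots> \<le> max K \<bar>flux_deriv\<bar> / \<alpha> + \<beta> * (\<bar>v\<bar> * (\<gamma> / (\<alpha> * \<alpha>)))"
      using 1 2 that beta_bounds alpha gamma_nonneg by (intro add_mono mult_mono mult_left_mono mult_nonneg_nonneg) auto
    also have "\<dots> \<le> L * (1 + \<bar>v\<bar>)"
    proof -
      have "0 \<le> max K \<bar>flux_deriv\<bar> / \<alpha> * \<bar>v\<bar>" "0 \<le> \<beta> * (\<gamma> / (\<alpha> * \<alpha>))" using alpha beta_bounds gamma_nonneg K(1) by auto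
      moreover have "P + k' * (v' * Q) \<le> (P + k' * Q) * (1 + v')" if "0 \<le> P * v'" "0 \<le> k' * Q" for P Q k' v' :: real
        using that by (simp add: algebra_simps)
      ultimately show ?thesis unfolding L_def by blast
    qed
    finally show ?thesis .
  qed
  have "AE z in M. \<bar>corr_quot n z\<bar> \<le> L * (1 + \<bar>u n z\<bar>)" for n
    using A_bound coeff_bound[of n] c_bound
  proof eventually_elim
    case (elim z)
    have "\<bar>rate n * C n * C0\<bar> \<le> max K \<bar>flux_deriv\<bar>" using K(2)[of n] by simp
    then show ?case unfolding corr_quot_def using elim C_bounds(1,2)[of n] C_bounds(3,4) by (intro main) auto
  qed
  moreover have "AE z in M. \<bar>corr_deriv z\<bar> \<le> L * (1 + \<bar>u0 z\<bar>)"
    using A_bound c_bound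
  proof eventually_elim
    case (elim z)
    then show ?case unfolding corr_deriv_def using C_bounds by (intro main) auto
  qed
  ultimately show ?thesis using L by blast
qed

text \<open>The normalisation of \<open>C0\<close> reduces \<open>flux_deriv\<close> times the mean
  of 1/A to \<open>rate0 * C0\<close>, which the second term cancels.\<close>

lemma corr_deriv_integral: "integrable M corr_deriv" "(\<integral>z. corr_deriv z \<partial>M) = 0"
proof -
  have "AE z in M. \<bar>c z / (A z * A z)\<bar> \<le> \<gamma> / (\<alpha> * \<alpha>)"
    using c_bound A_bound by eventually_elim (use alpha in \<open>intro abs_divide_le; auto intro!: mult_mono\<close>)
  then have i: "integrable M (\<lambda>z. u0 z * (c z / (A z * A z)))"
    by (intro integrable_AE_bounded_mult[OF u0_int]) measurable
  have i': "integrable M (\<lambda>z. flux_deriv * (1 / A z))" by (intro integrable_mult_right inverse_integrable)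
  have eq: "corr_deriv = (\<lambda>z. flux_deriv * (1 / A z) - C0 * (u0 z * (c z / (A z * A z))))" unfolding corr_deriv_def by auto
  show "integrable M corr_deriv" unfolding eq by (intro Bochner_Integration.integrable_diff i' integrable_mult_right i)
  have "(\<integral>z. corr_deriv z \<partial>M) = flux_deriv * (\<integral>z. 1 / A z \<partial>M) - C0 * rate0"
    unfolding eq rate0_def using i i' by (simp only: Bochner_Integration.integral_diff integrable_mult_right integral_mult_right_zero)
  also have "flux_deriv * (\<integral>z. 1 / A z \<partial>M) = rate0 * C0 * (C0 * (\<integral>z. 1 / A z \<partial>M))" unfolding flux_deriv_def by (simp only: mult.assoc)
  finally show "(\<integral>z. corr_deriv z \<partial>M) = 0" unfolding C0 by simp
qed

end

section \<open>The expansion of the correctors\<close>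

lemma periodic_int:
  fixes f :: "real \<Rightarrow> real"
  assumes "\<And>x. f (x + 1) = f x"
  shows "f (x + real_of_int k) = f x"
proof (induction k rule: int_induct[where k=0])
  case (step1 i)
  then show ?case using assms[of "x + real_of_int i"] by (simp add: add.assoc)
next
  case (step2 i)
  then show ?case using assms[of "x + real_of_int (i - 1)"] by (simp add: add.assoc)
qed simp

context ergodic_Z_system begin

section \<open>Fields over the product of cell and probability space\<close>

lemma distr_fst: "distr CM cell fst = cell"
  by (rule M.distr_pair_fst)

lemma AE_fst: "AE x in cell. Q x \<Longrightarrow> AE z in CM. Q (fst z)"
  by (rule AE_distrD[OF measurable_fst]) (subst distr_fst)

lemma integral_comp_fst:
  fixes f :: "real \<Rightarrow> real"
  assumes "f \<in> borel_measurable cell"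
  shows "(\<integral>z. f (fst z) \<partial>CM) = (\<integral>x. f x \<partial>cell)"
  using integral_distr[OF measurable_fst assms, of M] by (simp add: distr_fst)

lemma field_measurable_comp_fst:
  assumes "f \<in> borel_measurable borel"
  shows "(\<lambda>z. f (fst z)) \<in> borel_measurable (lborel \<Otimes>\<^sub>M M)"
  by (rule measurable_compose[OF measurable_fst]) (use assms in simp)

lemma field_measurable_primitive:
  assumes g: "field_measurable M g"
  shows "field_measurable M (\<lambda>x \<omega>. primitive (\<lambda>t. g t \<omega>) x)"
  unfolding field_measurable_def primitive_def
proof (rule lborel.borel_measurable_lebesgue_integral)
  have "(\<lambda>y. (snd y, snd (fst y))) \<in> (lborel \<Otimes>\<^sub>M M) \<Otimes>\<^sub>M lborel \<rightarrow>\<^sub>M lborel \<Otimes>\<^sub>M M"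
    by measurable
  from measurable_compose[OF this g[unfolded field_measurable_def]]
  have [measurable]: "(\<lambda>y. g (snd y) (snd (fst y))) \<in> borel_measurable ((lborel \<Otimes>\<^sub>M M) \<Otimes>\<^sub>M lborel)" by simp
  have "(\<lambda>y. fst (fst y)) \<in> borel_measurable ((lborel \<Otimes>\<^sub>M M) \<Otimes>\<^sub>M lborel)"
    "(\<lambda>y. snd y) \<in> borel_measurable ((lborel \<Otimes>\<^sub>M M) \<Otimes>\<^sub>M lborel)" by measurable
  from primitive_kernel_measurable[OF this]
  show "(\<lambda>(z, t). g t (snd z) * primitive_kernel (fst z) t) \<in> borel_measurable ((lborel \<Otimes>\<^sub>M M) \<Otimes>\<^sub>M lborel)"
    unfolding case_prod_beta' by measurable
qed

text \<open>The cell has measure 1, so for r \<ge> 1 test functions in L^r(L^q) also lie in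
  L^1(L^q). Weak convergence in L^2(L^p) thus follows from testing against the larger class.\<close>

lemma in_Lr_LqD:
  assumes g: "in_Lr_Lq M r q g" and r: "r \<ge> 1"
  shows "(\<lambda>z. g (fst z) (snd z)) \<in> borel_measurable CM" "AE x in cell. Lp_finite M q (g x)"
    "(\<integral>\<^sup>+x. ennreal (Lp_norm M q (g x)) \<partial>cell) < \<infinity>"
proof -
  show gm: "(\<lambda>z. g (fst z) (snd z)) \<in> borel_measurable CM" and "AE x in cell. Lp_finite M q (g x)"
    using g unfolding in_Lr_Lq_def by auto
  have [measurable]: "(\<lambda>x. Lp_norm M q (g x)) \<in> borel_measurable cell"
    using Lp_norm_measurable[OF gm] by simp
  have fin: "(\<integral>\<^sup>+x. ennreal (Lp_norm M q (g x) powr r) \<partial>cell) < \<infinity>"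
    using g unfolding in_Lr_Lq_def by auto
  have "Lp_norm M q (g x) \<le> 1 + Lp_norm M q (g x) powr r" for x
    using abs_le_one_plus_powr[OF r, of "Lp_norm M q (g x)"] by (simp add: Lp_norm_nonneg)
  then have "ennreal (Lp_norm M q (g x)) \<le> 1 + ennreal (Lp_norm M q (g x) powr r)" for x
    by (metis ennreal_1 ennreal_leI ennreal_plus powr_ge_zero zero_le_one)
  then have "(\<integral>\<^sup>+x. ennreal (Lp_norm M q (g x)) \<partial>cell) \<le> (\<integral>\<^sup>+x. 1 + ennreal (Lp_norm M q (g x) powr r) \<partial>cell)"
    by (intro nn_integral_mono)
  also have "\<dots> = 1 + (\<integral>\<^sup>+x. ennreal (Lp_norm M q (g x) powr r) \<partial>cell)"
    by (subst nn_integral_add) (auto simp: cell.emeasure_space_1)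
  also have "\<dots> < \<infinity>" using fin by simp
  finally show "(\<integral>\<^sup>+x. ennreal (Lp_norm M q (g x)) \<partial>cell) < \<infinity>" .
qed

end

theorem theorem18:
  fixes M :: "'a measure" and \<tau> :: "int \<Rightarrow> 'a \<Rightarrow> 'a"
    and a_per c_per :: "real \<Rightarrow> real"
    and b :: "real \<Rightarrow> real \<Rightarrow> 'a \<Rightarrow> real"
    and Mb \<alpha> \<beta> p :: real
    and w Dw :: "real \<Rightarrow> real \<Rightarrow> 'a \<Rightarrow> real"
    and w0 Dw0 :: "real \<Rightarrow> real"
  defines "a \<equiv> (\<lambda>\<eta> x \<omega>. a_per x + b \<eta> x \<omega> * c_per x)"
    and "m \<equiv> (\<lambda>\<eta>. real_of_ereal (Linf_Lp_norm M p (b \<eta>)))"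
    and "q \<equiv> p / (p - 1)"
    and "astar \<equiv> (\<lambda>\<eta>. \<integral>z. (a_per (fst z) + b \<eta> (fst z) (snd z) * c_per (fst z)) * (Dw \<eta> (fst z) (snd z) + 1) \<partial>(cell \<Otimes>\<^sub>M M))"
    and "astar_per \<equiv> (\<integral>x. a_per x * (Dw0 x + 1) \<partial>cell)"
  assumes erg: "ergodic_Z_action M \<tau>"
    and a_per_meas: "a_per \<in> borel_measurable lborel"
    and c_per_meas: "c_per \<in> borel_measurable lborel"
    and a_per_periodic: "\<forall>x. a_per (x + 1) = a_per x"
    and c_per_periodic: "\<forall>x. c_per (x + 1) = c_per x"
    and b_meas: "\<forall>\<eta>>0. field_measurable M (b \<eta>)"
    and b_stat: "\<forall>\<eta>>0. stationary M \<tau> (b \<eta>)"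
    and Mb_pos: "Mb > 0"
    and b_bound: "\<forall>\<eta>>0. AE z in cell \<Otimes>\<^sub>M M. \<bar>b \<eta> (fst z) (snd z)\<bar> \<le> Mb"
    and alpha_pos: "0 < \<alpha>" and alpha_beta: "\<alpha> \<le> \<beta>"
    and ell_per: "AE x in lborel. \<alpha> \<le> a_per x \<and> a_per x \<le> \<beta>"
    and ell_pert: "AE x in lborel. \<forall>s\<in>{-Mb..Mb}. \<alpha> \<le> a_per x + s * c_per x \<and> a_per x + s * c_per x \<le> \<beta>"
    and p_gt: "p > 1"
    and m_lim: "(m \<longlongrightarrow> 0) (at_right 0)"
    and w_corr: "\<forall>\<eta>>0. stoch_corrector M \<tau> (a \<eta>) (w \<eta>) (Dw \<eta>)"
    and w0_corr: "per_corrector a_per w0 Dw0"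
  shows "\<exists>\<eta>s :: nat \<Rightarrow> real. \<exists>b0 :: real \<Rightarrow> 'a \<Rightarrow> real.
     (\<forall>n. \<eta>s n > 0) \<and> \<eta>s \<longlonglongrightarrow> 0 \<and>
     \<comment> \<open>b_eta / m_eta converges weakly-* in L^infinity([-1/2,1/2]; L^p) to b0\<close>
     field_measurable M b0 \<and> stationary M \<tau> b0 \<and> Linf_Lp_norm M p b0 < \<infinity> \<and>
     (\<forall>g. in_Lr_Lq M 1 q g \<longrightarrow>
        (\<lambda>n. pair M (\<lambda>x \<omega>. b (\<eta>s n) x \<omega> / m (\<eta>s n)) g) \<longlonglongrightarrow> pair M b0 g) \<and>
     (\<exists>v0 Dv0 :: real \<Rightarrow> 'a \<Rightarrow> real.
        \<comment> \<open>v0 solves -(a_per v0')' = (b0 c_per (w0' + 1))' in R, v0' stationary, mean zero\<close>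
        field_measurable M v0 \<and> field_measurable M Dv0 \<and> stationary M \<tau> Dv0 \<and>
        integrable (cell \<Otimes>\<^sub>M M) (\<lambda>z. Dv0 (fst z) (snd z)) \<and>
        (AE \<omega> in M. has_weak_deriv (\<lambda>x. v0 x \<omega>) (\<lambda>x. Dv0 x \<omega>) \<and>
           weakly_divfree (\<lambda>x. a_per x * Dv0 x \<omega> + b0 x \<omega> * c_per x * (Dw0 x + 1))) \<and>
        (\<integral>z. Dv0 (fst z) (snd z) \<partial>(cell \<Otimes>\<^sub>M M)) = 0 \<and>
        \<comment> \<open>Dw_eta = Dw0 + m_eta Dv0 + o(m_eta) weakly in L^2([-1/2,1/2]; L^p)\<close>
        (\<forall>g. in_Lr_Lq M 2 q g \<longrightarrow>
           (\<lambda>n. pair M (\<lambda>x \<omega>. Dw (\<eta>s n) x \<omega> - Dw0 x - m (\<eta>s n) * Dv0 x \<omega>) g / m (\<eta>s n))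
             \<longlonglongrightarrow> 0) \<and>
        \<comment> \<open>expansion of the homogenized coefficient\<close>
        (\<lambda>n. (astar (\<eta>s n) - astar_per
                - m (\<eta>s n) * (\<integral>x. (\<integral>\<omega>. b0 x \<omega> \<partial>M) * c_per x * (Dw0 x + 1) \<partial>cell)
                - m (\<eta>s n) * (\<integral>x. a_per x * (\<integral>\<omega>. Dv0 x \<omega> \<partial>M) \<partial>cell)) / m (\<eta>s n))
          \<longlonglongrightarrow> 0)"
proof -
  interpret ergodic_Z_system M \<tau> by unfold_locales (rule erg)
  have Am: "a_per \<in> borel_measurable borel" and cm: "c_per \<in> borel_measurable borel"
    using a_per_meas c_per_meas by simp_all
  have Aper: "a_per (x + real_of_int k) = a_per x" and cper: "c_per (x + real_of_int k) = c_per x" for x k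
    using a_per_periodic c_per_periodic by (auto intro: periodic_int)
  have [measurable]: "(\<lambda>z. a_per (fst z)) \<in> borel_measurable (lborel \<Otimes>\<^sub>M M)"
    "(\<lambda>z. c_per (fst z)) \<in> borel_measurable (lborel \<Otimes>\<^sub>M M)"
    using Am cm by (auto intro: field_measurable_comp_fst)
  have [measurable]: "a_per \<in> borel_measurable cell" "c_per \<in> borel_measurable cell"
    using Am cm by (auto intro: borel_measurable_cell)
  have [measurable]: "(\<lambda>z. b \<eta> (fst z) (snd z)) \<in> borel_measurable CM" if "\<eta> > 0" for \<eta>
    using b_meas that by (intro field_measurable_cell) blast
  \<comment> \<open>Ellipticity at the extreme values s = Mb and s = -Mb, together with
    \<open>a_per\<close> \<ge> \<alpha>, bounds \<open>c_per\<close>.\<close>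
  have c_le: "AE x in lborel. \<bar>c_per x\<bar> \<le> (\<beta> - \<alpha>) / Mb"
    using ell_per ell_pert
  proof eventually_elim
    case (elim x)
    have "a_per x + Mb * c_per x \<le> \<beta>" "a_per x + (- Mb) * c_per x \<le> \<beta>"
      using elim(2)[rule_format, of Mb] elim(2)[rule_format, of "- Mb"] Mb_pos by auto
    then have "Mb * \<bar>c_per x\<bar> \<le> \<beta> - \<alpha>" using elim(1) by (auto simp: abs_if)
    then show ?case using Mb_pos by (simp add: field_simps)
  qed
  \<comment> \<open>The quantifier over s stands inside the almost-everywhere statement, so the
    random value of \<open>b\<close> may be substituted for it.\<close>
  have a_bound: "AE z in CM. \<alpha> \<le> a_per (fst z) + b \<eta> (fst z) (snd z) * c_per (fst z)
      \<and> a_per (fst z) + b \<eta> (fst z) (snd z) * c_per (fst z) \<le> \<beta>" if "\<eta> > 0" for \<eta>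
    using b_bound[rule_format, OF that] AE_fst[OF AE_cellI[OF ell_pert]]
    by eventually_elim (auto simp: abs_le_iff)
  have am: "field_measurable M (a \<eta>)" if "\<eta> > 0" for \<eta>
    using b_meas[rule_format, OF that] unfolding a_def field_measurable_def by measurable
  have ast: "stationary M \<tau> (a \<eta>)" if "\<eta> > 0" for \<eta>
    using b_stat[rule_format, OF that] Aper cper unfolding a_def stationary_def by simp

  have ball: "Lp_ball p (\<lambda>z. b \<eta> (fst z) (snd z) / m \<eta>)"
    and b_eq: "AE z in CM. b \<eta> (fst z) (snd z) = m \<eta> * (b \<eta> (fst z) (snd z) / m \<eta>)"
    and m0: "m \<eta> \<ge> 0" if "\<eta> > 0" for \<eta>
    using Lp_ball_normalised[OF p_gt _ b_bound[rule_format, OF that]]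
      Linf_Lp_norm_bounded_field(1)[OF p_gt _ b_bound[rule_format, OF that]] that
    unfolding m_def by auto
  define \<eta>0 where "\<eta>0 n = inverse (real (Suc n))" for n
  have \<eta>0: "\<eta>0 n > 0" for n unfolding \<eta>0_def by simp
  have \<eta>0_lim: "\<eta>0 \<longlonglongrightarrow> 0" unfolding \<eta>0_def by (rule LIMSEQ_inverse_real_of_nat)
  define f where "f n z = b (\<eta>0 n) (fst z) (snd z) / m (\<eta>0 n)" for n z
  have f_ball: "Lp_ball p (f n)" for n unfolding f_def[abs_def] by (rule ball[OF \<eta>0])
  have f_meas: "f n \<in> borel_measurable CM" for n using f_ball unfolding Lp_ball_def by blast
  have "\<exists>s g0. strict_mono (s :: nat \<Rightarrow> nat) \<and> integrable CM g0 \<and>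
    (\<forall>h\<in>borel_measurable CM. (\<exists>B. AE z in CM. \<bar>h z\<bar> \<le> B) \<longrightarrow>
      (\<lambda>n. \<integral>z. f (s n) z * h z \<partial>CM) \<longlonglongrightarrow> (\<integral>z. g0 z * h z \<partial>CM))"
    by (rule P.Lp_bounded_subsequence[OF p_gt f_meas Lp_ball_integrable[OF f_ball]])
  then obtain s :: "nat \<Rightarrow> nat" and g0 where s: "strict_mono s" and g0: "integrable CM g0"
    and lim0': "\<forall>h\<in>borel_measurable CM. (\<exists>B. AE z in CM. \<bar>h z\<bar> \<le> B) \<longrightarrow>
      (\<lambda>n. \<integral>z. f (s n) z * h z \<partial>CM) \<longlonglongrightarrow> (\<integral>z. g0 z * h z \<partial>CM)"
    by (elim exE conjE)
  have lim0: "(\<lambda>n. \<integral>z. f (s n) z * h z \<partial>CM) \<longlonglongrightarrow> (\<integral>z. g0 z * h z \<partial>CM)"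
    if "h \<in> borel_measurable CM" "AE z in CM. \<bar>h z\<bar> \<le> B" for h B
    using lim0' that by blast
  define \<eta>s where "\<eta>s n = \<eta>0 (s n)" for n
  have \<eta>s: "\<eta>s n > 0" for n unfolding \<eta>s_def by (rule \<eta>0)
  have \<eta>s_lim: "\<eta>s \<longlonglongrightarrow> 0"
    using LIMSEQ_subseq_LIMSEQ[OF \<eta>0_lim s] unfolding \<eta>s_def by (simp add: o_def)
  \<comment> \<open>\<open>g0\<close> is known on the cell only; the equation for v^0 on the whole
    line calls for its stationary extension.\<close>
  obtain b0 where b0m: "field_measurable M b0" and b0s: "stationary M \<tau> b0"
    and b0g: "AE z in CM. b0 (fst z) (snd z) = g0 z"
    using stationary_extension[OF borel_measurable_integrable[OF g0]] by blast
  define u where "u n z = b (\<eta>s n) (fst z) (snd z) / m (\<eta>s n)" for n z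
  define u0 where "u0 z = b0 (fst z) (snd z)" for z
  have u0m[measurable]: "u0 \<in> borel_measurable CM" unfolding u0_def by (rule field_measurable_cell[OF b0m])
  note [measurable] = borel_measurable_integrable[OF g0]
  have u0i: "integrable CM u0"
    using b0g g0 unfolding u0_def by (subst integrable_cong_AE[where g=g0]) (auto intro: field_measurable_cell[OF b0m])
  have u_lim: "(\<lambda>n. \<integral>z. u n z * h z \<partial>CM) \<longlonglongrightarrow> (\<integral>z. u0 z * h z \<partial>CM)"
    if h: "h \<in> borel_measurable CM" "AE z in CM. \<bar>h z\<bar> \<le> B" for h B
  proof -
    have "(\<integral>z. u0 z * h z \<partial>CM) = (\<integral>z. g0 z * h z \<partial>CM)"
    proof (rule integral_cong_AE)
      show "AE z in CM. u0 z * h z = g0 z * h z" using b0g unfolding u0_def by eventually_elim simp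
    qed (use h(1) in measurable)
    then show ?thesis using lim0[OF h] unfolding u_def \<eta>s_def f_def by simp
  qed
  have u_ball: "Lp_ball p (u n)" for n unfolding u_def[abs_def] by (rule ball[OF \<eta>s])
  have u_meas: "u n \<in> borel_measurable CM" for n using u_ball unfolding Lp_ball_def by blast
  \<comment> \<open>Membership of the limit in the ball gives its finite norm and allows test
    functions from L^1(L^q) on the limit side.\<close>
  have u0_ball: "Lp_ball p u0" by (rule Lp_ball_weak_limit[OF p_gt u_ball u0i u_lim])

  define C where "C n = astar (\<eta>s n)" for n
  define C0 where "C0 = astar_per"
  have stoch: "AE z in CM. a (\<eta>s n) (fst z) (snd z) * (Dw (\<eta>s n) (fst z) (snd z) + 1) = C n"
    "C n * (\<integral>z. 1 / a (\<eta>s n) (fst z) (snd z) \<partial>CM) = 1" for n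
  proof -
    have bnd: "AE z in CM. \<alpha> \<le> a (\<eta>s n) (fst z) (snd z) \<and> a (\<eta>s n) (fst z) (snd z) \<le> \<beta>"
      using a_bound[OF \<eta>s, of n] unfolding a_def .
    note flux = stoch_corrector_flux[OF am[OF \<eta>s] ast[OF \<eta>s] bnd alpha_pos w_corr[rule_format, OF \<eta>s]]
    have C: "C n = (\<integral>z. a (\<eta>s n) (fst z) (snd z) * (Dw (\<eta>s n) (fst z) (snd z) + 1) \<partial>CM)"
      unfolding C_def astar_def a_def ..
    show "AE z in CM. a (\<eta>s n) (fst z) (snd z) * (Dw (\<eta>s n) (fst z) (snd z) + 1) = C n"
      "C n * (\<integral>z. 1 / a (\<eta>s n) (fst z) (snd z) \<partial>CM) = 1"
      unfolding C by (rule flux)+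
  qed
  have per: "Dw0 \<in> borel_measurable borel" "AE x in lborel. a_per x * (Dw0 x + 1) = C0" "C0 * (\<integral>x. 1 / a_per x \<partial>cell) = 1"
    using per_corrector_flux[OF Am ell_per alpha_pos w0_corr] unfolding C0_def astar_per_def by simp_all
  have C0_eq: "C0 * (\<integral>z. 1 / a_per (fst z) \<partial>CM) = 1"
    using per(3) integral_comp_fst[of "\<lambda>x. 1 / a_per x"] by simp
  \<comment> \<open>The cell times the probability space is itself a probability space; from here on
    the expansion concerns scalar random variables on it.\<close>
  interpret K: coefficient_perturbation "CM" "\<lambda>z. a_per (fst z)" "\<lambda>z. c_per (fst z)"
    "\<lambda>n z. b (\<eta>s n) (fst z) (snd z)" u u0 "\<lambda>n. m (\<eta>s n)" \<alpha> \<beta> "(\<beta> - \<alpha>) / Mb" Mb p C C0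
  proof unfold_locales
    show "(\<lambda>z. a_per (fst z)) \<in> borel_measurable CM" "(\<lambda>z. c_per (fst z)) \<in> borel_measurable CM"
      by measurable
    show "(\<lambda>z. b (\<eta>s n) (fst z) (snd z)) \<in> borel_measurable CM" for n using \<eta>s by measurable
    show "AE z in CM. \<alpha> \<le> a_per (fst z) \<and> a_per (fst z) \<le> \<beta>" by (rule AE_fst[OF AE_cellI[OF ell_per]])
    show "AE z in CM. \<bar>c_per (fst z)\<bar> \<le> (\<beta> - \<alpha>) / Mb" by (rule AE_fst[OF AE_cellI[OF c_le]])
    show "AE z in CM. b (\<eta>s n) (fst z) (snd z) = m (\<eta>s n) * u n z" for n
      unfolding u_def by (rule b_eq[OF \<eta>s])
    show "(\<lambda>n. m (\<eta>s n)) \<longlonglongrightarrow> 0"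
    proof (rule filterlim_compose[OF m_lim])
      have "\<eta>s n \<in> {0<..} \<and> \<eta>s n \<noteq> 0" for n using \<eta>s[of n] by simp
      then show "filterlim \<eta>s (at_right 0) sequentially" using \<eta>s_lim by (simp add: filterlim_at)
    qed
    show "C n * (\<integral>z. 1 / (a_per (fst z) + b (\<eta>s n) (fst z) (snd z) * c_per (fst z)) \<partial>CM) = 1" for n
      using stoch(2)[of n] unfolding a_def .
  qed (use u_meas u0i alpha_pos p_gt a_bound[OF \<eta>s] b_bound[rule_format, OF \<eta>s] m0[OF \<eta>s] Lp_ball_integrable[OF u_ball] u_lim C0_eq in auto)

  \<comment> \<open>Obtained by solving for \<open>Dv0\<close> when
    \<open>a_per * Dv0 + b0 * c_per * (Dw0 + 1)\<close> is constant and
    \<open>Dw0 + 1 = C0 / a_per\<close>. The constant \<open>K.flux_deriv\<close> is the one that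
    makes the mean of \<open>Dv0\<close> vanish.\<close>
  define Dv0 where "Dv0 x \<omega> = K.flux_deriv / a_per x - C0 * (b0 x \<omega> * (c_per x / (a_per x * a_per x)))" for x \<omega>
  have Dv0_Y0: "Dv0 (fst z) (snd z) = K.corr_deriv z" for z unfolding Dv0_def K.corr_deriv_def u0_def ..
  have Dv0m: "field_measurable M Dv0"
    using b0m unfolding field_measurable_def Dv0_def by measurable
  have Dv0s: "stationary M \<tau> Dv0" using b0s Aper cper unfolding stationary_def Dv0_def by simp
  have Dv0i: "integrable CM (\<lambda>z. Dv0 (fst z) (snd z))" unfolding Dv0_Y0 by (rule K.corr_deriv_integral)
  define v0 where "v0 x \<omega> = primitive (\<lambda>t. Dv0 t \<omega>) x" for x \<omega>
  have v0m: "field_measurable M v0" unfolding v0_def[abs_def] by (rule field_measurable_primitive[OF Dv0m])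
  \<comment> \<open>The quantifier over \<omega> can stand inside because the exceptional points
    come from the periodic data alone.\<close>
  have flux0: "AE x in lborel. \<forall>\<omega>. a_per x * Dv0 x \<omega> + b0 x \<omega> * c_per x * (Dw0 x + 1) = K.flux_deriv"
    using ell_per per(2)
  proof eventually_elim
    case (elim x)
    then have nz: "a_per x \<noteq> 0" using alpha_pos by auto
    have D: "Dw0 x + 1 = C0 / a_per x" using elim(2) nz by (simp add: field_simps)
    show ?case unfolding D Dv0_def using nz by (simp add: field_simps)
  qed
  have pde: "AE \<omega> in M. has_weak_deriv (\<lambda>x. v0 x \<omega>) (\<lambda>x. Dv0 x \<omega>) \<and>
       weakly_divfree (\<lambda>x. a_per x * Dv0 x \<omega> + b0 x \<omega> * c_per x * (Dw0 x + 1))"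
    using stationary_loc_integrable[OF Dv0s Dv0i] AE_space
  proof eventually_elim
    case (elim \<omega>)
    have "has_weak_deriv (\<lambda>x. v0 x \<omega>) (\<lambda>x. Dv0 x \<omega>)"
      unfolding v0_def using elim(1) by (intro has_weak_deriv_primitive) blast
    moreover have "weakly_divfree (\<lambda>x. a_per x * Dv0 x \<omega> + b0 x \<omega> * c_per x * (Dw0 x + 1))"
    proof (rule weakly_divfree_AE_const)
      have [measurable]: "(\<lambda>x. Dv0 x \<omega>) \<in> borel_measurable borel" "(\<lambda>x. b0 x \<omega>) \<in> borel_measurable borel"
        using field_measurable_section[OF Dv0m elim(2)] field_measurable_section[OF b0m elim(2)] by auto
      show "(\<lambda>x. a_per x * Dv0 x \<omega> + b0 x \<omega> * c_per x * (Dw0 x + 1)) \<in> borel_measurable borel"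
        using Am cm per(1) by measurable
      show "AE x in lborel. a_per x * Dv0 x \<omega> + b0 x \<omega> * c_per x * (Dw0 x + 1) = K.flux_deriv"
        using flux0 by eventually_elim blast
    qed
    ultimately show ?case ..
  qed
  have mean: "(\<integral>z. Dv0 (fst z) (snd z) \<partial>CM) = 0" unfolding Dv0_Y0 by (rule K.corr_deriv_integral)

  have weak_star: "(\<lambda>n. pair M (\<lambda>x \<omega>. b (\<eta>s n) x \<omega> / m (\<eta>s n)) g) \<longlonglongrightarrow> pair M b0 g"
    if g: "in_Lr_Lq M 1 q g" for g
  proof -
    note gD = in_Lr_LqD[OF g order.refl]
    have "(\<lambda>n. \<integral>z. u n z * g (fst z) (snd z) \<partial>CM) \<longlonglongrightarrow> (\<integral>z. u0 z * g (fst z) (snd z) \<partial>CM)"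
      by (rule Lp_ball_tendsto_integral[OF p_gt _ u_ball u0_ball u_lim gD(1)]) (use gD(2,3) in \<open>simp_all add: q_def\<close>)
    then show ?thesis unfolding pair_def u_def u0_def .
  qed
  have diff: "AE z in CM. Dw (\<eta>s n) (fst z) (snd z) - Dw0 (fst z) = m (\<eta>s n) * K.corr_quot n z" for n
    using K.flux_diff[of n] stoch(1)[of n] AE_fst[OF AE_cellI[OF per(2)]] K.coeff_bound[of n] K.A_bound
  proof eventually_elim
    case (elim z)
    have eq: "a (\<eta>s n) (fst z) (snd z) = K.coeff n z" unfolding a_def K.coeff_def ..
    have "Dw (\<eta>s n) (fst z) (snd z) + 1 = C n / K.coeff n z"
      using elim(2,4) alpha_pos unfolding eq by (simp add: field_simps)
    moreover have "Dw0 (fst z) + 1 = C0 / a_per (fst z)"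
      using elim(3,5) alpha_pos by (simp add: field_simps)
    ultimately show ?case using elim(1) by simp
  qed
  have weak: "(\<lambda>n. pair M (\<lambda>x \<omega>. Dw (\<eta>s n) x \<omega> - Dw0 x - m (\<eta>s n) * Dv0 x \<omega>) g / m (\<eta>s n)) \<longlonglongrightarrow> 0"
    if g: "in_Lr_Lq M 2 q g" for g
  proof -
    note gD = in_Lr_LqD[OF g one_le_numeral]
    note [measurable] = gD(1)
    obtain L where L: "L > 0" "\<And>n. AE z in CM. \<bar>K.corr_quot n z\<bar> \<le> L * (1 + \<bar>u n z\<bar>)"
      "AE z in CM. \<bar>K.corr_deriv z\<bar> \<le> L * (1 + \<bar>u0 z\<bar>)" using K.corr_quot_bound by blast
    note dom = dominated_tendsto_integral[OF p_gt refl u_ball u0_ball L(1) K.corr_quot_meas(1) K.corr_quot_meas(2) L(2) L(3) K.corr_quot_tendsto gD(1)]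
    have lim: "(\<lambda>n. \<integral>z. K.corr_quot n z * g (fst z) (snd z) \<partial>CM) \<longlonglongrightarrow> (\<integral>z. K.corr_deriv z * g (fst z) (snd z) \<partial>CM)"
      and i: "integrable CM (\<lambda>z. K.corr_quot n z * g (fst z) (snd z))"
      and i0: "integrable CM (\<lambda>z. K.corr_deriv z * g (fst z) (snd z))" for n
      using dom gD(2,3) by (simp_all add: q_def)
    have Dwm[measurable]: "(\<lambda>z. Dw (\<eta>s n) (fst z) (snd z)) \<in> borel_measurable CM" for n
      using w_corr \<eta>s unfolding stoch_corrector_def by (intro field_measurable_cell) blast
    have [measurable]: "Dw0 \<in> borel_measurable cell" by (rule borel_measurable_cell[OF per(1)])
    note [measurable] = field_measurable_cell[OF Dv0m]
    have eq: "pair M (\<lambda>x \<omega>. Dw (\<eta>s n) x \<omega> - Dw0 x - m (\<eta>s n) * Dv0 x \<omega>) g =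
        m (\<eta>s n) * ((\<integral>z. K.corr_quot n z * g (fst z) (snd z) \<partial>CM) - (\<integral>z. K.corr_deriv z * g (fst z) (snd z) \<partial>CM))" for n
    proof -
      have "pair M (\<lambda>x \<omega>. Dw (\<eta>s n) x \<omega> - Dw0 x - m (\<eta>s n) * Dv0 x \<omega>) g =
          (\<integral>z. m (\<eta>s n) * (K.corr_quot n z * g (fst z) (snd z) - K.corr_deriv z * g (fst z) (snd z)) \<partial>CM)"
        unfolding pair_def
      proof (rule integral_cong_AE)
        show "AE z in CM. (Dw (\<eta>s n) (fst z) (snd z) - Dw0 (fst z) - m (\<eta>s n) * Dv0 (fst z) (snd z)) * g (fst z) (snd z) =
            m (\<eta>s n) * (K.corr_quot n z * g (fst z) (snd z) - K.corr_deriv z * g (fst z) (snd z))"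
          using diff[of n] by eventually_elim (simp add: Dv0_Y0 algebra_simps)
      qed measurable
      then show ?thesis using i[of n] i0 by simp
    qed
    show ?thesis
    \<comment> \<open>The estimate |m X / m| \<le> |X| also covers m = 0, where the quotient is 0 by
      convention.\<close>
    proof (rule tendsto_0_le[where K=1])
      show "(\<lambda>n. (\<integral>z. K.corr_quot n z * g (fst z) (snd z) \<partial>CM) - (\<integral>z. K.corr_deriv z * g (fst z) (snd z) \<partial>CM)) \<longlonglongrightarrow> 0"
        using lim by (simp add: LIM_zero_iff)
    qed (auto simp: eq)
  qed

  define T1 where "T1 = (\<integral>x. (\<integral>\<omega>. b0 x \<omega> \<partial>M) * c_per x * (Dw0 x + 1) \<partial>cell)"
  define T2 where "T2 = (\<integral>x. a_per x * (\<integral>\<omega>. Dv0 x \<omega> \<partial>M) \<partial>cell)"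
  \<comment> \<open>The two correction terms add up to the mean of the linearised flux, which
    \<open>flux0\<close> shows to be constant.\<close>
  have T: "T1 + T2 = K.flux_deriv"
  proof -
    have [measurable]: "Dw0 \<in> borel_measurable cell" by (rule borel_measurable_cell[OF per(1)])
    have i1: "integrable CM (\<lambda>z. u0 z * (c_per (fst z) * (Dw0 (fst z) + 1)))"
    proof (rule K.integrable_AE_bounded_mult[OF u0i])
      show "AE z in CM. \<bar>c_per (fst z) * (Dw0 (fst z) + 1)\<bar> \<le> (\<beta> - \<alpha>) / Mb * (C0 / \<alpha>)"
        using K.c_bound K.A_bound AE_fst[OF AE_cellI[OF per(2)]]
      proof eventually_elim
        case (elim z)
        have "Dw0 (fst z) + 1 = C0 / a_per (fst z)" using elim(2,3) alpha_pos by (simp add: field_simps)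
        then have "\<bar>Dw0 (fst z) + 1\<bar> \<le> C0 / \<alpha>"
          using abs_divide_le[of C0 C0 \<alpha> "a_per (fst z)"] elim(2) alpha_pos K.C_bounds(3) by simp
        then show ?case unfolding abs_mult using elim(1) by (intro mult_mono) auto
      qed
    qed measurable
    have i2: "integrable CM (\<lambda>z. Dv0 (fst z) (snd z) * a_per (fst z))"
      by (rule K.integrable_AE_bounded_mult[OF Dv0i, of _ \<beta>]) (measurable, use K.A_bound alpha_pos in \<open>auto elim: eventually_mono\<close>)
    have "T1 = (\<integral>x. \<integral>\<omega>. u0 (x, \<omega>) * (c_per x * (Dw0 x + 1)) \<partial>M \<partial>cell)"
      unfolding T1_def u0_def by (simp add: mult.assoc)
    also have "\<dots> = (\<integral>z. u0 z * (c_per (fst z) * (Dw0 (fst z) + 1)) \<partial>CM)"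
      using P.integral_fst'[OF i1] by simp
    finally have T1: "T1 = (\<integral>z. u0 z * (c_per (fst z) * (Dw0 (fst z) + 1)) \<partial>CM)" .
    have "T2 = (\<integral>x. \<integral>\<omega>. Dv0 x \<omega> * a_per x \<partial>M \<partial>cell)"
      unfolding T2_def by (simp add: mult.commute)
    also have "\<dots> = (\<integral>z. Dv0 (fst z) (snd z) * a_per (fst z) \<partial>CM)"
      using P.integral_fst'[OF i2] by simp
    finally have "T1 + T2 = (\<integral>z. u0 z * (c_per (fst z) * (Dw0 (fst z) + 1)) + Dv0 (fst z) (snd z) * a_per (fst z) \<partial>CM)"
      unfolding T1 using i1 i2 by simp
    also have "\<dots> = (\<integral>z. K.flux_deriv \<partial>CM)"
    proof (rule integral_cong_AE)
      note [measurable] = field_measurable_cell[OF Dv0m]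
      show "(\<lambda>z. u0 z * (c_per (fst z) * (Dw0 (fst z) + 1)) + Dv0 (fst z) (snd z) * a_per (fst z)) \<in> borel_measurable CM"
        by measurable
      show "AE z in CM. u0 z * (c_per (fst z) * (Dw0 (fst z) + 1)) + Dv0 (fst z) (snd z) * a_per (fst z) = K.flux_deriv"
        using AE_fst[OF AE_cellI[OF flux0]]
      proof eventually_elim
        case (elim z)
        from elim[rule_format, of "snd z"] show ?case by (simp add: u0_def ac_simps)
      qed
    qed simp
    finally show ?thesis using P.prob_space by simp
  qed
  have homog: "(\<lambda>n. (astar (\<eta>s n) - astar_per - m (\<eta>s n) * T1 - m (\<eta>s n) * T2) / m (\<eta>s n)) \<longlonglongrightarrow> 0"
  proof (rule tendsto_0_le[where K=1])
    show "(\<lambda>n. K.rate n * C n * C0 - K.flux_deriv) \<longlonglongrightarrow> 0" using K.C_rate_tendsto by (simp add: LIM_zero_iff)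
    have eq: "astar (\<eta>s n) - astar_per - m (\<eta>s n) * T1 - m (\<eta>s n) * T2 = m (\<eta>s n) * (K.rate n * C n * C0 - K.flux_deriv)" for n
    proof -
      have "astar (\<eta>s n) - astar_per - m (\<eta>s n) * T1 - m (\<eta>s n) * T2 = (C n - C0) - m (\<eta>s n) * (T1 + T2)"
        by (simp add: C_def C0_def algebra_simps)
      also have "\<dots> = m (\<eta>s n) * (K.rate n * C n * C0 - K.flux_deriv)"
        unfolding T K.C_diff by (simp only: right_diff_distrib)
      finally show ?thesis .
    qed
    show "\<forall>\<^sub>F n in sequentially. norm ((astar (\<eta>s n) - astar_per - m (\<eta>s n) * T1 - m (\<eta>s n) * T2) / m (\<eta>s n))
        \<le> norm (K.rate n * C n * C0 - K.flux_deriv) * 1"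
      unfolding eq by (intro always_eventually allI) simp
  qed
  have Linf: "Linf_Lp_norm M p b0 < \<infinity>"
    using u0_ball by (intro Linf_Lp_norm_finite[OF p_gt]) (simp add: u0_def[abs_def])
  show ?thesis
    using \<eta>s \<eta>s_lim b0m b0s Linf weak_star v0m Dv0m Dv0s Dv0i pde mean weak homog[unfolded T1_def T2_def]
    by (intro exI[of _ \<eta>s] exI[of _ b0] conjI exI[of _ v0] exI[of _ Dv0]) auto
qed

end
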